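(* Let $k\ge 2$, $m\ge1$, $\Delta\ge 3$ and $n\ge 2$ be integers, let $m^*=m-n(\Delta-2)$, and let $T$ be a caterpillar in $\mathbb{T}_k(m,\Delta,n)$. Then $\rho(T)\le \rho(C_k(m^*,\Delta,\lfloor n/2\rfloor,\lceil n/2\rceil))$, with equality if and only if $T\cong C_k(m^*,\Delta,\lfloor n/2\rfloor,\lceil n/2\rceil)$.
   Context: A hypergraph $G$ is $k$-uniform if every edge is a $k$-element subset of $V(G)$. The degree of a vertex is the number of edges containing it. A path from $u$ to $v$ is a sequence $(v_0,e_1,v_1,\dots,e_p,v_p)$ with $v_0=u$, $v_p=v$, $v_{i-1},v_i\in e_i$, $v_{i-1}\ne v_i$, all $v_i$ and $e_i$ distinct; its length is $p$. A cycle is such a sequence with at least two distinct edges, all $v_i,e_i$ distinct except $v_0=v_p$. A hypertree is a connected hypergraph with no cycles. $d_G(u,v)$ is the length of a shortest $u$–$v$ path, $D(G)=(d_G(u,v))$ is the distance matrix and $\rho(G)$, the distance spectral radius, is its largest eigenvalue. A $k$-uniform loose path $P^k_m=(u_0,e_1,u_1,\dots,u_{m-1},e_m,u_m)$ is a $k$-uniform hypertree with $m$ edges in which $u_1,\dots,u_{m-1}$ have degree $2$ and all other vertices have degree $1$. A $k$-uniform hyperstar $S^k_l$ is a $k$-uniform hypertree with $l$ edges sharing a common vertex (its center). A caterpillar is a $k$-uniform hypertree obtained from a loose path by choosing some vertices of the path and, at each chosen vertex, identifying a root vertex of a vertex-disjoint copy of a $k$-uniform hyperstar with that vertex. For integers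 $\Delta\ge 3$, $a,b\ge 0$ with $a+b<m$, $C_k(m,\Delta,a,b)$ is obtained from $P^k_m$ by attaching, for each $i$ with $1\le i\le a$ or $m-b\le i\le m-1$, a copy of $S^k_{\Delta-2}$ by identifying its center with $u_i$. $\mathbb{T}_k(m,\Delta,n)$ is the set of $k$-uniform hypertrees with $m$ edges, maximum degree $\Delta$, and exactly $n$ vertices of degree $\Delta$. *)

theory Defs
  imports Complex_Main
begin

definition uniform :: "nat \<Rightarrow> 'a set \<Rightarrow> 'a set set \<Rightarrow> bool" where
  "uniform k V E \<longleftrightarrow> (\<forall>e\<in>E. e \<subseteq> V \<and> card e = k)"

definition degree :: "'a set set \<Rightarrow> 'a \<Rightarrow> nat" where
  "degree E v = card {e\<in>E. v \<in> e}"

definition max_degree :: "'a set \<Rightarrow> 'a set set \<Rightarrow> nat" where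
  "max_degree V E = Max (degree E ` V)"

definition is_path :: "'a set set \<Rightarrow> 'a list \<Rightarrow> 'a set list \<Rightarrow> 'a \<Rightarrow> 'a \<Rightarrow> bool" where
  "is_path E vs es u v \<longleftrightarrow>
     length vs = length es + 1 \<and> set es \<subseteq> E \<and>
     hd vs = u \<and> last vs = v \<and>
     (\<forall>i<length es. vs ! i \<in> es ! i \<and> vs ! (i+1) \<in> es ! i \<and> vs ! i \<noteq> vs ! (i+1)) \<and>
     distinct vs \<and> distinct es"

definition is_cycle :: "'a set set \<Rightarrow> 'a list \<Rightarrow> 'a set list \<Rightarrow> bool" where
  "is_cycle E vs es \<longleftrightarrow>
     length vs = length es + 1 \<and> set es \<subseteq> E \<and> length es \<ge> 2 \<and>
     hd vs = last vs \<and>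
     (\<forall>i<length es. vs ! i \<in> es ! i \<and> vs ! (i+1) \<in> es ! i \<and> vs ! i \<noteq> vs ! (i+1)) \<and>
     distinct (tl vs) \<and> distinct es"

definition connected_hg :: "'a set \<Rightarrow> 'a set set \<Rightarrow> bool" where
  "connected_hg V E \<longleftrightarrow> (\<forall>u\<in>V. \<forall>v\<in>V. \<exists>vs es. is_path E vs es u v)"

definition hypertree :: "'a set \<Rightarrow> 'a set set \<Rightarrow> bool" where
  "hypertree V E \<longleftrightarrow> connected_hg V E \<and> \<not> (\<exists>vs es. is_cycle E vs es)"

definition hdist :: "'a set set \<Rightarrow> 'a \<Rightarrow> 'a \<Rightarrow> nat" where
  "hdist E u v = (LEAST p. \<exists>vs es. is_path E vs es u v \<and> length es = p)"

definition dist_eigenvalues :: "'a set \<Rightarrow> 'a set set \<Rightarrow> real set" where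
  "dist_eigenvalues V E = {lam. \<exists>x :: 'a \<Rightarrow> real. (\<exists>u\<in>V. x u \<noteq> 0) \<and>
      (\<forall>u\<in>V. (\<Sum>w\<in>V. real (hdist E u w) * x w) = lam * x u)}"

definition dist_spectral_radius :: "'a set \<Rightarrow> 'a set set \<Rightarrow> real" where
  "dist_spectral_radius V E = Max (dist_eigenvalues V E)"

definition hg_iso :: "'a set \<Rightarrow> 'a set set \<Rightarrow> 'b set \<Rightarrow> 'b set set \<Rightarrow> bool" where
  "hg_iso V E V' E' \<longleftrightarrow> (\<exists>f. bij_betw f V V' \<and> E' = (\<lambda>e. f ` e) ` E)"

definition loose_path :: "'a list \<Rightarrow> 'a set list \<Rightarrow> bool" where
  "loose_path us es \<longleftrightarrow>
     length es \<ge> 1 \<and> length us = length es + 1 \<and> distinct es \<and>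
     (\<forall>i<length es. us ! i \<in> es ! i \<and> us ! (i+1) \<in> es ! i \<and> us ! i \<noteq> us ! (i+1)) \<and>
     hypertree (\<Union>(set es)) (set es) \<and>
     (\<forall>i. 1 \<le> i \<and> i < length es \<longrightarrow> degree (set es) (us ! i) = 2) \<and>
     (\<forall>v\<in>\<Union>(set es). v \<notin> {us ! i | i. 1 \<le> i \<and> i < length es} \<longrightarrow> degree (set es) v = 1)"

text \<open>Caterpillar: a loose path in the hypergraph, plus edges forming vertex-disjoint hyperstars
  whose centres (roots) are identified with vertices of the path.\<close>
definition caterpillar :: "'a set \<Rightarrow> 'a set set \<Rightarrow> bool" where
  "caterpillar V E \<longleftrightarrow>
     (\<exists>us es. loose_path us es \<and> set es \<subseteq> E \<and>
        V = \<Union>(set es) \<union> \<Union>(E - set es) \<and>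
        (\<forall>f\<in>E - set es. \<exists>r. f \<inter> \<Union>(set es) = {r}) \<and>
        (\<forall>f\<in>E - set es. \<forall>f'\<in>E - set es. f \<noteq> f' \<longrightarrow> f \<inter> f' \<subseteq> \<Union>(set es)))"

text \<open>Vertices are triples: u_i = (0,i,0); internal vertices of e_i are (1,i,j), 1 \<le> j \<le> k-2;
  the t-th pendant star edge at u_i has non-centre vertices (t+1,i,j), 1 \<le> j \<le> k-1.\<close>
definition C_path_edge :: "nat \<Rightarrow> nat \<Rightarrow> (nat \<times> nat \<times> nat) set" where
  "C_path_edge k i = {(0, i-1, 0), (0, i, 0)} \<union> {(1, i, j) | j. 1 \<le> j \<and> j \<le> k - 2}"

definition C_star_edge :: "nat \<Rightarrow> nat \<Rightarrow> nat \<Rightarrow> (nat \<times> nat \<times> nat) set" where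
  "C_star_edge k i t = {(0, i, 0)} \<union> {(t+1, i, j) | j. 1 \<le> j \<and> j \<le> k - 1}"

definition C_edges :: "nat \<Rightarrow> nat \<Rightarrow> nat \<Rightarrow> nat \<Rightarrow> nat \<Rightarrow> (nat \<times> nat \<times> nat) set set" where
  "C_edges k m \<Delta> a b =
     {C_path_edge k i | i. 1 \<le> i \<and> i \<le> m} \<union>
     {C_star_edge k i t | i t. ((1 \<le> i \<and> i \<le> a) \<or> (m - b \<le> i \<and> i \<le> m - 1)) \<and>
                               1 \<le> t \<and> t \<le> \<Delta> - 2}"

definition C_verts :: "nat \<Rightarrow> nat \<Rightarrow> nat \<Rightarrow> nat \<Rightarrow> nat \<Rightarrow> (nat \<times> nat \<times> nat) set" where
  "C_verts k m \<Delta> a b = \<Union>(C_edges k m \<Delta> a b)"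

end

theory Submission
  imports Defs "HOL-Analysis.Function_Topology"
begin

text \<open>
  Among the finitely many hypergraphs on the given vertex set that satisfy the hypotheses take one,
  \<open>E\<close>, whose distance spectral radius is maximal. Moving a bundle of pendant edges from \<open>w\<close> to \<open>w'\<close>
  changes the distance quadratic form at the Perron vector by a positive multiple of the difference
  of the weighted transmissions of \<open>w'\<close> and \<open>w\<close> in the rest of the hypertree. These transmissions are
  strictly convex along the path, so a bundle strictly between two admissible positions can always
  be moved to one of them with gain. By maximality all pendant edges sit at vertices of degree
  \<open>\<Delta>\<close>, and these vertices form an initial and a final segment of the path, of sizes \<open>a\<close> and \<open>b\<close>.
  Pendant edges at inner vertices of path edges are excluded by moving them to the lighter end of
  a longest path. Finally \<open>a\<close> and \<open>b\<close> differ by at most \<open>1\<close>: to move a bundle from the longer segment to the shorter one, test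
  the difference of the distance matrices against the Perron vectors of both hypertrees; a discrete
  maximum principle, applied to the difference of a Perron vector and its reflection, gives the sign.
\<close>

section \<open>The Perron vector\<close>

text \<open>A move must keep the number of vertices of degree \<open>\<Delta>\<close>. A whole
  bundle is therefore moved only to a vertex without pendant edges that lies on equally many path
  edges, so that the two degrees are exchanged; a single pendant edge is moved only from a vertex of
  degree below \<open>\<Delta>\<close> to a bare end of the path, whose degree becomes 2. The path
  is taken as long as possible because a pendant edge at an end would lengthen it: the ends are then
  bare and can serve as targets. In the balancing step one Perron vector is not enough. Its entries
  at the two roots include the influence of the moved bundle itself, so their order does not decide
  the order of the transmissions in the rest; in the bilinear form of both Perron vectors these
  influences have opposite signs. \<open>C\<close> is never rebuilt on the given vertex set: a
  maximizer exists by finiteness, every maximizer is isomorphic to \<open>C\<close>, and the radius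
  is invariant under isomorphism.\<close>

definition bform :: "'a set \<Rightarrow> ('a \<Rightarrow> 'a \<Rightarrow> real) \<Rightarrow> ('a \<Rightarrow> real) \<Rightarrow> ('a \<Rightarrow> real) \<Rightarrow> real" where
  "bform V d x y = (\<Sum>u\<in>V. \<Sum>w\<in>V. d u w * x u * y w)"

definition eigenpair :: "'a set \<Rightarrow> ('a \<Rightarrow> 'a \<Rightarrow> real) \<Rightarrow> real \<Rightarrow> ('a \<Rightarrow> real) \<Rightarrow> bool" where
  "eigenpair V d lam x \<longleftrightarrow> (\<exists>u\<in>V. x u \<noteq> 0) \<and> (\<forall>u\<in>V. (\<Sum>w\<in>V. d u w * x w) = lam * x u)"

lemma bform_left:
  "bform V d x y = (\<Sum>u\<in>V. x u * (\<Sum>w\<in>V. d u w * y w))"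
  by (simp add: bform_def sum_distrib_left mult_ac)

lemma bform_eigen:
  assumes "\<forall>u\<in>V. (\<Sum>w\<in>V. d u w * y w) = lam * y u"
  shows "bform V d x y = lam * (\<Sum>u\<in>V. x u * y u)"
proof -
  have "bform V d x y = (\<Sum>u\<in>V. x u * (lam * y u))"
    unfolding bform_left using assms by (intro sum.cong) auto
  then show ?thesis by (simp add: sum_distrib_left mult_ac)
qed

lemma bform_commute:
  assumes "\<And>u w. u \<in> V \<Longrightarrow> w \<in> V \<Longrightarrow> d u w = d w u"
  shows "bform V d x y = bform V d y x"
  unfolding bform_def by (subst sum.swap, intro sum.cong refl) (simp add: assms mult_ac)

lemma ip_pos:
  fixes x :: "'a \<Rightarrow> real"
  assumes "finite V" "\<exists>u\<in>V. x u \<noteq> 0"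
  shows "(\<Sum>u\<in>V. x u * x u) > 0"
proof -
  obtain u where "u \<in> V" "x u \<noteq> 0" using assms(2) by blast
  then show ?thesis
    using assms(1) by (intro sum_pos2[of V u]) (auto simp: zero_less_mult_iff neq_iff)
qed

text \<open>Bessel's inequality applied to the indicator functions of the points of \<open>V\<close> shows
  that there are at most \<open>card V\<close> pairwise orthogonal unit vectors.\<close>

lemma finite_eigenvalues:
  assumes fin: "finite V" and sym: "\<And>u w. u \<in> V \<Longrightarrow> w \<in> V \<Longrightarrow> d u w = d w u"
  shows "finite {lam. \<exists>x. eigenpair V d lam x}"
proof (rule ccontr)
  assume "infinite {lam. \<exists>x. eigenpair V d lam x}"
  then obtain S where S: "S \<subseteq> {lam. \<exists>x. eigenpair V d lam x}" "finite S" "card S = Suc (card V)"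
    using infinite_arbitrarily_large by blast
  define y where "y lam = (SOME x. eigenpair V d lam x)" for lam
  have y: "eigenpair V d lam (y lam)" if mem: "lam \<in> S" for lam
  proof -
    obtain x where "eigenpair V d lam x" using S(1) mem by blast
    then show ?thesis unfolding y_def by (rule someI[of "eigenpair V d lam"])
  qed
  define z where "z lam u = y lam u / sqrt (\<Sum>w\<in>V. y lam w * y lam w)" for lam u
  have unit: "(\<Sum>u\<in>V. z lam u * z lam u) = 1" if "lam \<in> S" for lam
  proof -
    have p: "(\<Sum>w\<in>V. y lam w * y lam w) > 0"
      using y[OF that] fin by (auto simp: eigenpair_def intro: ip_pos)
    have "(\<Sum>u\<in>V. z lam u * z lam u) = (\<Sum>u\<in>V. y lam u * y lam u / (\<Sum>w\<in>V. y lam w * y lam w))"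
      unfolding z_def using p by (intro sum.cong refl) (simp add: field_simps)
    then show ?thesis using p by (simp flip: sum_divide_distrib)
  qed
  have orth: "(\<Sum>u\<in>V. z a u * z b u) = 0" if ab: "a \<in> S" "b \<in> S" "a \<noteq> b" for a b
  proof -
    have ea: "bform V d (y b) (y a) = a * (\<Sum>u\<in>V. y b u * y a u)"
      and eb: "bform V d (y a) (y b) = b * (\<Sum>u\<in>V. y a u * y b u)"
      using y[OF ab(1)] y[OF ab(2)] by (auto simp: eigenpair_def intro!: bform_eigen)
    have c: "(\<Sum>u\<in>V. y b u * y a u) = (\<Sum>u\<in>V. y a u * y b u)"
      by (simp add: mult.commute)
    have "a * (\<Sum>u\<in>V. y a u * y b u) = b * (\<Sum>u\<in>V. y a u * y b u)"
      using ea eb bform_commute[where V=V and x="y a" and y="y b", OF sym] unfolding c by simp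
    then have 0: "(\<Sum>u\<in>V. y a u * y b u) = 0" using ab(3) by simp
    have "(\<Sum>u\<in>V. z a u * z b u)
       = (\<Sum>u\<in>V. y a u * y b u) / (sqrt (\<Sum>w\<in>V. y a w * y a w) * sqrt (\<Sum>w\<in>V. y b w * y b w))"
      unfolding z_def sum_divide_distrib by (intro sum.cong refl) simp
    then show ?thesis using 0 by simp
  qed
  have bessel: "(\<Sum>lam\<in>S. (z lam v)\<^sup>2) \<le> 1" if v: "v \<in> V" for v
  proof -
    define c where "c lam = z lam v" for lam
    have sq: "(of_bool (u = v))\<^sup>2 = (of_bool (u = v) :: real)" for u by (cases "u = v") auto
    \<comment> \<open>Squared norm of the indicator of \<open>v\<close> minus its projection onto
      the span of the \<open>z lam\<close>; expanding it leaves 1 minus the sum of the squared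
      coefficients.\<close>
    have "0 \<le> (\<Sum>u\<in>V. (of_bool (u = v) - (\<Sum>lam\<in>S. c lam * z lam u))\<^sup>2)"
      by (intro sum_nonneg) simp
    also have "\<dots> = (\<Sum>u\<in>V. of_bool (u = v)) - 2 * (\<Sum>u\<in>V. of_bool (u = v) * (\<Sum>lam\<in>S. c lam * z lam u))
        + (\<Sum>u\<in>V. (\<Sum>lam\<in>S. c lam * z lam u)\<^sup>2)"
      by (simp add: power2_diff sum.distrib sum_subtractf sum_distrib_left mult_ac sq)
    also have "(\<Sum>u\<in>V. of_bool (u = v)) = (1::real)" using v fin by simp
    also have "(\<Sum>u\<in>V. of_bool (u = v) * (\<Sum>lam\<in>S. c lam * z lam u)) = (\<Sum>lam\<in>S. (c lam)\<^sup>2)"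
    proof -
      have "of_bool (u = v) * r = (if u = v then r else 0)" for u and r :: real by simp
      then show ?thesis using v fin by (simp add: c_def power2_eq_square del: of_bool_eq_iff)
    qed
    also have "(\<Sum>u\<in>V. (\<Sum>lam\<in>S. c lam * z lam u)\<^sup>2)
        = (\<Sum>u\<in>V. \<Sum>a\<in>S. \<Sum>b\<in>S. (c a * c b) * (z a u * z b u))"
      by (simp add: power2_eq_square sum_product mult_ac)
    also have "\<dots> = (\<Sum>a\<in>S. \<Sum>b\<in>S. (c a * c b) * (\<Sum>u\<in>V. z a u * z b u))"
      by (simp add: sum_distrib_left sum.swap[of _ _ V])
    also have "\<dots> = (\<Sum>a\<in>S. \<Sum>b\<in>S. if a = b then (c a)\<^sup>2 else 0)"
      by (intro sum.cong refl) (auto simp: orth unit power2_eq_square)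
    also have "\<dots> = (\<Sum>a\<in>S. (c a)\<^sup>2)" using S(2) by simp
    finally show ?thesis by (simp add: c_def)
  qed
  have "real (card S) = (\<Sum>lam\<in>S. \<Sum>v\<in>V. (z lam v)\<^sup>2)"
    by (simp add: unit power2_eq_square)
  also have "\<dots> = (\<Sum>v\<in>V. \<Sum>lam\<in>S. (z lam v)\<^sup>2)" by (rule sum.swap)
  also have "\<dots> \<le> (\<Sum>v\<in>V. 1)" by (intro sum_mono bessel)
  finally show False using S(3) by simp
qed

text \<open>First-order condition at a maximum in algebraic form: the expression is what remains of
  a quadratic in \<open>t\<close> with its maximum at 0.\<close>

lemma linear_coeff_zero:
  fixes a b :: real
  assumes "\<And>t. a * t + b * t\<^sup>2 \<le> 0"
  shows "a = 0"
proof (rule ccontr)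
  assume a: "a \<noteq> 0"
  \<comment> \<open>With this \<open>p\<close> the choice \<open>t = a / p\<close> gives
    \<open>a\<^sup>2 * (p + b) / p\<^sup>2\<close>, which is positive for either sign of
    \<open>b\<close>.\<close>
  define p where "p = 1 + \<bar>b\<bar>"
  have p: "p > 0" "p + b > 0" unfolding p_def by linarith+
  have "a * (a / p) + b * (a / p)\<^sup>2 = a\<^sup>2 * (p + b) / p\<^sup>2"
    using p(1) by (simp add: field_simps power2_eq_square)
  also have "\<dots> > 0" using a p by (intro divide_pos_pos mult_pos_pos) auto
  finally show False using assms[of "a / p"] by linarith
qed

text \<open>Compactness of the unit sphere, carried out on functions on the whole type: coordinates
  outside \<open>V\<close> are pinned to 0 and those in \<open>V\<close> kept in [-1, 1], so that
  Tychonoff applies, and the norm condition is closed. \<open>M\<close> is the maximal Rayleigh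
  quotient.\<close>

lemma bform_maximizer:
  assumes fin: "finite V" and ne: "V \<noteq> {}"
  obtains z M where "(\<Sum>u\<in>V. (z u)\<^sup>2) = 1" "bform V d z z = M"
    "\<And>x. bform V d x x \<le> M * (\<Sum>u\<in>V. (x u)\<^sup>2)"
proof -
  define K where "K = (\<Pi>\<^sub>E i\<in>(UNIV::'a set). if i \<in> V then {-1..1} else {0::real})"
  define S where "S = {x. (\<Sum>u\<in>V. (x u)\<^sup>2) = (1::real)}"
  have "compactin (product_topology (\<lambda>i::'a. euclidean :: real topology) UNIV) K"
    unfolding K_def compactin_PiE by auto
  then have "compact K"
    by (simp add: euclidean_product_topology)
  moreover have "closed S"
    unfolding S_def by (intro closed_Collect_eq continuous_intros continuous_on_product_coordinates)
  ultimately have cKS: "compact (K \<inter> S)" by (rule compact_Int_closed)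
  obtain v where v: "v \<in> V" using ne by blast
  have "(\<lambda>u. of_bool (u = v)) \<in> K \<inter> S"
    using v fin by (auto simp: K_def S_def PiE_def power2_eq_square)
  then have neKS: "K \<inter> S \<noteq> {}" by blast
  have "continuous_on (K \<inter> S) (\<lambda>x. bform V d x x)"
    unfolding bform_def
    by (intro continuous_intros continuous_on_subset[OF continuous_on_product_coordinates]) auto
  from continuous_attains_sup[OF cKS neKS this]
  obtain z where z: "z \<in> K \<inter> S" and max: "\<And>x. x \<in> K \<inter> S \<Longrightarrow> bform V d x x \<le> bform V d z z"
    by blast
  have "bform V d x x \<le> bform V d z z * (\<Sum>u\<in>V. (x u)\<^sup>2)" for x
  proof (cases "\<exists>u\<in>V. x u \<noteq> 0")
    case False
    then have "bform V d x x = 0" by (simp add: bform_def)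
    with False show ?thesis by simp
  next
    case True
    define N where "N = (\<Sum>u\<in>V. (x u)\<^sup>2)"
    have N: "N > 0" unfolding N_def using ip_pos[OF fin True] by (simp add: power2_eq_square)
    define y where "y u = (if u \<in> V then x u / sqrt N else 0)" for u
    have yS: "(\<Sum>u\<in>V. (y u)\<^sup>2) = 1"
    proof -
      have "(\<Sum>u\<in>V. (y u)\<^sup>2) = (\<Sum>u\<in>V. (x u)\<^sup>2 / N)"
        using N by (intro sum.cong refl) (simp add: y_def power_divide)
      then show ?thesis using N by (simp add: N_def flip: sum_divide_distrib)
    qed
    have "- 1 \<le> y u \<and> y u \<le> 1" if "u \<in> V" for u
    proof -
      have "(y u)\<^sup>2 \<le> (\<Sum>u\<in>V. (y u)\<^sup>2)" using that fin by (intro member_le_sum) auto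
      then show ?thesis using yS by (simp add: abs_square_le_1 abs_le_iff)
    qed
    moreover have "y u = 0" if "u \<notin> V" for u using that by (simp add: y_def)
    ultimately have "y \<in> K \<inter> S" using yS by (auto simp: K_def S_def)
    then have "bform V d y y \<le> bform V d z z" by (rule max)
    moreover have "bform V d y y = bform V d x x / N"
      using N unfolding bform_def sum_divide_distrib
      by (intro sum.cong refl) (simp add: y_def)
    ultimately show ?thesis using N by (simp add: N_def field_simps)
  qed
  with z show ?thesis by (intro that[of z "bform V d z z"]) (auto simp: S_def)
qed

text \<open>Perturb \<open>z\<close> by \<open>t\<close> times the indicator of \<open>v\<close>:
  \<open>M\<close> times the squared norm minus the form stays nonnegative and is 0 at
  \<open>t = 0\<close>, so its linear coefficient vanishes. That coefficient encodes the eigenvalue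
  equation at \<open>v\<close>.\<close>

lemma maximizer_eigen:
  assumes fin: "finite V" and sym: "\<And>u w. u \<in> V \<Longrightarrow> w \<in> V \<Longrightarrow> d u w = d w u"
    and ub: "\<And>x. bform V d x x \<le> M * (\<Sum>u\<in>V. (x u)\<^sup>2)"
    and z: "bform V d z z = M * (\<Sum>u\<in>V. (z u)\<^sup>2)" and v: "v \<in> V"
  shows "(\<Sum>w\<in>V. d v w * z w) = M * z v"
proof -
  define h where "h u = (of_bool (u = v) :: real)" for u
  have lin: "bform V d (\<lambda>u. z u + t * h u) (\<lambda>u. z u + t * h u)
      = bform V d z z + t * (bform V d h z + bform V d z h) + t\<^sup>2 * bform V d h h" for t
    unfolding bform_def sum_distrib_left sum.distrib[symmetric]
    by (intro sum.cong refl) (simp add: algebra_simps power2_eq_square)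
  have hz: "bform V d h z = (\<Sum>w\<in>V. d v w * z w)"
    unfolding bform_left h_def using fin v by simp
  have zh: "(\<Sum>u\<in>V. (z u + t * h u)\<^sup>2) = (\<Sum>u\<in>V. (z u)\<^sup>2) + 2 * t * z v + t\<^sup>2" for t
  proof -
    have "(\<Sum>u\<in>V. (z u + t * h u)\<^sup>2)
        = (\<Sum>u\<in>V. (z u)\<^sup>2 + (2 * t * z u * of_bool (u = v) + t\<^sup>2 * of_bool (u = v)))"
      by (intro sum.cong refl) (simp add: h_def power2_sum)
    then show ?thesis using fin v by (simp add: sum.distrib flip: sum_distrib_left)
  qed
  have "2 * ((\<Sum>w\<in>V. d v w * z w) - M * z v) * t + (bform V d h h - M) * t\<^sup>2 \<le> 0" for t
  proof -
    have "bform V d z h = bform V d h z" by (rule bform_commute[OF sym])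
    then have "bform V d z z + 2 * t * (\<Sum>w\<in>V. d v w * z w) + t\<^sup>2 * bform V d h h
       \<le> M * ((\<Sum>u\<in>V. (z u)\<^sup>2) + 2 * t * z v + t\<^sup>2)"
      using ub[of "\<lambda>u. z u + t * h u"] unfolding lin zh hz by (simp add: mult_ac)
    then show ?thesis unfolding z by (simp add: algebra_simps)
  qed
  from linear_coeff_zero[OF this] show ?thesis by simp
qed

text \<open>Taking absolute values cannot lower the form because the entries of \<open>d\<close> are
  nonnegative, so a nonnegative maximizer exists and is an eigenvector; a zero at one point would
  spread to all others through the positive off-diagonal entries. Its value \<open>M\<close> bounds
  every Rayleigh quotient and hence every eigenvalue; identifying it with \<open>Max\<close> also
  takes finiteness of the set of eigenvalues.\<close>

lemma perron:
  assumes fin: "finite V" and two: "a \<in> V" "b \<in> V" "a \<noteq> b"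
    and sym: "\<And>u w. u \<in> V \<Longrightarrow> w \<in> V \<Longrightarrow> d u w = d w u"
    and pos: "\<And>u w. u \<in> V \<Longrightarrow> w \<in> V \<Longrightarrow> u \<noteq> w \<Longrightarrow> d u w > 0"
    and diag: "\<And>u. u \<in> V \<Longrightarrow> d u u = 0"
    and \<rho>: "\<rho> = Max {lam. \<exists>x. eigenpair V d lam x}"
  shows "\<exists>x. (\<forall>u\<in>V. x u > 0) \<and> (\<forall>u\<in>V. (\<Sum>w\<in>V. d u w * x w) = \<rho> * x u)"
    and "bform V d y y \<le> \<rho> * (\<Sum>u\<in>V. y u * y u)"
proof -
  have nn: "d u w \<ge> 0" if "u \<in> V" "w \<in> V" for u w
    using pos[of u w] diag[of u] that by (cases "u = w") (auto simp: less_imp_le)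
  obtain z M where z: "(\<Sum>u\<in>V. (z u)\<^sup>2) = 1" "bform V d z z = M"
    and ub: "\<And>x. bform V d x x \<le> M * (\<Sum>u\<in>V. (x u)\<^sup>2)"
    using bform_maximizer[OF fin] two(1) by blast
  define x where "x u = \<bar>z u\<bar>" for u
  have x1: "(\<Sum>u\<in>V. (x u)\<^sup>2) = 1" using z(1) by (simp add: x_def)
  have "M \<le> bform V d x x"
    unfolding z(2)[symmetric] bform_def x_def
    by (intro sum_mono) (auto simp: mult.assoc nn abs_mult[symmetric] intro!: mult_left_mono)
  then have Mx: "bform V d x x = M * (\<Sum>u\<in>V. (x u)\<^sup>2)"
    using ub[of x] by (simp add: x1)
  have ev: "(\<Sum>w\<in>V. d v w * x w) = M * x v" if "v \<in> V" for v
    by (rule maximizer_eigen[OF fin sym ub Mx that])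
  have x0: "x u \<ge> 0" for u by (simp add: x_def)
  have xpos: "x v > 0" if v: "v \<in> V" for v
  proof (rule ccontr)
    assume "\<not> x v > 0"
    then have xv: "x v = 0" using x0[of v] by simp
    then have "(\<Sum>w\<in>V. d v w * x w) = 0" using ev[OF v] by simp
    then have "\<forall>w\<in>V. d v w * x w = 0"
      by (subst (asm) sum_nonneg_eq_0_iff[OF fin]) (auto intro: mult_nonneg_nonneg nn v x0)
    then have "x w = 0" if "w \<in> V" for w
      using that pos[OF v that] xv by (cases "v = w") force+
    then show False using x1 by simp
  qed
  have "eigenpair V d M x" unfolding eigenpair_def using ev xpos two(1) by force
  moreover have "lam \<le> M" if "eigenpair V d lam y" for lam y
  proof -
    have "lam * (\<Sum>u\<in>V. y u * y u) \<le> M * (\<Sum>u\<in>V. y u * y u)"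
      using that ub[of y] bform_eigen[of V d y lam y] by (simp add: eigenpair_def power2_eq_square)
    moreover have "(\<Sum>u\<in>V. y u * y u) > 0" using that fin by (auto simp: eigenpair_def intro: ip_pos)
    ultimately show ?thesis by simp
  qed
  ultimately have "Max {lam. \<exists>x. eigenpair V d lam x} = M"
    by (intro Max_eqI finite_eigenvalues fin sym) auto
  then have "\<rho> = M" by (simp add: \<rho>)
  then show "\<exists>x. (\<forall>u\<in>V. x u > 0) \<and> (\<forall>u\<in>V. (\<Sum>w\<in>V. d u w * x w) = \<rho> * x u)"
    and "bform V d y y \<le> \<rho> * (\<Sum>u\<in>V. y u * y u)"
    using xpos ev ub[of y] by (auto simp: power2_eq_square)
qed

section \<open>Distances and isomorphisms\<close>

text \<open>A certificate for distances to \<open>t\<close>: the Lipschitz condition along edges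
  bounds every path from below, and the descent condition builds a path of length
  \<open>d v\<close>.\<close>

lemma hdist_eqI:
  fixes d :: "'a \<Rightarrow> nat"
  assumes zero: "\<And>v. v \<in> V \<Longrightarrow> d v = 0 \<longleftrightarrow> v = t"
    and lip: "\<And>e a b. e \<in> E \<Longrightarrow> a \<in> e \<Longrightarrow> b \<in> e \<Longrightarrow> d a \<le> Suc (d b)"
    and desc: "\<And>v. v \<in> V \<Longrightarrow> v \<noteq> t \<Longrightarrow> \<exists>e\<in>E. v \<in> e \<and> (\<exists>w\<in>e. w \<in> V \<and> d v = Suc (d w))"
    and v: "v \<in> V" and t: "t \<in> V"
  shows "hdist E v t = d v"
proof -
  \<comment> \<open>The last conjunct strengthens the induction: \<open>d\<close> drops by exactly
    one per step. So \<open>v\<close> cannot recur, and a recurrence of \<open>e\<close> would put a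
    vertex at least two below \<open>v\<close> into an edge containing \<open>v\<close>, against
    \<open>lip\<close>.\<close>
  have ex: "\<exists>vs es. is_path E vs es v t \<and> length es = d v \<and> (\<forall>i<length vs. d (vs ! i) + i = d v)"
    using v
  proof (induction "d v" arbitrary: v)
    case 0
    then have "v = t" using zero by metis
    then have "is_path E [v] [] v t" by (simp add: is_path_def)
    then show ?case using 0 by (intro exI[of _ "[v]"] exI[of _ "[]"]) simp
  next
    case (Suc n)
    then have "v \<noteq> t" using zero by (metis nat.distinct(1))
    then obtain e w where e: "e \<in> E" "v \<in> e" "w \<in> e" "w \<in> V" and dw: "d v = Suc (d w)"
      using desc Suc.prems by blast
    then have "n = d w" using Suc.hyps(2) by simp
    then obtain vs es where p: "is_path E vs es w t" "length es = d w"
      and dec: "\<forall>i<length vs. d (vs ! i) + i = d w"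
      using Suc.hyps(1) e(4) by blast
    have len: "length vs = Suc (length es)" and ne: "vs \<noteq> []" using p(1) by (auto simp: is_path_def)
    have hd: "vs ! 0 = w" using p(1) ne by (auto simp: is_path_def hd_conv_nth)
    have "v \<notin> set vs"
    proof
      assume "v \<in> set vs"
      then obtain i where "i < length vs" "vs ! i = v" by (auto simp: in_set_conv_nth)
      then show False using dec dw by (metis Suc_n_not_le_n le_add1)
    qed
    moreover have "e \<notin> set es"
    proof
      assume "e \<in> set es"
      then obtain i where i: "i < length es" "es ! i = e" by (auto simp: in_set_conv_nth)
      then have "vs ! (i + 1) \<in> e" using p(1) by (auto simp: is_path_def)
      then have "d v \<le> Suc (d (vs ! (i + 1)))" using lip e by blast
      moreover have "d (vs ! (i + 1)) + (i + 1) = d w" using dec i len by auto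
      ultimately show False using dw by linarith
    qed
    moreover have "v \<noteq> w" using dw by auto
    ultimately have "is_path E (v # vs) (e # es) v t"
      using p(1) e hd ne by (auto simp: is_path_def nth_Cons split: nat.splits)
    moreover have "\<forall>i<length (v # vs). d ((v # vs) ! i) + i = d v"
      using dec dw by (auto simp: nth_Cons split: nat.splits)
    ultimately show ?case using p(2) dw by (intro exI[of _ "v # vs"] exI[of _ "e # es"]) simp
  qed
  have lower: "d v \<le> length es" if p: "is_path E vs es v t" for vs es
  proof -
    have len: "length vs = Suc (length es)" and ne: "vs \<noteq> []" using p by (auto simp: is_path_def)
    have "d (vs ! 0) \<le> d (vs ! i) + i" if "i \<le> length es" for i
      using that
    proof (induction i)
      case (Suc i)
      then have "vs ! i \<in> es ! i" "vs ! (i + 1) \<in> es ! i" "es ! i \<in> E"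
        using p by (auto simp: is_path_def)
      then have "d (vs ! i) \<le> Suc (d (vs ! (i + 1)))" using lip by blast
      then show ?case using Suc by auto
    qed simp
    from this[of "length es"] have "d (vs ! 0) \<le> d (vs ! length es) + length es" by simp
    moreover have "vs ! 0 = v" using p ne by (auto simp: is_path_def hd_conv_nth)
    moreover have "vs ! length es = t" using p len ne by (auto simp: is_path_def last_conv_nth)
    moreover have "d t = 0" using zero[OF t] by simp
    ultimately show ?thesis by simp
  qed
  show "hdist E v t = d v"
    unfolding hdist_def
  proof (rule Least_equality)
    show "\<exists>vs es. is_path E vs es v t \<and> length es = d v" using ex by blast
  qed (use lower in blast)
qed

lemma is_path_image:
  assumes p: "is_path E vs es u v" and inj: "inj_on f V" and EV: "\<Union>E \<subseteq> V" and u: "u \<in> V"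
  shows "is_path ((`) f ` E) (map f vs) (map ((`) f) es) (f u) (f v)"
proof -
  have len: "length vs = Suc (length es)" and ne: "vs \<noteq> []" using p by (auto simp: is_path_def)
  have esE: "set es \<subseteq> E" using p by (simp add: is_path_def)
  have vsV: "set vs \<subseteq> V"
  proof
    fix y assume "y \<in> set vs"
    then obtain i where i: "i < length vs" "vs ! i = y" by (auto simp: in_set_conv_nth)
    show "y \<in> V"
    proof (cases i)
      case 0
      then show ?thesis using i u p ne by (auto simp: is_path_def hd_conv_nth)
    next
      case (Suc j)
      then have "y \<in> es ! j" "es ! j \<in> E" using p i len esE by (auto simp: is_path_def)
      then show ?thesis using EV by blast
    qed
  qed
  have "inj_on ((`) f) E"
    by (rule inj_on_image[OF inj_on_subset[OF inj EV]])
  then have "inj_on ((`) f) (set es)" using esE by (rule inj_on_subset)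
  moreover have "inj_on f (set vs)" using inj vsV by (rule inj_on_subset)
  moreover have "f (vs ! i) \<noteq> f (vs ! Suc i)" if "i < length es" for i
    using inj_onD[OF \<open>inj_on f (set vs)\<close>, of "vs ! i" "vs ! Suc i"] p that len
    by (auto simp: is_path_def)
  ultimately show ?thesis
    using p ne len by (auto simp: is_path_def distinct_map hd_map last_map)
qed

lemma hdist_iso:
  assumes inj: "inj_on f V" and EV: "\<Union>E \<subseteq> V" and u: "u \<in> V" "v \<in> V"
  shows "hdist ((`) f ` E) (f u) (f v) = hdist E u v"
proof -
  define g where "g = inv_into V f"
  have gf: "g (f y) = y" if "y \<in> V" for y using inj that by (simp add: g_def)
  have "g ` (f ` e) = e" if "e \<in> E" for e
    using that EV gf by (force simp: image_iff)
  then have E': "(`) g ` ((`) f ` E) = E" by (force simp: image_iff)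
  have inj': "inj_on g (f ` V)" using gf by (auto simp: inj_on_def)
  have "(\<exists>vs es. is_path ((`) f ` E) vs es (f u) (f v) \<and> length es = p)
      \<longleftrightarrow> (\<exists>vs es. is_path E vs es u v \<and> length es = p)" for p
  proof
    assume "\<exists>vs es. is_path ((`) f ` E) vs es (f u) (f v) \<and> length es = p"
    then obtain vs es where "is_path ((`) f ` E) vs es (f u) (f v)" "length es = p" by blast
    from is_path_image[OF this(1) inj'] this(2) show "\<exists>vs es. is_path E vs es u v \<and> length es = p"
      using EV u gf unfolding E' by (intro exI[of _ "map g vs"] exI[of _ "map ((`) g) es"]) auto
  next
    assume "\<exists>vs es. is_path E vs es u v \<and> length es = p"
    then obtain vs es where "is_path E vs es u v" "length es = p" by blast
    with is_path_image[OF this(1) inj EV u(1)]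
    show "\<exists>vs es. is_path ((`) f ` E) vs es (f u) (f v) \<and> length es = p"
      by (intro exI[of _ "map f vs"] exI[of _ "map ((`) f) es"]) auto
  qed
  then show ?thesis by (simp add: hdist_def)
qed

lemma dist_eigenvalues_iso_subset:
  assumes bij: "bij_betw f V V'" and EV: "\<Union>E \<subseteq> V"
  shows "dist_eigenvalues V E \<subseteq> dist_eigenvalues V' ((`) f ` E)"
proof
  fix lam assume "lam \<in> dist_eigenvalues V E"
  then obtain x u where x: "u \<in> V" "x u \<noteq> 0"
    "\<forall>u\<in>V. (\<Sum>w\<in>V. real (hdist E u w) * x w) = lam * x u"
    by (auto simp: dist_eigenvalues_def)
  have inj: "inj_on f V" and V': "V' = f ` V" using bij by (auto simp: bij_betw_def)
  define y where "y = x \<circ> inv_into V f"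
  have y: "y (f v) = x v" if "v \<in> V" for v using that inj by (simp add: y_def)
  have "(\<Sum>w\<in>V'. real (hdist ((`) f ` E) v w) * y w) = lam * y v" if v: "v \<in> V'" for v
  proof -
    obtain a where a: "a \<in> V" "v = f a" using v V' by blast
    have "(\<Sum>w\<in>V'. real (hdist ((`) f ` E) v w) * y w)
        = (\<Sum>w\<in>V. real (hdist ((`) f ` E) v (f w)) * y (f w))"
      unfolding V' by (simp add: sum.reindex[OF inj])
    also have "\<dots> = (\<Sum>w\<in>V. real (hdist E a w) * x w)"
      using a by (intro sum.cong refl) (simp add: hdist_iso[OF inj EV] y)
    finally show ?thesis using x(3) a y by simp
  qed
  moreover have "f u \<in> V'" "y (f u) \<noteq> 0" using x y V' by auto
  ultimately show "lam \<in> dist_eigenvalues V' ((`) f ` E)"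
    unfolding dist_eigenvalues_def by blast
qed

lemma dist_spectral_radius_iso:
  assumes iso: "hg_iso V E V' E'" and EV: "\<Union>E \<subseteq> V"
  shows "dist_spectral_radius V E = dist_spectral_radius V' E'"
proof -
  obtain f where f: "bij_betw f V V'" and E': "E' = (`) f ` E"
    using iso by (auto simp: hg_iso_def)
  define g where "g = inv_into V f"
  have gf: "g (f y) = y" if "y \<in> V" for y using f that by (simp add: g_def bij_betw_def)
  have "g ` (f ` e) = e" if "e \<in> E" for e
    using that EV gf by (force simp: image_iff)
  then have gE: "(`) g ` E' = E" unfolding E' by (force simp: image_iff)
  have g: "bij_betw g V' V" unfolding g_def by (rule bij_betw_inv_into[OF f])
  have EV': "\<Union>E' \<subseteq> V'" using EV f unfolding E' bij_betw_def by blast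
  have "dist_eigenvalues V E = dist_eigenvalues V' E'"
    using dist_eigenvalues_iso_subset[OF f EV] dist_eigenvalues_iso_subset[OF g EV']
    unfolding gE E'[symmetric] by blast
  then show ?thesis by (simp add: dist_spectral_radius_def)
qed

section \<open>Caterpillars in coordinates\<close>

text \<open>
  \<open>B\<close> is the vertex set of the loose path and \<open>u 0, \<dots>, u L\<close> are its consecutive path vertices. A vertex
  \<open>b\<close> of \<open>B\<close> has \<open>lo b = hi b = j\<close> if it is \<open>u j\<close>, and \<open>lo b = i\<close>, \<open>hi b = i + 1\<close> if it is an inner vertex of
  the \<open>i\<close>-th edge, counted from \<open>0\<close>. The members of \<open>F\<close> are the pendant edges without their roots.
  The roots are given by a separate function \<open>f\<close> with \<open>footed f\<close>, so that moving pendant edges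
  changes only \<open>f\<close>.
\<close>

locale spine =
  fixes k L :: nat and B :: "'a set" and lo hi :: "'a \<Rightarrow> nat" and u :: "nat \<Rightarrow> 'a"
    and F :: "'a set set"
  assumes k2: "k \<ge> 2" and L1: "L \<ge> 1" and finB: "finite B"
    and lohi: "b \<in> B \<Longrightarrow> hi b = lo b \<or> hi b = Suc (lo b)"
    and hiL: "b \<in> B \<Longrightarrow> hi b \<le> L"
    and uB: "j \<le> L \<Longrightarrow> u j \<in> B" and lou: "j \<le> L \<Longrightarrow> lo (u j) = j" and hiu: "j \<le> L \<Longrightarrow> hi (u j) = j"
    and u_uniq: "b \<in> B \<Longrightarrow> hi b = lo b \<Longrightarrow> u (lo b) = b"
    and card_inner: "i < L \<Longrightarrow> card {b\<in>B. lo b = i \<and> hi b = Suc i} = k - 2"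
    and finF: "finite F" and cardF: "g \<in> F \<Longrightarrow> card g = k - 1"
    and FB: "g \<in> F \<Longrightarrow> g \<inter> B = {}"
    and disjF: "g \<in> F \<Longrightarrow> h \<in> F \<Longrightarrow> z \<in> g \<Longrightarrow> z \<in> h \<Longrightarrow> g = h"
begin

definition V where "V = B \<union> \<Union>F"
definition pathE where "pathE i = {b\<in>B. i \<le> lo b \<and> hi b \<le> Suc i}"
definition footed where
  "footed f \<longleftrightarrow> (\<forall>b\<in>B. f b = b) \<and> (\<forall>g\<in>F. \<exists>w\<in>B. \<forall>z\<in>g. f z = w)"
definition edges where "edges f = pathE ` {..<L} \<union> (\<lambda>g. g \<union> f ` g) ` F"
text \<open>Each vertex of \<open>B\<close> is read as the interval
  [\<open>lo\<close>, \<open>hi\<close>] on the path; the value is the number of path edges covered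
  by the hull of the two intervals. Truncated subtraction silences the term that points the wrong
  way, and two inner vertices of one edge come out at distance 1.\<close>

definition bd where "bd b c = (if b = c then 0 else max (hi c - lo b) (hi b - lo c))"
definition ht :: "'a \<Rightarrow> nat" where "ht y = (if y \<in> B then 0 else 1)"
definition same where "same y t \<longleftrightarrow> (\<exists>g\<in>F. y \<in> g \<and> t \<in> g)"
text \<open>Closed form of the distance. Vertices of one pendant edge are adjacent without passing
  through the root, hence the separate case; otherwise a shortest path runs through both feet, and
  \<open>ht\<close> pays for the step to each of them.\<close>

definition dst where
  "dst f y t = (if y = t then 0 else if same y t then 1 else ht y + ht t + bd (f y) (f t))"

lemma finite_g: "g \<in> F \<Longrightarrow> finite g"
  using cardF[of g] k2 by (intro card_ge_0_finite) simp

lemma g_ne: "g \<in> F \<Longrightarrow> g \<noteq> {}"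
  using cardF k2 by fastforce

lemma finV: "finite V"
  unfolding V_def using finB finF finite_g by auto

lemma same_notB: "same y t \<Longrightarrow> y \<notin> B \<and> t \<notin> B"
  using FB by (auto simp: same_def)

lemma same_sym: "same y t \<longleftrightarrow> same t y" by (auto simp: same_def)

lemma footB: "footed f \<Longrightarrow> b \<in> B \<Longrightarrow> f b = b"
  by (simp add: footed_def)

lemma foot_in: "footed f \<Longrightarrow> y \<in> V \<Longrightarrow> f y \<in> B"
  unfolding footed_def V_def by force

lemma same_foot: "footed f \<Longrightarrow> same y t \<Longrightarrow> f y = f t"
  unfolding footed_def same_def by metis

lemma foot_image:
  assumes "footed f" "g \<in> F" "z \<in> g" shows "f ` g = {f z}"
proof -
  have "f y = f z" if "y \<in> g" for y using same_foot[OF assms(1)] that assms by (auto simp: same_def)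
  with assms(3) show ?thesis by blast
qed

lemma bd_sym: "bd b c = bd c b" by (auto simp: bd_def max.commute)

lemma bd_refl [simp]: "bd b b = 0" by (simp add: bd_def)

lemma bd_pos:
  assumes b: "b \<in> B" and c: "c \<in> B" and ne: "b \<noteq> c" shows "bd b c > 0"
proof (rule ccontr)
  assume "\<not> bd b c > 0"
  then have "hi c \<le> lo b" "hi b \<le> lo c" using ne by (auto simp: bd_def max_def split: if_splits)
  then have "hi b = lo b" "hi c = lo c" "lo b = lo c" using lohi[OF b] lohi[OF c] by auto
  then show False using u_uniq[OF b] u_uniq[OF c] ne by auto
qed

lemma bd_u:
  assumes "b \<in> B" "j \<le> L" shows "bd b (u j) = max (j - lo b) (hi b - j)"
  using assms lou hiu by (auto simp: bd_def)

lemma u_pathE: "i < L \<Longrightarrow> u i \<in> pathE i" "i < L \<Longrightarrow> u (Suc i) \<in> pathE i"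
  using uB lou hiu by (auto simp: pathE_def)

lemma pathE_B: "pathE i \<subseteq> B" by (auto simp: pathE_def)

lemma bd_lip:
  assumes "a \<in> pathE i" "b \<in> pathE i" "c \<in> B"
  shows "bd a c \<le> Suc (bd b c)"
proof -
  have "i \<le> lo a" "hi a \<le> Suc i" "i \<le> lo b" "hi b \<le> Suc i" "lo a \<le> hi a" "lo b \<le> hi b" "lo c \<le> hi c"
    using assms lohi[of a] lohi[of b] lohi[of c] by (auto simp: pathE_def)
  then show ?thesis by (auto simp: bd_def max_def)
qed

lemma bd_desc:
  assumes b: "b \<in> B" and c: "c \<in> B" and ne: "b \<noteq> c"
  shows "\<exists>i<L. b \<in> pathE i \<and> (\<exists>b'\<in>pathE i. bd b c = Suc (bd b' c))"
proof -
  note h = lohi[OF b] lohi[OF c] hiL[OF b] hiL[OF c]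
  consider "hi b = Suc (lo b)" "hi b \<le> lo c" | "hi b = Suc (lo b)" "hi c \<le> lo b"
    | "hi b = Suc (lo b)" "hi c = Suc (lo c)" "lo b = lo c"
    | "hi b = lo b" "lo b < lo c" | "hi b = lo b" "lo b = lo c" "hi c = Suc (lo c)"
    | "hi b = lo b" "hi c < lo b" | "hi b = lo b" "hi c = lo b" "hi c = Suc (lo c)"
    using h u_uniq[OF b] u_uniq[OF c] ne by (metis Suc_leI le_SucE less_Suc_eq_le linorder_less_linear not_less_eq_eq)
  then show ?thesis
  proof cases
    case 1
    then have "lo b < L" "Suc (lo b) \<le> L" using h by auto
    then have "b \<in> pathE (lo b)" "u (Suc (lo b)) \<in> pathE (lo b)"
      "bd b c = Suc (bd (u (Suc (lo b))) c)"
      using 1 b h lou hiu bd_u[OF c, of "Suc (lo b)"] ne uB u_pathE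
      by (auto simp: pathE_def bd_sym[of _ c]) (auto simp: bd_def)
    then show ?thesis using \<open>lo b < L\<close> by blast
  next
    case 2
    then have "lo b < L" using h by auto
    then have "b \<in> pathE (lo b)" "u (lo b) \<in> pathE (lo b)" "bd b c = Suc (bd (u (lo b)) c)"
      using 2 b h bd_u[OF c, of "lo b"] ne u_pathE
      by (auto simp: pathE_def bd_sym[of _ c]) (auto simp: bd_def)
    then show ?thesis using \<open>lo b < L\<close> by blast
  next
    case 3
    then have "lo b < L" using h by auto
    moreover have "b \<in> pathE (lo b)" "c \<in> pathE (lo b)" "bd b c = Suc (bd c c)"
      using 3 b c ne by (auto simp: pathE_def bd_def)
    ultimately show ?thesis by blast
  next
    case 4
    then have "lo b < L" using h by auto
    moreover have "b \<in> pathE (lo b)" "u (Suc (lo b)) \<in> pathE (lo b)"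
      "bd b c = Suc (bd (u (Suc (lo b))) c)"
      using 4 b h bd_u[OF c, of "Suc (lo b)"] ne u_pathE
      by (auto simp: pathE_def bd_sym[of _ c]) (auto simp: bd_def)
    ultimately show ?thesis by blast
  next
    case 5
    then have "lo b < L" using h by auto
    moreover have "b \<in> pathE (lo b)" "c \<in> pathE (lo b)" "bd b c = Suc (bd c c)"
      using 5 b c ne by (auto simp: pathE_def bd_def)
    ultimately show ?thesis by blast
  next
    case 6
    then obtain i where i: "lo b = Suc i" by (cases "lo b") auto
    then have "i < L" using h 6 by auto
    moreover have "b \<in> pathE i" "u i \<in> pathE i" "bd b c = Suc (bd (u i) c)"
      using 6 b h bd_u[OF c, of i] ne u_pathE i
      by (auto simp: pathE_def bd_sym[of _ c]) (auto simp: bd_def)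
    ultimately show ?thesis by blast
  next
    case 7
    then have "lo c < L" using h by auto
    moreover have "b \<in> pathE (lo c)" "c \<in> pathE (lo c)" "bd b c = Suc (bd c c)"
      using 7 b c ne by (auto simp: pathE_def bd_def)
    ultimately show ?thesis by blast
  qed
qed

lemma dst_sym: "dst f y t = dst f t y"
  by (auto simp: dst_def same_sym bd_sym)

lemma dst_base:
  assumes "footed f" "w \<in> B" shows "dst f y w = ht y + bd (f y) w"
  using assms same_notB by (auto simp: dst_def footB ht_def)

lemma dst_pos:
  assumes "footed f" "y \<in> V" "t \<in> V" "y \<noteq> t" shows "dst f y t > 0"
  using assms bd_pos by (auto simp: dst_def ht_def footB)

lemma edges_V:
  assumes f: "footed f" shows "\<Union>(edges f) = V"
proof
  show "\<Union>(edges f) \<subseteq> V"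
    using pathE_B foot_in[OF f] by (auto simp: edges_def V_def)
  have "b \<in> \<Union>(edges f)" if b: "b \<in> B" for b
  proof -
    obtain i where "i < L" "b \<in> pathE i"
    proof (cases "lo b < L")
      case True
      then show ?thesis using that[of "lo b"] b lohi[OF b] by (auto simp: pathE_def)
    next
      case False
      then have "lo b = L" "hi b = L" using lohi[OF b] hiL[OF b] by auto
      then show ?thesis using that[of "L - 1"] b L1 by (auto simp: pathE_def)
    qed
    then show ?thesis by (auto simp: edges_def)
  qed
  then show "V \<subseteq> \<Union>(edges f)" by (auto simp: V_def edges_def)
qed

lemma dst_lip:
  assumes f: "footed f" and e: "e \<in> edges f" and ab: "a \<in> e" "b \<in> e" and t: "t \<in> V"
  shows "dst f a t \<le> Suc (dst f b t)"
  using e unfolding edges_def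
proof
  assume "e \<in> pathE ` {..<L}"
  then obtain i where i: "a \<in> pathE i" "b \<in> pathE i" using ab by blast
  then have B: "a \<in> B" "b \<in> B" using pathE_B by auto
  show ?thesis
    using bd_lip[OF i foot_in[OF f t]] dst_base[OF f B(1), of t] dst_base[OF f B(2), of t]
    by (simp add: dst_sym[of f _ t] bd_sym[of "f t"])
next
  assume "e \<in> (\<lambda>g. g \<union> f ` g) ` F"
  then obtain g where g: "g \<in> F" "e = g \<union> f ` g" by blast
  then obtain z where z: "z \<in> g" using ab by blast
  define w where "w = f z"
  have e': "e = insert w g" using foot_image[OF f g(1) z] g(2) by (simp add: w_def)
  have gV: "g \<subseteq> V" using g(1) by (auto simp: V_def)
  have w: "w \<in> B" using foot_in[OF f] z gV by (auto simp: w_def)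
  have fg: "f y = w" if "y \<in> g" for y using foot_image[OF f g(1) z] that by (auto simp: w_def)
  have dw: "dst f w t = ht t + bd w (f t)"
    using dst_base[OF f w, of t] by (simp add: dst_sym[of f w] bd_sym)
  show ?thesis
  proof (cases "t \<in> g")
    case True
    have "dst f y t = (if y = t then 0 else 1)" if "y \<in> g" for y
      using that True g(1) by (auto simp: dst_def same_def)
    moreover have "dst f w t = 1" using dw fg[OF True] FB[OF g(1)] True by (auto simp: ht_def)
    ultimately show ?thesis using ab e' by auto
  next
    case False
    have "dst f y t = Suc (dst f w t)" if "y \<in> g" for y
    proof -
      have "\<not> same y t" using disjF[OF g(1)] that False by (auto simp: same_def)
      moreover have "ht y = 1" using FB[OF g(1)] that by (auto simp: ht_def)
      moreover have "y \<noteq> t" using that False by blast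
      ultimately show ?thesis using fg[OF that] dw by (simp add: dst_def[of f y])
    qed
    then show ?thesis using ab e' by auto
  qed
qed

lemma dst_desc:
  assumes f: "footed f" and t: "t \<in> V" and v: "v \<in> V" "v \<noteq> t"
  shows "\<exists>e\<in>edges f. v \<in> e \<and> (\<exists>w\<in>e. w \<in> V \<and> dst f v t = Suc (dst f w t))"
proof -
  have d: "dst f b t = ht t + bd b (f t)" if "b \<in> B" for b
    using dst_base[OF f that, of t] dst_sym[of f b t] bd_sym[of b "f t"] by simp
  show ?thesis
  proof (cases "v \<in> B")
    case False
    then obtain g where g: "g \<in> F" "v \<in> g" using v by (auto simp: V_def)
    have e: "g \<union> f ` g \<in> edges f" using g by (auto simp: edges_def)
    show ?thesis
    proof (cases "t \<in> g")
      case True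
      then have "dst f v t = Suc (dst f t t)" using g v by (auto simp: dst_def same_def)
      then show ?thesis using e True g t by (metis UnI1)
    next
      case False
      then have "\<not> same v t" using disjF[OF g(1)] g by (auto simp: same_def)
      then have "dst f v t = ht v + ht t + bd (f v) (f t)" using v(2) by (simp add: dst_def)
      then have "dst f v t = Suc (dst f (f v) t)"
        using d[OF foot_in[OF f v(1)]] \<open>v \<notin> B\<close> by (simp add: ht_def)
      moreover have "f v \<in> V" using foot_in[OF f v(1)] by (simp add: V_def)
      moreover have "v \<in> g \<union> f ` g" "f v \<in> g \<union> f ` g" using g by auto
      ultimately show ?thesis using e by metis
    qed
  next
    case True
    show ?thesis
    proof (cases "v = f t")
      case True
      then have "t \<notin> B" using v(2) footB[OF f] by auto
      then obtain g where g: "g \<in> F" "t \<in> g" using t by (auto simp: V_def)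
      have "dst f v t = Suc (dst f t t)" using d[OF \<open>v \<in> B\<close>] True \<open>t \<notin> B\<close> by (simp add: ht_def dst_def[of f t t])
      moreover have "v \<in> g \<union> f ` g" "t \<in> g \<union> f ` g" using True g by auto
      moreover have "g \<union> f ` g \<in> edges f" using g by (auto simp: edges_def)
      ultimately show ?thesis using t by metis
    next
      case False
      then obtain i b where i: "i < L" "v \<in> pathE i" "b \<in> pathE i" "bd v (f t) = Suc (bd b (f t))"
        using bd_desc[OF True foot_in[OF f t]] by blast
      then have "b \<in> B" using pathE_B by blast
      then have "dst f v t = Suc (dst f b t)" using d True i(4) by simp
      moreover have "pathE i \<in> edges f" using i by (auto simp: edges_def)
      moreover have "b \<in> V" using \<open>b \<in> B\<close> by (simp add: V_def)
      ultimately show ?thesis using i by metis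
    qed
  qed
qed

lemma hdist_edges:
  assumes f: "footed f" and "v \<in> V" "t \<in> V"
  shows "hdist (edges f) v t = dst f v t"
proof (rule hdist_eqI[where V = V])
  show "dst f v t = 0 \<longleftrightarrow> v = t" if "v \<in> V" for v
    using dst_pos[OF f that \<open>t \<in> V\<close>] by (auto simp: dst_def)
  show "dst f a t \<le> Suc (dst f b t)" if "e \<in> edges f" "a \<in> e" "b \<in> e" for e a b
    by (rule dst_lip[OF f that \<open>t \<in> V\<close>])
  show "\<exists>e\<in>edges f. v \<in> e \<and> (\<exists>w\<in>e. w \<in> V \<and> dst f v t = Suc (dst f w t))"
    if "v \<in> V" "v \<noteq> t" for v
    by (rule dst_desc[OF f \<open>t \<in> V\<close> that])
qed (use assms in simp_all)

definition rho where "rho f = dist_spectral_radius V (edges f)"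

lemma u01: "u 0 \<in> V" "u L \<in> V" "u 0 \<noteq> u L"
  using uB lou L1 by (auto simp: V_def) (metis lou order_refl zero_le One_nat_def not_one_le_zero)

lemma perron_edges:
  assumes f: "footed f"
  shows "\<exists>x. (\<forall>v\<in>V. x v > 0) \<and> (\<forall>v\<in>V. (\<Sum>w\<in>V. real (dst f v w) * x w) = rho f * x v)"
    and "bform V (\<lambda>v w. real (dst f v w)) y y \<le> rho f * (\<Sum>v\<in>V. y v * y v)"
proof -
  have "dist_eigenvalues V (edges f) = {lam. \<exists>x. eigenpair V (\<lambda>v w. real (dst f v w)) lam x}"
    unfolding dist_eigenvalues_def eigenpair_def
    by (auto simp: hdist_edges[OF f] cong: sum.cong)
  then have "rho f = Max {lam. \<exists>x. eigenpair V (\<lambda>v w. real (dst f v w)) lam x}"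
    by (simp add: rho_def dist_spectral_radius_def)
  note p = perron[OF finV u01 _ _ _ this]
  show "\<exists>x. (\<forall>v\<in>V. x v > 0) \<and> (\<forall>v\<in>V. (\<Sum>w\<in>V. real (dst f v w) * x w) = rho f * x v)"
    by (rule p(1)) (use dst_sym dst_pos[OF f] in \<open>auto simp: dst_def[of f v v for v]\<close>)
  show "bform V (\<lambda>v w. real (dst f v w)) y y \<le> rho f * (\<Sum>v\<in>V. y v * y v)"
    by (rule p(2)) (use dst_sym dst_pos[OF f] in \<open>auto simp: dst_def[of f v v for v]\<close>)
qed

end

section \<open>Moving pendant edges\<close>

context spine
begin

definition move where "move f U w' = (\<lambda>y. if y \<in> U then w' else f y)"

lemma footed_move:
  assumes f: "footed f" and S: "S \<subseteq> F" and w: "w' \<in> B"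
  shows "footed (move f (\<Union>S) w')"
proof -
  have "b \<notin> \<Union>S" if "b \<in> B" for b using FB S that by blast
  then have 1: "\<forall>b\<in>B. move f (\<Union>S) w' b = b" using f by (simp add: move_def footed_def)
  have "\<exists>v\<in>B. \<forall>z\<in>g. move f (\<Union>S) w' z = v" if g: "g \<in> F" for g
  proof (cases "g \<in> S")
    case True
    then show ?thesis using w by (auto simp: move_def)
  next
    case False
    then have "z \<notin> \<Union>S" if "z \<in> g" for z using disjF[OF g] S that by blast
    moreover obtain v where "v \<in> B" "\<forall>z\<in>g. f z = v" using f g by (auto simp: footed_def)
    ultimately show ?thesis by (auto simp: move_def)
  qed
  with 1 show ?thesis by (simp add: footed_def)
qed

text \<open>All of \<open>S\<close> hangs at one vertex and moves together, so distances within the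
  bundle and distances outside it stay. A moved vertex sits one step above its root, so its distance
  to an unmoved \<open>t\<close> changes by the difference of the distances from \<open>t\<close> to
  the two roots.\<close>

lemma dst_move:
  assumes f: "footed f" and S: "S \<subseteq> F" and Sw: "\<And>z. z \<in> \<Union>S \<Longrightarrow> f z = w"
    and w: "w \<in> B" "w' \<in> B" and V: "y \<in> V" "t \<in> V"
  shows "real (dst (move f (\<Union>S) w') y t) - real (dst f y t)
     = (if y \<in> \<Union>S \<and> t \<notin> \<Union>S then real (dst f t w') - real (dst f t w) else 0)
     + (if y \<notin> \<Union>S \<and> t \<in> \<Union>S then real (dst f y w') - real (dst f y w) else 0)"
proof -
  have ns: "\<not> same y t" "y \<noteq> t" if "y \<in> \<Union>S" "t \<notin> \<Union>S" for y t
    using that disjF S unfolding same_def by blast+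
  have d: "real (dst (move f (\<Union>S) w') y t) - real (dst f y t) = real (dst f t w') - real (dst f t w)"
    if h: "y \<in> \<Union>S" "t \<notin> \<Union>S" "t \<in> V" for y t
    using ns[OF h(1,2)] h Sw[OF h(1)] dst_base[OF f w(1), of t] dst_base[OF f w(2), of t]
    by (simp add: dst_def[of _ y t] move_def bd_sym)
  consider "y \<in> \<Union>S" "t \<notin> \<Union>S" | "y \<notin> \<Union>S" "t \<in> \<Union>S" | "y \<in> \<Union>S \<longleftrightarrow> t \<in> \<Union>S" by blast
  then show ?thesis
  proof cases
    case 1 then show ?thesis using d[OF 1 V(2)] by simp
  next
    case 2 then show ?thesis using d[OF 2(2,1) V(1)] by (simp add: dst_sym[of _ y t])
  next
    case 3
    then have "dst (move f (\<Union>S) w') y t = dst f y t" using Sw by (auto simp: dst_def move_def)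
    with 3 show ?thesis by auto
  qed
qed

abbreviation bil where "bil f x y \<equiv> bform V (\<lambda>v w. real (dst f v w)) x y"

text \<open>Moving the pendant edges \<open>S\<close> from \<open>w\<close> to \<open>w'\<close> changes the distance form only through
  the transmissions of \<open>w\<close> and \<open>w'\<close> in the rest of the hypertree.\<close>

lemma bil_move:
  fixes x y :: "'a \<Rightarrow> real"
  assumes f: "footed f" and S: "S \<subseteq> F" and Sw: "\<And>z. z \<in> \<Union>S \<Longrightarrow> f z = w"
    and w: "w \<in> B" "w' \<in> B"
  shows "bil (move f (\<Union>S) w') y x - bil f y x
    = sum y (\<Union>S) * (\<Sum>t\<in>V - \<Union>S. x t * (real (dst f t w') - real (dst f t w)))
    + sum x (\<Union>S) * (\<Sum>t\<in>V - \<Union>S. y t * (real (dst f t w') - real (dst f t w)))"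
proof -
  let ?U = "\<Union>S" and ?D = "\<lambda>t. real (dst f t w') - real (dst f t w)"
  have UV: "?U \<subseteq> V" using S by (auto simp: V_def)
  have s1: "(\<Sum>t\<in>V. if t \<in> ?U then h t else 0) = sum h ?U" for h :: "'a \<Rightarrow> real"
    using UV by (subst sum.inter_restrict[OF finV, symmetric]) (simp add: Int_absorb1)
  have s2: "(\<Sum>t\<in>V. if t \<notin> ?U then h t else 0) = sum h (V - ?U)" for h :: "'a \<Rightarrow> real"
    using finV by (intro sum.mono_neutral_cong_right) auto
  have "bil (move f ?U w') y x - bil f y x
      = (\<Sum>v\<in>V. \<Sum>t\<in>V. (real (dst (move f ?U w') v t) - real (dst f v t)) * y v * x t)"
    by (simp add: bform_def left_diff_distrib sum_subtractf)
  also have "\<dots> = (\<Sum>v\<in>V. \<Sum>t\<in>V. (if v \<in> ?U then y v else 0) * (if t \<notin> ?U then x t * ?D t else 0)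
      + (if t \<in> ?U then x t else 0) * (if v \<notin> ?U then y v * ?D v else 0))"
    by (intro sum.cong refl, subst dst_move[OF f S Sw w]) auto
  also have "\<dots> = (\<Sum>v\<in>V. if v \<in> ?U then y v else 0) * (\<Sum>t\<in>V. if t \<notin> ?U then x t * ?D t else 0)
      + (\<Sum>t\<in>V. if t \<in> ?U then x t else 0) * (\<Sum>v\<in>V. if v \<notin> ?U then y v * ?D v else 0)"
    by (simp only: sum.distrib sum_product) (subst (2) sum.swap, simp add: mult.commute)
  finally show ?thesis by (simp only: s1 s2)
qed

definition eig where
  "eig f x \<longleftrightarrow> (\<forall>v\<in>V. x v > 0) \<and> (\<forall>v\<in>V. (\<Sum>w\<in>V. real (dst f v w) * x w) = rho f * x v)"

lemma eig_ex: "footed f \<Longrightarrow> \<exists>x. eig f x"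
  using perron_edges(1) by (simp add: eig_def)

lemma eig_pos: "eig f x \<Longrightarrow> v \<in> V \<Longrightarrow> x v > 0" by (simp add: eig_def)

text \<open>Difference of two rows of the eigenvalue equation. The later relations between
  neighbouring entries of a Perron vector come from evaluating the distance difference on the
  right.\<close>

lemma eig_diff:
  assumes "eig f x" "v \<in> V" "w \<in> V"
  shows "rho f * (x v - x w) = (\<Sum>t\<in>V. x t * (real (dst f t v) - real (dst f t w)))"
proof -
  have "rho f * x v = (\<Sum>t\<in>V. real (dst f t v) * x t)" "rho f * x w = (\<Sum>t\<in>V. real (dst f t w) * x t)"
    using assms by (simp_all add: eig_def dst_sym[of f _ v] dst_sym[of f _ w])
  then show ?thesis unfolding right_diff_distrib sum_subtractf by (simp add: mult.commute)
qed

text \<open>Distinct vertices are at distance at least 1, which bounds the row of \<open>v\<close>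
  from below by the total weight without \<open>x v\<close>. Applying this at both ends of the path
  and adding gives the second claim.\<close>

lemma rho_ge1:
  assumes f: "footed f" and x: "eig f x" and v: "v \<in> V"
  shows "sum x V \<le> (rho f + 1) * x v" and "rho f \<ge> 1"
proof -
  have le: "sum x V \<le> (rho f + 1) * x v" if v: "v \<in> V" for v
  proof -
    have "sum x V - x v = (\<Sum>t\<in>V. x t - of_bool (t = v) * x v)"
      using v finV by (simp add: sum_subtractf flip: sum_distrib_right)
    also have "\<dots> \<le> (\<Sum>t\<in>V. real (dst f v t) * x t)"
    proof (rule sum_mono)
      fix t assume t: "t \<in> V"
      show "x t - of_bool (t = v) * x v \<le> real (dst f v t) * x t"
      proof (cases "t = v")
        case False
        then have "1 \<le> real (dst f v t)" using dst_pos[OF f v t] by simp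
        then show ?thesis using False eig_pos[OF x t] by (simp add: mult_le_cancel_right1)
      qed (use eig_pos[OF x t] in simp)
    qed
    finally show ?thesis using x v by (simp add: eig_def algebra_simps)
  qed
  then show "sum x V \<le> (rho f + 1) * x v" using v by blast
  have "x (u 0) + x (u L) \<le> sum x V"
    using sum_mono2[OF finV, of "{u 0, u L}" x] u01 eig_pos[OF x] by (auto simp: less_imp_le)
  then have "x (u 0) + x (u L) \<le> (rho f + 1) * x (u 0)" "x (u 0) + x (u L) \<le> (rho f + 1) * x (u L)"
    using le[OF u01(1)] le[OF u01(2)] by linarith+
  then have "x (u L) \<le> rho f * x (u 0)" "x (u 0) \<le> rho f * x (u L)" by (simp_all add: algebra_simps)
  moreover have "x (u L) > 0" "x (u 0) > 0" using eig_pos[OF x] u01 by auto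
  ultimately show "rho f \<ge> 1"
  proof -
    have "x (u L) + x (u 0) \<le> rho f * (x (u L) + x (u 0))"
      using \<open>x (u L) \<le> _\<close> \<open>x (u 0) \<le> _\<close> by (simp add: algebra_simps)
    then show ?thesis using \<open>x (u L) > 0\<close> \<open>x (u 0) > 0\<close> by (simp add: mult_le_cancel_right1)
  qed
qed

text \<open>The old Perron vector serves as test vector for the new hypertree: by
  \<open>bil_move\<close> the form grows by twice the weight of the moved bundle times the gain, and
  the Rayleigh bound passes the growth on to \<open>rho\<close>.\<close>

lemma rayleigh_move:
  assumes f: "footed f" and S: "S \<subseteq> F" "S \<noteq> {}" and Sw: "\<And>z. z \<in> \<Union>S \<Longrightarrow> f z = w"
    and w: "w \<in> B" "w' \<in> B" and x: "eig f x"
    and gain: "(\<Sum>t\<in>V - \<Union>S. x t * (real (dst f t w') - real (dst f t w))) > 0"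
  shows "rho f < rho (move f (\<Union>S) w')"
proof -
  have f': "footed (move f (\<Union>S) w')" by (rule footed_move[OF f S(1) w(2)])
  have UV: "\<Union>S \<subseteq> V" using S by (auto simp: V_def)
  have "\<Union>S \<noteq> {}" using S g_ne by fastforce
  then have Ux: "sum x (\<Union>S) > 0"
    using UV eig_pos[OF x] finV by (intro sum_pos) (auto intro: finite_subset)
  have xx: "(\<Sum>v\<in>V. x v * x v) > 0"
    using u01 eig_pos[OF x] by (intro ip_pos[OF finV]) force
  have "bil f x x = rho f * (\<Sum>v\<in>V. x v * x v)"
    using x by (intro bform_eigen) (auto simp: eig_def)
  moreover have "bil (move f (\<Union>S) w') x x - bil f x x > 0"
    by (subst bil_move[OF f S(1) _ w]) (use Sw Ux gain in \<open>auto intro!: add_pos_pos mult_pos_pos\<close>)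
  moreover have "bil (move f (\<Union>S) w') x x \<le> rho (move f (\<Union>S) w') * (\<Sum>v\<in>V. x v * x v)"
    by (rule perron_edges(2)[OF f'])
  ultimately have "rho f * (\<Sum>v\<in>V. x v * x v) < rho (move f (\<Union>S) w') * (\<Sum>v\<in>V. x v * x v)"
    by linarith
  then show ?thesis using xx by simp
qed

text \<open>With the Perron vectors of both hypertrees the quadratic self-interaction of the moved part
  cancels.\<close>

lemma bilinear_move:
  assumes f: "footed f" and S: "S \<subseteq> F" "S \<noteq> {}" and Sw: "\<And>z. z \<in> \<Union>S \<Longrightarrow> f z = w"
    and w: "w \<in> B" "w' \<in> B" and x: "eig f x" and y: "eig (move f (\<Union>S) w') y"
    and xw: "x w < x w'" and yw: "y w < y w'"
  shows "rho f < rho (move f (\<Union>S) w')"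
proof -
  let ?U = "\<Union>S" and ?f = "move f (\<Union>S) w'" and ?D = "\<lambda>t. real (dst f t w') - real (dst f t w)"
  have f': "footed ?f" by (rule footed_move[OF f S(1) w(2)])
  have UV: "?U \<subseteq> V" using S by (auto simp: V_def)
  have wV: "w \<in> V" "w' \<in> V" using w by (auto simp: V_def)
  have nB: "t \<notin> B" if "t \<in> ?U" for t using that FB S by blast
  have "?U \<noteq> {}" using S g_ne by fastforce
  then have Ux: "sum x ?U > 0" and Uy: "sum y ?U > 0"
    using UV eig_pos[OF x] eig_pos[OF y] finV by (auto intro!: sum_pos intro: finite_subset)
  have xy: "(\<Sum>v\<in>V. y v * x v) > 0"
    using u01 eig_pos[OF x] eig_pos[OF y] by (intro sum_pos finV) auto
  have b1: "bil f y x = rho f * (\<Sum>v\<in>V. y v * x v)"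
    using x by (intro bform_eigen) (auto simp: eig_def)
  have "bil ?f x y = rho ?f * (\<Sum>v\<in>V. x v * y v)"
    using y by (intro bform_eigen) (auto simp: eig_def)
  moreover have "bil ?f x y = bil ?f y x"
    by (rule bform_commute) (simp add: dst_sym)
  ultimately have b2: "bil ?f y x = rho ?f * (\<Sum>v\<in>V. y v * x v)"
    by (simp add: mult.commute)
  \<comment> \<open>Seen from the bundle, \<open>w'\<close> is farther than \<open>w\<close> by
    \<open>bd w w'\<close> before the move and nearer by the same amount after it. These opposite
    signs are the source of the cancellation.\<close>
  have Dx: "?D t = real (bd w w')" if "t \<in> ?U" for t
    using that Sw[OF that] dst_base[OF f w(1), of t] dst_base[OF f w(2), of t] by simp
  have Dy: "real (dst ?f t w') - real (dst ?f t w) = - real (bd w w')" if "t \<in> ?U" for t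
    using that dst_base[OF f' w(1), of t] dst_base[OF f' w(2), of t] by (simp add: move_def bd_sym)
  have Deq: "real (dst ?f t w') - real (dst ?f t w) = ?D t" if "t \<in> V - ?U" for t
    using that dst_base[OF f' w(1), of t] dst_base[OF f' w(2), of t]
      dst_base[OF f w(1), of t] dst_base[OF f w(2), of t] by (simp add: move_def)
  have split: "sum h V = sum h (V - ?U) + sum h ?U" for h :: "'a \<Rightarrow> real"
    using sum.subset_diff[OF UV finV] .
  have sx: "(\<Sum>t\<in>V - ?U. x t * ?D t) = rho f * (x w' - x w) - real (bd w w') * sum x ?U"
    using eig_diff[OF x wV(2,1)] Dx split[of "\<lambda>t. x t * ?D t"]
    by (simp add: sum_distrib_right mult.commute)
  have sy: "(\<Sum>t\<in>V - ?U. y t * ?D t) = rho ?f * (y w' - y w) + real (bd w w') * sum y ?U"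
  proof -
    have "rho ?f * (y w' - y w) = (\<Sum>t\<in>V - ?U. y t * (real (dst ?f t w') - real (dst ?f t w)))
       + (\<Sum>t\<in>?U. y t * (real (dst ?f t w') - real (dst ?f t w)))"
      unfolding eig_diff[OF y wV(2,1)] by (rule split)
    also have "\<dots> = (\<Sum>t\<in>V - ?U. y t * ?D t) + (\<Sum>t\<in>?U. - (real (bd w w') * y t))"
      using Dy Deq by (intro arg_cong2[where f = "(+)"] sum.cong refl) auto
    finally show ?thesis by (simp add: sum_negf sum_distrib_left)
  qed
  \<comment> \<open>The product \<open>bd w w' * sum x ?U * sum y ?U\<close> occurs once with each
    sign, so only the entry differences at the two roots remain.\<close>
  have "(rho ?f - rho f) * (\<Sum>v\<in>V. y v * x v)
      = sum y ?U * (rho f * (x w' - x w)) + sum x ?U * (rho ?f * (y w' - y w))"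
    using bil_move[OF f S(1) _ w, of y x, OF Sw] unfolding b1 b2 sx sy by (simp add: algebra_simps)
  also have "\<dots> > 0"
    using Ux Uy xw yw rho_ge1(2)[OF f x u01(1)] rho_ge1(2)[OF f' y u01(1)]
    by (intro add_pos_pos mult_pos_pos) auto
  finally show ?thesis using xy by (simp add: zero_less_mult_iff)
qed

end

section \<open>Degrees and moves along the path\<close>

text \<open>The increments \<open>s\<close> increase strictly. If the increment arriving at
  \<open>i\<close> is nonnegative, \<open>h\<close> rises strictly to the right of \<open>i\<close>;
  otherwise all earlier increments are negative too, and \<open>h\<close> is larger on the
  left.\<close>

lemma convex_less_max:
  fixes h :: "nat \<Rightarrow> real"
  assumes conv: "\<And>j. 0 < j \<Longrightarrow> j < L \<Longrightarrow> 2 * h j < h (j - 1) + h (Suc j)"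
    and i: "i1 < i" "i < i2" "i2 \<le> L"
  shows "h i < max (h i1) (h i2)"
proof -
  define s where "s j = h (Suc j) - h j" for j
  have step: "s j < s (Suc j)" if "Suc j < L" for j
    using conv[of "Suc j"] that by (simp add: s_def)
  have mono: "s p < s q" if "p < q" "q < L" for p q
    using that
  proof (induction q)
    case (Suc q)
    then show ?case using step[of q] by (cases "p = q") auto
  qed simp
  show ?thesis
  proof (cases "s (i - 1) \<ge> 0")
    case True
    have "h i < h (i + Suc d)" if "i + Suc d \<le> i2" for d
      using that
    proof (induction d)
      case 0
      have "s (i - 1) < s i" using i by (intro mono) auto
      then show ?case using True by (simp add: s_def)
    next
      case (Suc d)
      have "s (i - 1) < s (i + Suc d)" using i Suc.prems by (intro mono) auto
      then show ?case using Suc True by (simp add: s_def)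
    qed
    from this[of "i2 - i - 1"] i show ?thesis by (simp add: max_def)
  next
    case False
    have "h i < h (i - Suc d)" if "i1 + Suc d \<le> i" for d
      using that
    proof (induction d)
      case 0
      then show ?case using False i by (auto simp: s_def)
    next
      case (Suc d)
      then have "s (i - Suc (Suc d)) < s (i - 1)" using i by (intro mono) auto
      then have "s (i - Suc (Suc d)) < 0" using False by simp
      moreover have "Suc (i - Suc (Suc d)) = i - Suc d" using Suc.prems by auto
      ultimately show ?case using Suc by (auto simp: s_def)
    qed
    from this[of "i - i1 - 1"] i show ?thesis by (simp add: max_def)
  qed
qed

context spine
begin

definition tcount where "tcount f b = card {g\<in>F. f ` g = {b}}"
definition pdeg where "pdeg b = card {i. i < L \<and> b \<in> pathE i}"

lemma pendant_edge_notB: "g \<in> F \<Longrightarrow> \<not> g \<union> X \<subseteq> B"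
  using FB g_ne by fastforce

lemma path_ne_pendant: "g \<in> F \<Longrightarrow> pathE i \<noteq> g \<union> X"
  using pathE_B pendant_edge_notB by metis

lemma inj_pathE: "inj_on pathE {..<L}"
proof (rule inj_onI)
  fix i j assume ij: "i \<in> {..<L}" "j \<in> {..<L}" "pathE i = pathE j"
  then have "u i \<in> pathE j" "u (Suc i) \<in> pathE j" using u_pathE[of i] by auto
  then show "i = j" using ij lou[of i] hiu[of "Suc i"] by (auto simp: pathE_def)
qed

lemma inj_pendant:
  assumes f: "footed f" shows "inj_on (\<lambda>g. g \<union> f ` g) F"
proof (rule inj_onI)
  fix g h assume gh: "g \<in> F" "h \<in> F" "g \<union> f ` g = h \<union> f ` h"
  have "(g \<union> f ` g) - B = g" if "g \<in> F" for g
    using that FB[OF that] foot_in[OF f] by (auto simp: V_def)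
  then show "g = h" using gh by metis
qed

lemma card_edges:
  assumes f: "footed f" shows "card (edges f) = L + card F"
proof -
  have "pathE ` {..<L} \<inter> (\<lambda>g. g \<union> f ` g) ` F = {}"
    using path_ne_pendant by auto
  then have "card (edges f) = card (pathE ` {..<L}) + card ((\<lambda>g. g \<union> f ` g) ` F)"
    unfolding edges_def using finF by (intro card_Un_disjoint) auto
  then show ?thesis by (simp add: card_image inj_pathE inj_pendant[OF f])
qed

lemma degree_edges:
  assumes f: "footed f"
  shows "b \<in> B \<Longrightarrow> degree (edges f) b = pdeg b + tcount f b"
    and "v \<in> V - B \<Longrightarrow> degree (edges f) v = 1"
proof -
  have *: "degree (edges f) v = card {i. i < L \<and> v \<in> pathE i} + card {g\<in>F. v \<in> g \<union> f ` g}" for v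
  proof -
    have eq: "{e\<in>edges f. v \<in> e} = pathE ` {i. i < L \<and> v \<in> pathE i}
        \<union> (\<lambda>g. g \<union> f ` g) ` {g\<in>F. v \<in> g \<union> f ` g}"
      by (auto simp: edges_def)
    have "pathE ` {i. i < L \<and> v \<in> pathE i} \<inter> (\<lambda>g. g \<union> f ` g) ` {g\<in>F. v \<in> g \<union> f ` g} = {}"
      using path_ne_pendant by auto
    then have "card {e\<in>edges f. v \<in> e} = card (pathE ` {i. i < L \<and> v \<in> pathE i})
        + card ((\<lambda>g. g \<union> f ` g) ` {g\<in>F. v \<in> g \<union> f ` g})"
      unfolding eq using finF by (intro card_Un_disjoint) auto
    also have "card (pathE ` {i. i < L \<and> v \<in> pathE i}) = card {i. i < L \<and> v \<in> pathE i}"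
      by (intro card_image inj_on_subset[OF inj_pathE]) auto
    also have "card ((\<lambda>g. g \<union> f ` g) ` {g\<in>F. v \<in> g \<union> f ` g}) = card {g\<in>F. v \<in> g \<union> f ` g}"
      by (intro card_image inj_on_subset[OF inj_pendant[OF f]]) auto
    finally show ?thesis by (simp add: degree_def)
  qed
  show "degree (edges f) b = pdeg b + tcount f b" if b: "b \<in> B"
  proof -
    have "{g\<in>F. b \<in> g \<union> f ` g} = {g\<in>F. f ` g = {b}}"
    proof (intro Collect_cong conj_cong refl)
      fix g assume g: "g \<in> F"
      then obtain z where z: "z \<in> g" using g_ne by blast
      have "b \<notin> g" using FB[OF g] b by blast
      then show "b \<in> g \<union> f ` g \<longleftrightarrow> f ` g = {b}" using foot_image[OF f g z] by auto
    qed
    then show ?thesis by (simp add: * pdeg_def tcount_def)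
  qed
  show "degree (edges f) v = 1" if v: "v \<in> V - B"
  proof -
    obtain h where h: "h \<in> F" "v \<in> h" using v by (auto simp: V_def)
    have "v \<notin> f ` g" if "g \<in> F" for g using v foot_in[OF f] that by (auto simp: V_def)
    then have "{g\<in>F. v \<in> g \<union> f ` g} = {h}" using h disjF[OF _ h(1) _ h(2)] by blast
    moreover have "{i. i < L \<and> v \<in> pathE i} = {}" using v pathE_B by auto
    ultimately show ?thesis by (simp add: *)
  qed
qed

lemma pdeg_inner:
  assumes "b \<in> B" "hi b = Suc (lo b)" shows "pdeg b = 1"
proof -
  have "{i. i < L \<and> b \<in> pathE i} = {lo b}" using assms hiL[of b] by (auto simp: pathE_def)
  then show ?thesis by (simp add: pdeg_def)
qed

lemma pdeg_u:
  assumes "j \<le> L" shows "pdeg (u j) = (if j = 0 \<or> j = L then 1 else 2)"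
proof -
  have mem: "u j \<in> pathE i \<longleftrightarrow> i = j \<or> Suc i = j" for i
    using assms uB lou hiu by (auto simp: pathE_def)
  consider "j = 0" | "j = L" "j > 0" | "0 < j" "j < L" using assms by linarith
  then show ?thesis
  proof cases
    case 1
    then have "{i. i < L \<and> u j \<in> pathE i} = {0}" unfolding mem using L1 by auto
    then show ?thesis using 1 by (simp add: pdeg_def)
  next
    case 2
    then have "{i. i < L \<and> u j \<in> pathE i} = {L - 1}" unfolding mem by auto
    then show ?thesis using 2 by (simp add: pdeg_def)
  next
    case 3
    then have "{i. i < L \<and> u j \<in> pathE i} = {j - 1, j}" unfolding mem by auto
    then show ?thesis using 3 by (simp add: pdeg_def)
  qed
qed

lemma foot_at:
  assumes "S \<subseteq> {g\<in>F. f ` g = {w}}" "z \<in> \<Union>S" shows "f z = w"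
  using assms by blast

lemma move_image:
  assumes "S \<subseteq> F" "g \<in> F"
  shows "move f (\<Union>S) w' ` g = (if g \<in> S then {w'} else f ` g)"
proof (cases "g \<in> S")
  case True
  then show ?thesis using g_ne[OF assms(2)] by (auto simp: move_def image_iff)
next
  case False
  then have "z \<notin> \<Union>S" if "z \<in> g" for z using disjF[OF assms(2)] assms(1) that by blast
  then show ?thesis using False by (force simp: move_def image_iff)
qed

lemma tcount_move:
  assumes S: "S \<subseteq> {g\<in>F. f ` g = {w}}" and ne: "w \<noteq> w'"
  shows "tcount (move f (\<Union>S) w') b =
    (if b = w then tcount f w - card S else if b = w' then tcount f w' + card S else tcount f b)"
proof -
  have SF: "S \<subseteq> F" using S by blast
  have fS: "finite S" using SF finF by (rule finite_subset)
  have "{g\<in>F. move f (\<Union>S) w' ` g = {b}}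
      = {g\<in>F. (if g \<in> S then {w'} else f ` g) = {b}}"
    by (intro Collect_cong conj_cong refl) (simp add: move_image[OF SF])
  also have "\<dots> = (if b = w then {g\<in>F. f ` g = {w}} - S
      else if b = w' then {g\<in>F. f ` g = {w'}} \<union> S else {g\<in>F. f ` g = {b}})"
    using S ne by auto
  finally have eq: "{g\<in>F. move f (\<Union>S) w' ` g = {b}} = (if b = w then {g\<in>F. f ` g = {w}} - S
      else if b = w' then {g\<in>F. f ` g = {w'}} \<union> S else {g\<in>F. f ` g = {b}})" .
  have "{g\<in>F. f ` g = {w'}} \<inter> S = {}" using S ne by auto
  then show ?thesis
    unfolding tcount_def eq using S fS finF ne by (auto simp: card_Diff_subset card_Un_disjoint)
qed

definition deg_ok where
  "deg_ok \<Delta> n f \<longleftrightarrow> (\<forall>v\<in>V. degree (edges f) v \<le> \<Delta>) \<and> card {v\<in>V. degree (edges f) v = \<Delta>} = n"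

text \<open>The move transposes the degrees of \<open>w\<close> and \<open>w'\<close>.\<close>

lemma deg_ok_transfer:
  assumes f: "footed f" and w: "w \<in> B" "w' \<in> B" "w \<noteq> w'" and p: "pdeg w = pdeg w'"
    and t: "tcount f w' = 0" and ok: "deg_ok \<Delta> n f"
  shows "deg_ok \<Delta> n (move f (\<Union>{g\<in>F. f ` g = {w}}) w')"
proof -
  let ?S = "{g\<in>F. f ` g = {w}}"
  let ?f = "move f (\<Union>?S) w'"
  define \<tau> where "\<tau> v = (if v = w then w' else if v = w' then w else v)" for v
  have f': "footed ?f" using w by (intro footed_move f) auto
  have c: "card ?S = tcount f w" by (simp add: tcount_def)
  have deg: "degree (edges ?f) v = degree (edges f) (\<tau> v)" if v: "v \<in> V" for v
  proof (cases "v \<in> B")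
    case True
    then show ?thesis
      using w p t tcount_move[OF order_refl w(3), of f v] c
      by (auto simp: degree_edges(1)[OF f'] degree_edges(1)[OF f] \<tau>_def)
  next
    case False
    then show ?thesis using v w by (auto simp: degree_edges(2)[OF f'] degree_edges(2)[OF f] \<tau>_def)
  qed
  have \<tau>V: "\<tau> v \<in> V" if "v \<in> V" for v using that w by (auto simp: \<tau>_def V_def)
  have \<tau>\<tau>: "\<tau> (\<tau> v) = v" for v by (simp add: \<tau>_def)
  have "bij_betw \<tau> {v\<in>V. degree (edges ?f) v = \<Delta>} {v\<in>V. degree (edges f) v = \<Delta>}"
    by (rule bij_betw_byWitness[where f' = \<tau>]) (auto simp: deg \<tau>V \<tau>\<tau>)
  then show ?thesis using ok bij_betw_same_card by (fastforce simp: deg_ok_def deg \<tau>V)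
qed

lemma lohi_foot: "footed f \<Longrightarrow> t \<in> V \<Longrightarrow> hi (f t) = lo (f t) \<or> hi (f t) = Suc (lo (f t))"
  using lohi foot_in by blast

lemma dst_u:
  assumes f: "footed f" and "t \<in> V" "j \<le> L"
  shows "dst f t (u j) = ht t + max (j - lo (f t)) (hi (f t) - j)"
  using dst_base[OF f uB[OF assms(3)], of t] bd_u[OF foot_in[OF f assms(2)] assms(3)] by simp

text \<open>As a function of \<open>j\<close>, the distance to the interval
  [\<open>a\<close>, \<open>c\<close>] is piecewise linear: a path vertex turns slope -1 into 1 at
  once, a bend of 2, while an inner vertex has slope 0 across its edge and a bend of 1 at both ends
  of it.\<close>

lemma second_diff_nat:
  fixes a c j :: nat
  assumes "c = a \<or> c = Suc a" "0 < j"
  shows "max (j - 1 - a) (c - (j - 1)) + max (Suc j - a) (c - Suc j) = 2 * max (j - a) (c - j)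
    + (if a = j \<and> c = j then 2 else 0) + (if a = j - 1 \<and> c = j then 1 else 0)
    + (if a = j \<and> c = Suc j then 1 else 0)"
proof -
  consider "a < j" "c < j" | "a < j" "c = j" | "a = j" | "a > j" using assms by linarith
  then show ?thesis using assms by cases (auto simp: max_def)
qed

lemma second_diff:
  assumes f: "footed f" and t: "t \<in> V" and j: "0 < j" "j < L"
  shows "dst f t (u (j - 1)) + dst f t (u (Suc j)) = 2 * dst f t (u j)
    + (if f t = u j then 2 else 0)
    + (if lo (f t) = j - 1 \<and> hi (f t) = j then 1 else 0)
    + (if lo (f t) = j \<and> hi (f t) = Suc j then 1 else 0)"
proof -
  have eq: "f t = u j \<longleftrightarrow> lo (f t) = j \<and> hi (f t) = j"
    using u_uniq[OF foot_in[OF f t]] lou[of j] hiu[of j] j by (metis less_imp_le)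
  have d: "dst f t (u i) = ht t + max (i - lo (f t)) (hi (f t) - i)" if "i \<le> L" for i
    by (rule dst_u[OF f t that])
  have le: "j - 1 \<le> L" "Suc j \<le> L" "j \<le> L" using j by auto
  have gen: "a + b = 2 * c + x + y + z \<Longrightarrow> (h + a) + (h + b) = 2 * (h + c) + x + y + z"
    for a b c x y z h :: nat by simp
  show ?thesis
    unfolding d[OF le(1)] d[OF le(2)] d[OF le(3)] eq
    by (rule gen[OF second_diff_nat[OF lohi_foot[OF f t] j(1)]])
qed

text \<open>Each summand is convex along the path, and the term of \<open>u j\<close> itself makes
  the inequality at \<open>j\<close> strict. Only \<open>B\<close> must lie in \<open>A\<close>, so
  the moved pendant edges may be left out of the sum.\<close>

lemma transmission_convex:
  assumes f: "footed f" and A: "A \<subseteq> V" "B \<subseteq> A" and x: "\<And>v. v \<in> V \<Longrightarrow> x v > 0"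
    and i: "i1 < i" "i < i2" "i2 \<le> L"
  shows "(\<Sum>t\<in>A. x t * real (dst f t (u i)))
    < max (\<Sum>t\<in>A. x t * real (dst f t (u i1))) (\<Sum>t\<in>A. x t * real (dst f t (u i2)))"
proof (rule convex_less_max[where h = "\<lambda>i. \<Sum>t\<in>A. x t * real (dst f t (u i))", OF _ i])
  fix j assume j: "0 < j" "j < L"
  have fA: "finite A" using A finV finite_subset by blast
  have sd: "real (dst f t (u (j - 1))) + real (dst f t (u (Suc j))) \<ge> 2 * real (dst f t (u j))"
    if "t \<in> V" for t using second_diff[OF f that j] by linarith
  have "u j \<in> B" using uB j by simp
  then have uj: "u j \<in> A" "u j \<in> V" "f (u j) = u j" using A footB[OF f] by auto
  have "2 * (\<Sum>t\<in>A. x t * real (dst f t (u j))) = (\<Sum>t\<in>A. x t * (2 * real (dst f t (u j))))"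
    by (simp add: sum_distrib_left mult_ac)
  also have "\<dots> < (\<Sum>t\<in>A. x t * (real (dst f t (u (j - 1))) + real (dst f t (u (Suc j)))))"
  proof (rule sum_strict_mono_ex1[OF fA])
    show "\<forall>t\<in>A. x t * (2 * real (dst f t (u j)))
        \<le> x t * (real (dst f t (u (j - 1))) + real (dst f t (u (Suc j))))"
      using sd x A by (intro ballI mult_left_mono) (auto simp: less_imp_le)
    have "2 * real (dst f (u j) (u j)) < real (dst f (u j) (u (j - 1))) + real (dst f (u j) (u (Suc j)))"
      using second_diff[OF f uj(2) j] uj(3) by simp
    then show "\<exists>t\<in>A. x t * (2 * real (dst f t (u j)))
        < x t * (real (dst f t (u (j - 1))) + real (dst f t (u (Suc j))))"
      using uj x[OF uj(2)] by (intro bexI[of _ "u j"] mult_strict_left_mono) auto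
  qed
  finally show "2 * (\<Sum>t\<in>A. x t * real (dst f t (u j)))
      < (\<Sum>t\<in>A. x t * real (dst f t (u (j - 1)))) + (\<Sum>t\<in>A. x t * real (dst f t (u (Suc j))))"
    by (simp add: distrib_left sum.distrib)
qed

lemma spine_move:
  assumes f: "footed f" and S: "S \<subseteq> {g\<in>F. f ` g = {u i}}" "S \<noteq> {}"
    and i: "i1 < i" "i < i2" "i2 \<le> L"
  shows "rho f < rho (move f (\<Union>S) (u i1)) \<or> rho f < rho (move f (\<Union>S) (u i2))"
proof -
  obtain x where x: "eig f x" using eig_ex[OF f] by blast
  have SF: "S \<subseteq> F" using S by blast
  let ?A = "V - \<Union>S"
  have "B \<subseteq> ?A" using FB SF by (fastforce simp: V_def)
  then have "(\<Sum>t\<in>?A. x t * real (dst f t (u i)))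
    < max (\<Sum>t\<in>?A. x t * real (dst f t (u i1))) (\<Sum>t\<in>?A. x t * real (dst f t (u i2)))"
    by (intro transmission_convex[OF f _ _ _ i] eig_pos[OF x]) auto
  then consider j where "j \<in> {i1, i2}"
    "(\<Sum>t\<in>?A. x t * real (dst f t (u i))) < (\<Sum>t\<in>?A. x t * real (dst f t (u j)))"
    by (auto simp: max_def split: if_splits)
  then show ?thesis
  proof cases
    case 1
    then have "(\<Sum>t\<in>?A. x t * (real (dst f t (u j)) - real (dst f t (u i)))) > 0"
      by (simp add: right_diff_distrib sum_subtractf)
    then have "rho f < rho (move f (\<Union>S) (u j))"
      using 1(1) i uB by (intro rayleigh_move[OF f SF S(2) foot_at[OF S(1)] _ _ x]) auto
    then show ?thesis using 1(1) by blast
  qed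
qed

text \<open>
  The function \<open>c\<close> in the proof bounds the gain in distance from below; its sum is controlled by
  \<open>heavy\<close>, except for the excess loss at \<open>u L\<close>, which the entries at \<open>v\<close> and \<open>u (L - 1)\<close> compensate.
\<close>

lemma inner_move:
  assumes f: "footed f" and v: "v \<in> B" "lo v = i" "hi v = Suc i" and i: "Suc i < L"
    and S: "S = {g\<in>F. f ` g = {v}}" "S \<noteq> {}"
    and noL: "\<And>z. z \<in> V \<Longrightarrow> f z = u L \<Longrightarrow> z = u L" and x: "eig f x"
    and heavy: "sum x {t\<in>V. lo (f t) \<ge> Suc i} \<le> sum x {t\<in>V. hi (f t) \<le> i}"
  shows "rho f < rho (move f (\<Union>S) (u L))"
proof -
  have SF: "S \<subseteq> F" using S by blast
  have uLB: "u L \<in> B" "u (L - 1) \<in> B" using uB by auto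
  \<comment> \<open>A vertex whose foot is left of the edge of \<open>v\<close> gains exactly
    \<open>L - Suc i\<close>; one on the right loses at most that, the worst case being a foot
    inside the last edge. Exceptions: \<open>v\<close> gains \<open>L - i\<close>, which is at least
    2; \<open>u (L - 1)\<close> loses one less than the bound; \<open>u L\<close> loses one more. By
    \<open>noL\<close> no pendant vertex shares the extra loss of \<open>u L\<close>.\<close>
  define c where "c t = real (L - Suc i) * (of_bool (hi (f t) \<le> i) - of_bool (Suc i \<le> lo (f t)))
    + 2 * of_bool (t = v) + of_bool (t = u (L - 1)) - of_bool (t = u L)" for t
  have iV: "v \<in> V" "u L \<in> V" "u (L - 1) \<in> V" using v uLB by (auto simp: V_def)
  have e: "lo (u L) = L" "hi (u L) = L" "lo (u (L - 1)) = L - 1" "hi (u (L - 1)) = L - 1"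
    using lou hiu by simp_all
  have "L \<noteq> L - 1" using i by simp
  then have ne: "v \<noteq> u L" "v \<noteq> u (L - 1)" "u L \<noteq> u (L - 1)"
    using v e by (metis n_not_Suc_n)+
  have fB: "f v = v" "f (u L) = u L" "f (u (L - 1)) = u (L - 1)" using v uLB footB[OF f] by auto
  have US: "t \<in> \<Union>S \<longleftrightarrow> t \<notin> B \<and> f t = v" if tV: "t \<in> V" for t
  proof
    assume "t \<in> \<Union>S"
    then show "t \<notin> B \<and> f t = v" using S(1) FB by blast
  next
    assume t: "t \<notin> B \<and> f t = v"
    then obtain g where "g \<in> F" "t \<in> g" using tV by (auto simp: V_def)
    moreover from this have "f ` g = {v}" using foot_image[OF f, of g t] t by simp
    ultimately show "t \<in> \<Union>S" using S(1) by blast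
  qed
  have c0: "c t = 0" if "t \<in> \<Union>S" for t
  proof -
    have "t \<in> V" using that SF by (auto simp: V_def)
    then have "t \<notin> B" "f t = v" using US that by auto
    then show ?thesis using v uLB by (auto simp: c_def)
  qed
  have cle: "c t \<le> real (dst f t (u L)) - real (dst f t v)" if t: "t \<in> V - \<Union>S" for t
  proof -
    have tV: "t \<in> V" and nv: "t \<noteq> v \<Longrightarrow> f t \<noteq> v" using t US[of t] footB[OF f] by auto
    have lh: "hi (f t) = lo (f t) \<or> hi (f t) = Suc (lo (f t))" "hi (f t) \<le> L"
      using lohi_foot[OF f tV] hiL[OF foot_in[OF f tV]] .
    have dL: "dst f t (u L) = ht t + (L - lo (f t))" using dst_u[OF f tV, of L] lh by (simp add: max_def)
    show ?thesis
    proof (cases "t = v")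
      case True
      then have "dst f t (u L) = L - i" "dst f t v = 0" using dL fB v by (auto simp: ht_def dst_def)
      then show ?thesis using True ne v fB i by (simp add: c_def)
    next
      case False
      have dv: "dst f t v = ht t + max (Suc i - lo (f t)) (hi (f t) - i)"
        using dst_base[OF f v(1), of t] nv[OF False] v by (simp add: bd_def)
      have uL: "f t = u L" if "lo (f t) = L"
        using that u_uniq[OF foot_in[OF f tV]] lh by auto
      show ?thesis
      proof (cases "t = u L")
        case True
        then show ?thesis using False dL dv fB e ne i by (auto simp: c_def max_def)
      next
        case tL: False
        then have lL: "lo (f t) < L" using uL noL[OF tV] lh by fastforce
        show ?thesis
        proof (cases "t = u (L - 1)")
          case True
          moreover have "Suc i \<le> L - Suc 0" using i by simp
          ultimately show ?thesis using False tL dL dv fB e ne i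
            by (auto simp: c_def max_def)
        next
          case tL1: False
          consider "hi (f t) \<le> i" | "Suc i \<le> lo (f t)" | "lo (f t) = i" "hi (f t) = Suc i"
            using lh by linarith
          then show ?thesis
          proof cases
            case 1
            then have "dst f t (u L) = dst f t v + (L - Suc i)" using dL dv lh i by (auto simp: max_def)
            then show ?thesis using 1 False tL tL1 lh by (auto simp: c_def)
          next
            case 2
            then have "dst f t v \<le> dst f t (u L) + (L - Suc i)" using dL dv lh lL i by (auto simp: max_def)
            then show ?thesis using 2 False tL tL1 lh by (auto simp: c_def)
          next
            case 3
            then have "dst f t v \<le> dst f t (u L)" using dL dv i by (auto simp: max_def)
            then show ?thesis using 3 False tL tL1 by (auto simp: c_def)
          qed
        qed
      qed
    qed
  qed
  have xn: "x t \<ge> 0" if "t \<in> V" for t using eig_pos[OF x that] by simp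
  have pick: "(\<Sum>t\<in>V. x t * of_bool (P t)) = sum x {t\<in>V. P t}" for P
  proof -
    have "(\<Sum>t\<in>V. x t * of_bool (P t)) = (\<Sum>t\<in>V. if P t then x t else 0)"
      by (intro sum.cong) auto
    then show ?thesis by (simp add: sum.inter_filter[OF finV])
  qed
  have one: "{t\<in>V. t = a} = {a}" if "a \<in> V" for a using that by auto
  \<comment> \<open>Pays for the extra loss at \<open>u L\<close>. The step from
    \<open>u (L - 1)\<close> to \<open>u L\<close> raises any distance by at most 1, so
    \<open>rho f\<close> times the difference is below the total weight, which
    \<open>rho_ge1\<close> bounds by \<open>(rho f + 1) * x v\<close>, hence by
    \<open>2 * rho f * x v\<close>.\<close>
  have Mlt: "x (u L) - x (u (L - 1)) < 2 * x v"
  proof -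
    have "rho f * (x (u L) - x (u (L - 1))) = (\<Sum>t\<in>V. x t * (real (dst f t (u L)) - real (dst f t (u (L - 1)))))"
      by (rule eig_diff[OF x iV(2,3)])
    also have "\<dots> < (\<Sum>t\<in>V. x t)"
    proof (rule sum_strict_mono_ex1[OF finV])
      show "\<forall>t\<in>V. x t * (real (dst f t (u L)) - real (dst f t (u (L - 1)))) \<le> x t"
      proof
        fix t assume t: "t \<in> V"
        have "dst f t (u L) \<le> Suc (dst f t (u (L - 1)))"
          using dst_u[OF f t, of L] dst_u[OF f t, of "L - 1"] hiL[OF foot_in[OF f t]] by (auto simp: max_def)
        then have "real (dst f t (u L)) - real (dst f t (u (L - 1))) \<le> 1" by simp
        from mult_left_mono[OF this xn[OF t]] show "x t * (real (dst f t (u L)) - real (dst f t (u (L - 1)))) \<le> x t"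
          by simp
      qed
      have "real (dst f (u L) (u L)) - real (dst f (u L) (u (L - 1))) \<le> 0" by (simp add: dst_def)
      then have "x (u L) * (real (dst f (u L) (u L)) - real (dst f (u L) (u (L - 1)))) \<le> 0"
        using xn[OF iV(2)] by (simp add: mult_nonneg_nonpos)
      then show "\<exists>t\<in>V. x t * (real (dst f t (u L)) - real (dst f t (u (L - 1)))) < x t"
        using eig_pos[OF x iV(2)] iV(2) by (intro bexI[of _ "u L"]) linarith+
    qed
    also have "\<dots> \<le> (rho f + 1) * x v" by (rule rho_ge1(1)[OF f x iV(1)])
    also have "\<dots> \<le> rho f * (2 * x v)"
      using mult_right_mono[OF rho_ge1(2)[OF f x iV(1)] xn[OF iV(1)]] by (simp add: algebra_simps)
    finally show ?thesis using rho_ge1(2)[OF f x iV(1)] by (simp add: mult_less_cancel_left_pos)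
  qed
  have "0 < real (L - Suc i) * (sum x {t\<in>V. hi (f t) \<le> i} - sum x {t\<in>V. Suc i \<le> lo (f t)})
      + 2 * x v + x (u (L - 1)) - x (u L)"
  proof -
    have "0 \<le> real (L - Suc i) * (sum x {t\<in>V. hi (f t) \<le> i} - sum x {t\<in>V. Suc i \<le> lo (f t)})"
      using heavy by (intro mult_nonneg_nonneg) auto
    then show ?thesis using Mlt by linarith
  qed
  also have "\<dots> = (\<Sum>t\<in>V. x t * c t)"
  proof -
    have "(\<Sum>t\<in>V. x t * c t) = real (L - Suc i) * ((\<Sum>t\<in>V. x t * of_bool (hi (f t) \<le> i))
        - (\<Sum>t\<in>V. x t * of_bool (Suc i \<le> lo (f t))))
      + 2 * (\<Sum>t\<in>V. x t * of_bool (t = v)) + (\<Sum>t\<in>V. x t * of_bool (t = u (L - 1)))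
      - (\<Sum>t\<in>V. x t * of_bool (t = u L))"
      unfolding sum_subtractf[symmetric] sum_distrib_left sum.distrib[symmetric]
      by (intro sum.cong refl) (simp add: c_def algebra_simps)
    then show ?thesis unfolding pick one[OF iV(1)] one[OF iV(2)] one[OF iV(3)] by simp
  qed
  also have "\<dots> = (\<Sum>t\<in>V - \<Union>S. x t * c t)"
    using c0 finV by (intro sum.mono_neutral_right) auto
  also have "\<dots> \<le> (\<Sum>t\<in>V - \<Union>S. x t * (real (dst f t (u L)) - real (dst f t v)))"
    using cle xn by (intro sum_mono mult_left_mono) auto
  finally show ?thesis
    using S v uLB by (intro rayleigh_move[OF f SF S(2) _ _ _ x]) auto
qed

end

section \<open>Balancing the two ends\<close>

text \<open>A discrete maximum principle for the antisymmetric function \<open>f i - f (L - i)\<close>.\<close>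

lemma reflect_le:
  fixes f W I :: "nat \<Rightarrow> real"
  assumes L: "L \<ge> 1" and \<alpha>: "0 \<le> \<alpha>" "\<alpha> < \<rho>"
    and sd: "\<And>j. 0 < j \<Longrightarrow> j < L \<Longrightarrow> \<rho> * (f (j - 1) + f (Suc j) - 2 * f j) = 2 * W j + I (j - 1) + I j"
    and b0: "\<rho> * (f 1 - f 0) = 2 * W 0 + I 0 - M"
    and bL: "\<rho> * (f (L - 1) - f L) = 2 * W L + I (L - 1) - M"
    and I: "\<And>i. i < L \<Longrightarrow> I i = \<alpha> * (f i + f (Suc i)) + \<beta>"
    and W: "\<And>i. 2 * i \<le> L \<Longrightarrow> f (L - i) \<le> f i \<Longrightarrow> f i - f (L - i) \<le> W i - W (L - i)"
    and i: "2 * i \<le> L"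
  shows "f i \<le> f (L - i)"
proof (rule ccontr)
  assume "\<not> f i \<le> f (L - i)"
  define \<delta> where "\<delta> j = f j - f (L - j)" for j
  define i0 where "i0 = (LEAST i. 2 * i \<le> L \<and> \<delta> i > 0)"
  have ex: "2 * i \<le> L \<and> \<delta> i > 0" using i \<open>\<not> f i \<le> f (L - i)\<close> by (simp add: \<delta>_def)
  have i0: "2 * i0 \<le> L" "\<delta> i0 > 0" using LeastI[of "\<lambda>i. 2 * i \<le> L \<and> \<delta> i > 0", OF ex] by (auto simp: i0_def)
  have before: "\<delta> j \<le> 0" if "j < i0" for j
    using not_less_Least[of j "\<lambda>i. 2 * i \<le> L \<and> \<delta> i > 0"] that i0(1) by (auto simp: i0_def)
  have stepA: "\<delta> (Suc j) > \<delta> j" if j: "0 < j" "2 * j \<le> L" "\<delta> j > 0" "\<delta> (j - 1) \<le> \<delta> j" for j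
  proof -
    have jL: "j < L" "L - j < L" "0 < L - j" using j by auto
    have s: "Suc (L - j) = L - (j - 1)" "L - j - 1 = L - Suc j" using j by auto
    have 1: "\<rho> * (f (j - 1) + f (Suc j) - 2 * f j) = 2 * W j + I (j - 1) + I j" using sd j jL by blast
    have 2: "\<rho> * (f (L - Suc j) + f (L - (j - 1)) - 2 * f (L - j)) = 2 * W (L - j) + I (L - Suc j) + I (L - j)"
      using sd[OF jL(3,2)] unfolding s .
    have 3: "I (j - 1) = \<alpha> * (f (j - 1) + f j) + \<beta>" "I j = \<alpha> * (f j + f (Suc j)) + \<beta>"
      "I (L - Suc j) = \<alpha> * (f (L - Suc j) + f (L - j)) + \<beta>"
      "I (L - j) = \<alpha> * (f (L - j) + f (L - (j - 1))) + \<beta>"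
    proof -
      have "j - 1 < L" "Suc (j - 1) = j" using j jL by auto
      then show "I (j - 1) = \<alpha> * (f (j - 1) + f j) + \<beta>" using I[of "j - 1"] by simp
    qed (use I[of j] I[of "L - Suc j"] I[of "L - j"] j jL s in \<open>auto simp: Suc_diff_Suc\<close>)
    \<comment> \<open>Difference of the relations at \<open>j\<close> and \<open>L - j\<close>:
      \<open>\<beta>\<close> cancels, and writing
      \<open>\<delta> (j - 1) + 2 * \<delta> j + \<delta> (Suc j)\<close> as the second difference
      plus \<open>4 * \<delta> j\<close> brings \<open>\<alpha>\<close> to the left inside
      \<open>\<rho> - \<alpha>\<close>.\<close>
    have "(\<rho> - \<alpha>) * (\<delta> (Suc j) - \<delta> j) = (\<rho> - \<alpha>) * (\<delta> j - \<delta> (j - 1)) + 4 * (\<alpha> * \<delta> j) + 2 * (W j - W (L - j))"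
      using 1 2 unfolding 3 \<delta>_def by (simp add: algebra_simps)
    also have "\<dots> > 0"
    proof -
      have "W j - W (L - j) > 0" using W[OF j(2)] j(3) by (simp add: \<delta>_def)
      moreover have "(\<rho> - \<alpha>) * (\<delta> j - \<delta> (j - 1)) \<ge> 0" "\<alpha> * \<delta> j \<ge> 0" using \<alpha> j by simp_all
      ultimately show ?thesis by (intro add_nonneg_pos add_nonneg_nonneg) simp_all
    qed
    finally show ?thesis using \<alpha> by (simp add: zero_less_mult_iff)
  qed
  have step0: "\<delta> 1 > \<delta> 0" if "\<delta> 0 > 0"
  proof -
    have I0: "I 0 = \<alpha> * (f 0 + f 1) + \<beta>" "I (L - 1) = \<alpha> * (f (L - 1) + f L) + \<beta>"
      using I[of 0] I[of "L - 1"] L by auto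
    have "(\<rho> - \<alpha>) * (\<delta> 1 - \<delta> 0) = 2 * (\<alpha> * \<delta> 0) + 2 * (W 0 - W L)"
      using b0 bL unfolding I0 \<delta>_def by (simp add: algebra_simps)
    also have "\<dots> > 0"
    proof -
      have "W 0 - W L > 0" using W[of 0] that by (auto simp: \<delta>_def)
      moreover have "\<alpha> * \<delta> 0 \<ge> 0" using that \<alpha> by simp
      ultimately show ?thesis by (intro add_nonneg_pos) simp_all
    qed
    finally have "(\<rho> - \<alpha>) * (\<delta> 1 - \<delta> 0) > 0" .
    then show ?thesis using \<alpha> by (simp add: zero_less_mult_iff)
  qed
  have base: "\<delta> (Suc i0) > \<delta> i0"
    using stepA[of i0] step0 before[of "i0 - 1"] i0 by (cases "i0 = 0") auto
  have run: "2 * j \<le> L \<longrightarrow> \<delta> j > 0 \<and> \<delta> (Suc j) > \<delta> j" if "i0 \<le> j" for j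
    using that
  proof (induction j rule: dec_induct)
    case (step j)
    show ?case
    proof
      assume le: "2 * Suc j \<le> L"
      then show "\<delta> (Suc j) > 0 \<and> \<delta> (Suc (Suc j)) > \<delta> (Suc j)"
        using step.IH stepA[of "Suc j"] by auto
    qed
  qed (use base i0 in simp)
  \<comment> \<open>A positive \<open>\<delta>\<close> keeps growing up to the centre, where
    antisymmetry forbids it: \<open>\<delta> h\<close> vanishes for even \<open>L\<close>, and
    \<open>\<delta>\<close> changes sign across the middle edge for odd \<open>L\<close>.\<close>
  define h where "h = L div 2"
  have h: "\<delta> h > 0" "\<delta> (Suc h) > \<delta> h" using run[of h] i0(1) by (auto simp: h_def)
  have "L = 2 * h \<or> L = Suc (2 * h)" unfolding h_def by arith
  then show False
  proof
    assume "L = 2 * h"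
    then have "\<delta> h = 0" by (simp add: \<delta>_def)
    then show False using h by simp
  next
    assume "L = Suc (2 * h)"
    then have "L - h = Suc h" "L - Suc h = h" by auto
    then have "\<delta> (Suc h) = - \<delta> h" by (simp add: \<delta>_def)
    then show False using h by simp
  qed
qed

section \<open>Relations between the entries of a Perron vector along the path\<close>

context spine
begin

definition spiny where "spiny f \<longleftrightarrow> (\<forall>t\<in>V - B. hi (f t) = lo (f t))"

lemma eq_u_iff:
  assumes f: "footed f" and t: "t \<in> V" and j: "j \<le> L"
  shows "f t = u j \<longleftrightarrow> lo (f t) = j \<and> hi (f t) = j"
  using u_uniq[OF foot_in[OF f t]] lou[OF j] hiu[OF j] by metis

definition inner where "inner i = {b\<in>B. lo b = i \<and> hi b = Suc i}"

lemma spiny_inner: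
  assumes f: "footed f" and s: "spiny f" and t: "t \<in> V"
  shows "t \<in> inner i \<longleftrightarrow> lo (f t) = i \<and> hi (f t) = Suc i"
  using s t footB[OF f] by (cases "t \<in> B") (auto simp: spiny_def inner_def)

lemma sum_pick:
  fixes x :: "'a \<Rightarrow> real" shows "(\<Sum>t\<in>V. x t * (if P t then c else 0)) = c * sum x {t\<in>V. P t}"
proof -
  have "(\<Sum>t\<in>V. x t * (if P t then c else 0)) = c * (\<Sum>t\<in>V. if P t then x t else 0)"
    unfolding sum_distrib_left by (intro sum.cong) auto
  then show ?thesis by (simp add: sum.inter_filter[OF finV])
qed

lemma innerV: "{t\<in>V. t \<in> inner i} = inner i" by (auto simp: V_def inner_def)

text \<open>\<open>second_diff\<close> weighted by \<open>x\<close>. Under \<open>spiny\<close> only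
  inner path vertices have a foot inside an edge, so the terms with coefficient 1 collect exactly
  the sets \<open>inner\<close>.\<close>

lemma eig_second_diff:
  assumes f: "footed f" and x: "eig f x" and s: "spiny f" and j: "0 < j" "j < L"
  shows "rho f * (x (u (j - 1)) + x (u (Suc j)) - 2 * x (u j))
    = 2 * sum x {t\<in>V. f t = u j} + sum x (inner (j - 1)) + sum x (inner j)"
proof -
  have uV: "u (j - 1) \<in> V" "u (Suc j) \<in> V" "u j \<in> V" using uB j by (auto simp: V_def)
  have "rho f * (x (u (j - 1)) + x (u (Suc j)) - 2 * x (u j))
      = rho f * (x (u (j - 1)) - x (u j)) + rho f * (x (u (Suc j)) - x (u j))"
    by (simp add: algebra_simps)
  also have "\<dots> = (\<Sum>t\<in>V. x t * (real (dst f t (u (j - 1)) + dst f t (u (Suc j))) - 2 * real (dst f t (u j))))"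
    unfolding eig_diff[OF x uV(1,3)] eig_diff[OF x uV(2,3)] sum.distrib[symmetric]
    by (intro sum.cong refl) (simp add: algebra_simps)
  also have "\<dots> = (\<Sum>t\<in>V. x t * (if f t = u j then 2 else 0) + x t * (if t \<in> inner (j - 1) then 1 else 0)
      + x t * (if t \<in> inner j then 1 else 0))"
  proof (intro sum.cong refl)
    fix t assume t: "t \<in> V"
    have j': "Suc (j - 1) = j" using j by simp
    show "x t * (real (dst f t (u (j - 1)) + dst f t (u (Suc j))) - 2 * real (dst f t (u j)))
      = x t * (if f t = u j then 2 else 0) + x t * (if t \<in> inner (j - 1) then 1 else 0)
        + x t * (if t \<in> inner j then 1 else 0)"
      unfolding second_diff[OF f t j] using spiny_inner[OF f s t, of "j - 1"] spiny_inner[OF f s t, of j]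
      unfolding j' by (simp add: algebra_simps)
  qed
  finally show ?thesis unfolding sum.distrib sum_pick innerV by simp
qed

text \<open>A typical vertex is one step nearer to \<open>u 1\<close> than to \<open>u 0\<close>,
  hence \<open>- sum x V\<close>; vertices with foot \<open>u 0\<close> are one step farther, a
  correction of 2, and those of \<open>inner 0\<close> are equidistant, a correction of 1.\<close>

lemma eig_left_end:
  assumes f: "footed f" and x: "eig f x" and s: "spiny f"
  shows "rho f * (x (u 1) - x (u 0)) = 2 * sum x {t\<in>V. f t = u 0} + sum x (inner 0) - sum x V"
proof -
  have uV: "u 1 \<in> V" "u 0 \<in> V" using uB L1 by (auto simp: V_def)
  have D: "real (dst f t (u 1)) - real (dst f t (u 0))
      = (if f t = u 0 then 2 else 0) + (if t \<in> inner 0 then 1 else 0) - 1" if t: "t \<in> V" for t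
    using eq_u_iff[OF f t, of 0] spiny_inner[OF f s t, of 0] lohi_foot[OF f t]
      dst_u[OF f t, of 1] dst_u[OF f t, of 0] L1
    by (cases "lo (f t)") (auto simp: max_def)
  then have "rho f * (x (u 1) - x (u 0)) = (\<Sum>t\<in>V. x t * (if f t = u 0 then 2 else 0)
      + x t * (if t \<in> inner 0 then 1 else 0) - x t)"
    unfolding eig_diff[OF x uV] by (intro sum.cong refl, subst D) (simp_all add: algebra_simps)
  then show ?thesis unfolding sum.distrib sum_subtractf sum_pick innerV by simp
qed

lemma eig_right_end:
  assumes f: "footed f" and x: "eig f x" and s: "spiny f"
  shows "rho f * (x (u (L - 1)) - x (u L)) = 2 * sum x {t\<in>V. f t = u L} + sum x (inner (L - 1)) - sum x V"
proof -
  have uV: "u (L - 1) \<in> V" "u L \<in> V" using uB L1 by (auto simp: V_def)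
  have D: "real (dst f t (u (L - 1))) - real (dst f t (u L))
      = (if f t = u L then 2 else 0) + (if t \<in> inner (L - 1) then 1 else 0) - 1" if t: "t \<in> V" for t
  proof -
    obtain K where K: "L = Suc K" using L1 by (cases L) auto
    have h: "hi (f t) = lo (f t) \<or> hi (f t) = Suc (lo (f t))" "hi (f t) \<le> Suc K"
      using lohi_foot[OF f t] hiL[OF foot_in[OF f t]] K by auto
    then consider "lo (f t) = Suc K" "hi (f t) = Suc K" | "lo (f t) = K" "hi (f t) = Suc K"
      | "hi (f t) \<le> K" "lo (f t) \<le> K" by linarith
    note cases = this
    have d: "dst f t (u K) = ht t + max (K - lo (f t)) (hi (f t) - K)"
      "dst f t (u (Suc K)) = ht t + max (Suc K - lo (f t)) (hi (f t) - Suc K)"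
      using dst_u[OF f t, of K] dst_u[OF f t, of "Suc K"] K by simp_all
    have e: "f t = u (Suc K) \<longleftrightarrow> lo (f t) = Suc K \<and> hi (f t) = Suc K"
      "t \<in> inner K \<longleftrightarrow> lo (f t) = K \<and> hi (f t) = Suc K"
      using eq_u_iff[OF f t, of "Suc K"] spiny_inner[OF f s t, of K] K by simp_all
    show ?thesis
      unfolding K diff_Suc_1 d e by (rule cases) (simp_all add: max_def)
  qed
  then have "rho f * (x (u (L - 1)) - x (u L)) = (\<Sum>t\<in>V. x t * (if f t = u L then 2 else 0)
      + x t * (if t \<in> inner (L - 1) then 1 else 0) - x t)"
    unfolding eig_diff[OF x uV] by (intro sum.cong refl, subst D) (simp_all add: algebra_simps)
  then show ?thesis unfolding sum.distrib sum_subtractf sum_pick innerV by simp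
qed

text \<open>Seen from outside the edge, an inner vertex is as far away as the farther of the two
  ends, and the end distances differ by 1; so twice its distance minus both end distances is 1, with
  corrections inside the edge. Summing the resulting equation over the \<open>k - 2\<close> inner
  vertices solves for their total weight. This is the origin of \<open>\<alpha>\<close> and
  \<open>\<beta>\<close> in the reflection argument.\<close>

lemma eig_inner:
  assumes f: "footed f" and x: "eig f x" and s: "spiny f" and i: "i < L"
  shows "(2 * rho f + real k) * sum x (inner i)
    = real (k - 2) * (rho f * (x (u i) + x (u (Suc i))) + sum x V)"
proof -
  have uV: "u i \<in> V" "u (Suc i) \<in> V" using uB i by (auto simp: V_def)
  have one: "(2 * rho f + 2) * x v = rho f * (x (u i) + x (u (Suc i))) + sum x V - sum x (inner i)"
    if v: "v \<in> inner i" for v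
  proof -
    have vV: "v \<in> V" and vB: "v \<in> B" and lv: "lo v = i" "hi v = Suc i" using v by (auto simp: V_def inner_def)
    have coeff: "2 * real (dst f t v) - real (dst f t (u i)) - real (dst f t (u (Suc i)))
        = 1 - (if t \<in> inner i then 1 else 0) - (if t = v then 2 else 0)" if t: "t \<in> V" for t
    proof (cases "t = v")
      case True
      then have "dst f t v = 0" "dst f t (u i) = 1" "dst f t (u (Suc i)) = 1"
        using footB[OF f vB] dst_u[OF f t, of i] dst_u[OF f t, of "Suc i"] i vB lv
        by (simp_all add: ht_def) (simp add: dst_def)
      then show ?thesis using True v by simp
    next
      case False
      have "f t \<noteq> v"
      proof
        assume "f t = v"
        then have "t \<in> B" using spiny_inner[OF f s t, of i] lv by (simp add: inner_def)
        then show False using \<open>f t = v\<close> False footB[OF f] by simp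
      qed
      then have dv: "dst f t v = ht t + max (Suc i - lo (f t)) (hi (f t) - i)"
        using dst_base[OF f vB, of t] lv by (simp add: bd_def)
      have d: "dst f t (u i) = ht t + max (i - lo (f t)) (hi (f t) - i)"
        "dst f t (u (Suc i)) = ht t + max (Suc i - lo (f t)) (hi (f t) - Suc i)"
        using dst_u[OF f t, of i] dst_u[OF f t, of "Suc i"] i by auto
      note e = spiny_inner[OF f s t, of i]
      consider "hi (f t) \<le> i" "lo (f t) \<le> i" | "Suc i \<le> lo (f t)" "Suc i \<le> hi (f t)"
        | "lo (f t) = i" "hi (f t) = Suc i"
        using lohi_foot[OF f t] by linarith
      then show ?thesis
      proof cases
        case 3
        then have "ht t = 0" using e by (simp add: ht_def inner_def)
        then show ?thesis unfolding dv d e using 3 False by simp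
      qed (unfold dv d e, use False in \<open>simp_all add: max_def\<close>)
    qed
    have "rho f * (2 * x v - x (u i) - x (u (Suc i)))
        = rho f * (x v - x (u i)) + rho f * (x v - x (u (Suc i)))" by (simp add: algebra_simps)
    also have "\<dots> = (\<Sum>t\<in>V. x t * (2 * real (dst f t v) - real (dst f t (u i)) - real (dst f t (u (Suc i)))))"
      unfolding eig_diff[OF x vV uV(1)] eig_diff[OF x vV uV(2)] sum.distrib[symmetric]
      by (intro sum.cong refl) (simp add: algebra_simps)
    also have "\<dots> = (\<Sum>t\<in>V. x t - x t * (if t \<in> inner i then 1 else 0) - x t * (if t = v then 2 else 0))"
      by (intro sum.cong refl, subst coeff) (simp_all add: algebra_simps)
    also have "\<dots> = sum x V - sum x (inner i) - 2 * x v"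
    proof -
      have "{t \<in> V. t = v} = {v}" using vV by auto
      then show ?thesis unfolding sum_subtractf sum_pick innerV by simp
    qed
    finally show ?thesis by (simp add: algebra_simps)
  qed
  have "(2 * rho f + 2) * sum x (inner i) = (\<Sum>v\<in>inner i. rho f * (x (u i) + x (u (Suc i))) + sum x V - sum x (inner i))"
    unfolding sum_distrib_left by (intro sum.cong refl one)
  also have "\<dots> = real (k - 2) * (rho f * (x (u i) + x (u (Suc i))) + sum x V - sum x (inner i))"
    using card_inner[OF i] by (simp add: inner_def)
  finally show ?thesis using k2 by (simp add: algebra_simps of_nat_diff)
qed

text \<open>Same elimination as for inner vertices, now against the single root: a vertex outside
  \<open>g\<close> is one step farther from \<open>z\<close> than from \<open>w\<close>.\<close>

lemma eig_pendant:
  assumes f: "footed f" and x: "eig f x" and g: "g \<in> F" and w: "f ` g = {w}"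
  shows "(rho f + real k) * sum x g = real (k - 1) * (rho f * x w + sum x V)"
proof -
  have gV: "g \<subseteq> V" using g by (auto simp: V_def)
  have fz: "f z = w" if "z \<in> g" for z using w that by auto
  obtain y where "y \<in> g" using g_ne[OF g] by blast
  then have wB: "w \<in> B" using foot_in[OF f, of y] gV fz[of y] by auto
  then have wV: "w \<in> V" by (simp add: V_def)
  have one: "(rho f + 1) * x z = rho f * x w + sum x V - sum x g" if z: "z \<in> g" for z
  proof -
    have zV: "z \<in> V" using z gV by blast
    have zB: "z \<notin> B" using FB[OF g] z by blast
    have coeff: "real (dst f t z) - real (dst f t w) = 1 - (if t \<in> g then 1 else 0) - (if t = z then 1 else 0)"
      if t: "t \<in> V" for t
    proof -
      have dw: "dst f t w = ht t + bd (f t) w" by (rule dst_base[OF f wB])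
      consider "t = z" | "t \<in> g" "t \<noteq> z" | "t \<notin> g" by blast
      then show ?thesis
      proof cases
        case 1
        then show ?thesis using dw z fz zB by (simp add: dst_def ht_def)
      next
        case 2
        then have "same t z" "t \<notin> B" using g z FB[OF g] by (auto simp: same_def)
        then show ?thesis using 2 dw fz by (simp add: dst_def ht_def)
      next
        case 3
        then have "\<not> same t z" using disjF[OF _ g _ z] by (auto simp: same_def)
        then show ?thesis using 3 dw z fz zB by (auto simp: dst_def ht_def)
      qed
    qed
    have "rho f * (x z - x w) = (\<Sum>t\<in>V. x t - x t * (if t \<in> g then 1 else 0) - x t * (if t = z then 1 else 0))"
      unfolding eig_diff[OF x zV wV]
      by (intro sum.cong refl, subst coeff) (simp_all add: algebra_simps)
    also have "\<dots> = sum x V - sum x g - x z"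
    proof -
      have "{t \<in> V. t = z} = {z}" "{t \<in> V. t \<in> g} = g" using zV gV by auto
      then show ?thesis unfolding sum_subtractf sum_pick by simp
    qed
    finally show ?thesis by (simp add: algebra_simps)
  qed
  have "(rho f + 1) * sum x g = (\<Sum>z\<in>g. rho f * x w + sum x V - sum x g)"
    unfolding sum_distrib_left by (intro sum.cong refl one)
  also have "\<dots> = real (k - 1) * (rho f * x w + sum x V - sum x g)"
    using cardF[OF g] by simp
  finally show ?thesis using k2 by (simp add: algebra_simps of_nat_diff)
qed

lemma foot_class_sum:
  fixes x :: "'a \<Rightarrow> real"
  assumes f: "footed f" and w: "w \<in> B"
  shows "sum x {t\<in>V. f t = w} = x w + (\<Sum>g\<in>{g\<in>F. f ` g = {w}}. sum x g)"
proof -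
  let ?G = "{g\<in>F. f ` g = {w}}"
  have eq: "{t\<in>V. f t = w} = insert w (\<Union>?G)"
  proof (intro equalityI subsetI)
    fix t assume t: "t \<in> {t\<in>V. f t = w}"
    show "t \<in> insert w (\<Union>?G)"
    proof (cases "t \<in> B")
      case False
      then obtain g where "g \<in> F" "t \<in> g" using t by (auto simp: V_def)
      moreover from this have "f ` g = {w}" using foot_image[OF f, of g t] t by simp
      ultimately show ?thesis by blast
    qed (use t footB[OF f] in simp)
  next
    fix t assume "t \<in> insert w (\<Union>?G)"
    then show "t \<in> {t\<in>V. f t = w}" using w footB[OF f] by (auto simp: V_def)
  qed
  have "w \<notin> \<Union>?G" using FB w by blast
  moreover have fin: "finite (\<Union>?G)" using finF finite_g by auto
  moreover have "sum x (\<Union>?G) = (\<Sum>g\<in>?G. sum x g)"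
    using finF finite_g disjF by (subst sum.Union_disjoint) auto
  ultimately show ?thesis unfolding eq by simp
qed

text \<open>Expresses the weight hanging at \<open>w\<close> as an increasing affine function of the
  entry there, with slope and constant growing in \<open>tcount\<close>. This makes the class
  weights comparable under reflection.\<close>

lemma eig_foot_class:
  assumes f: "footed f" and x: "eig f x" and w: "w \<in> B"
  shows "sum x {t\<in>V. f t = w}
    = x w + real (tcount f w) * (real (k - 1) * (rho f * x w + sum x V) / (rho f + real k))"
proof -
  have "rho f + real k > 0" using rho_ge1(2)[OF f x u01(1)] by linarith
  then have "sum x g = real (k - 1) * (rho f * x w + sum x V) / (rho f + real k)"
    if "g \<in> {g\<in>F. f ` g = {w}}" for g
    using eig_pendant[OF f x, of g w] that by (simp add: field_simps)
  then have "(\<Sum>g\<in>{g\<in>F. f ` g = {w}}. sum x g)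
      = (\<Sum>g\<in>{g\<in>F. f ` g = {w}}. real (k - 1) * (rho f * x w + sum x V) / (rho f + real k))"
    by (rule sum.cong[OF refl])
  then show ?thesis unfolding foot_class_sum[OF f w] by (simp add: tcount_def)
qed

definition left_heavy where
  "left_heavy f \<longleftrightarrow> (\<forall>i. 2 * i \<le> L \<longrightarrow> tcount f (u (L - i)) \<le> tcount f (u i))"

text \<open>The side with more pendant edges is closer to the bulk of the weight and so has the
  smaller entries. The proof instantiates \<open>reflect_le\<close>: a larger entry on the left
  would, by \<open>left_heavy\<close> and \<open>eig_foot_class\<close>, force at least as large an
  excess of hanging weight there.\<close>

lemma eig_reflect:
  assumes f: "footed f" and x: "eig f x" and s: "spiny f" and lh: "left_heavy f" and i: "2 * i \<le> L"
  shows "x (u i) \<le> x (u (L - i))"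
proof -
  define \<rho> M where "\<rho> = rho f" and "M = sum x V"
  have \<rho>: "\<rho> \<ge> 1" unfolding \<rho>_def by (rule rho_ge1(2)[OF f x u01(1)])
  have M: "M \<ge> 0" unfolding M_def using eig_pos[OF x] by (intro sum_nonneg) (simp add: less_imp_le)
  define \<alpha> \<beta> where "\<alpha> = real (k - 2) * \<rho> / (2 * \<rho> + real k)" and "\<beta> = real (k - 2) * M / (2 * \<rho> + real k)"
  have D: "2 * \<rho> + real k > 0" using \<rho> by linarith
  define W where "W i = sum x {t\<in>V. f t = u i}" for i
  define I where "I i = sum x (inner i)" for i
  show ?thesis
  proof (rule reflect_le[where L = L and \<alpha> = \<alpha> and \<beta> = \<beta> and \<rho> = \<rho> and W = W and I = I and M = M
        and f = "\<lambda>i. x (u i)"])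
    show "0 \<le> \<alpha>" using \<rho> by (simp add: \<alpha>_def)
    have "real (k - 2) * \<rho> < \<rho> * (2 * \<rho> + real k)"
    proof -
      have "real (k - 2) < 2 * \<rho> + real k" using \<rho> by (simp add: of_nat_diff k2)
      then have "\<rho> * real (k - 2) < \<rho> * (2 * \<rho> + real k)" using \<rho> by (intro mult_strict_left_mono) auto
      then show ?thesis by (simp add: mult.commute)
    qed
    then show "\<alpha> < \<rho>" using D by (simp add: \<alpha>_def divide_less_eq)
    show "\<rho> * (x (u (j - 1)) + x (u (Suc j)) - 2 * x (u j)) = 2 * W j + I (j - 1) + I j"
      if "0 < j" "j < L" for j
      using eig_second_diff[OF f x s that] by (simp add: \<rho>_def W_def I_def)
    show "\<rho> * (x (u 1) - x (u 0)) = 2 * W 0 + I 0 - M"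
      using eig_left_end[OF f x s] by (simp add: \<rho>_def W_def I_def M_def)
    show "\<rho> * (x (u (L - 1)) - x (u L)) = 2 * W L + I (L - 1) - M"
      using eig_right_end[OF f x s] by (simp add: \<rho>_def W_def I_def M_def)
    show "I i = \<alpha> * (x (u i) + x (u (Suc i))) + \<beta>" if "i < L" for i
    proof -
      have "(2 * \<rho> + real k) * I i = real (k - 2) * (\<rho> * (x (u i) + x (u (Suc i))) + M)"
        using eig_inner[OF f x s that] by (simp add: \<rho>_def I_def M_def)
      then have "I i = real (k - 2) * (\<rho> * (x (u i) + x (u (Suc i))) + M) / (2 * \<rho> + real k)"
        using D by (simp add: field_simps)
      then show ?thesis by (simp add: \<alpha>_def \<beta>_def add_divide_distrib[symmetric] algebra_simps)
    qed
    show "x (u i) - x (u (L - i)) \<le> W i - W (L - i)"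
      if i: "2 * i \<le> L" and le: "x (u (L - i)) \<le> x (u i)" for i
    proof -
      define c where "c y = real (k - 1) * (\<rho> * y + M) / (\<rho> + real k)" for y
      have uB': "u i \<in> B" "u (L - i) \<in> B" using uB i by auto
      have Wi: "W i = x (u i) + real (tcount f (u i)) * c (x (u i))"
        "W (L - i) = x (u (L - i)) + real (tcount f (u (L - i))) * c (x (u (L - i)))"
        using eig_foot_class[OF f x uB'(1)] eig_foot_class[OF f x uB'(2)]
        by (simp_all add: W_def c_def \<rho>_def M_def)
      have "x (u (L - i)) > 0" using eig_pos[OF x] uB'(2) by (auto simp: V_def)
      then have c0: "c (x (u (L - i))) \<ge> 0" using \<rho> M by (simp add: c_def)
      have "\<rho> * x (u (L - i)) \<le> \<rho> * x (u i)" using \<rho> le by simp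
      then have "c (x (u (L - i))) \<le> c (x (u i))"
        unfolding c_def using \<rho> by (intro divide_right_mono mult_left_mono) auto
      moreover have "tcount f (u (L - i)) \<le> tcount f (u i)" using lh i by (simp add: left_heavy_def)
      ultimately have "real (tcount f (u (L - i))) * c (x (u (L - i))) \<le> real (tcount f (u i)) * c (x (u i))"
        using c0 by (intro mult_mono) auto
      then show ?thesis using Wi by simp
    qed
  qed (use L1 i in auto)
qed

text \<open>The condition \<open>p + q > L\<close> places \<open>p\<close> strictly between
  \<open>L - q\<close> and \<open>q\<close>. Strict convexity keeps the entry at \<open>p\<close>
  below the larger of those two, and by reflection that is the one at \<open>q\<close>.\<close>

lemma eig_skew:
  assumes f: "footed f" and x: "eig f x" and s: "spiny f" and lh: "left_heavy f"
    and pq: "p < q" "q \<le> L" "p + q > L"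
  shows "x (u p) < x (u q)"
proof -
  have "x (u p) < max (x (u (L - q))) (x (u q))"
  proof (rule convex_less_max[where L = L and h = "\<lambda>i. x (u i)"])
    fix j assume j: "0 < j" "j < L"
    have uV: "u j \<in> V" using uB j by (simp add: V_def)
    have fin: "finite {t\<in>V. f t = u j}" using finV by simp
    have "u j \<in> {t\<in>V. f t = u j}" using uV footB[OF f uB] j by simp
    then have "sum x {t\<in>V. f t = u j} > 0"
      using eig_pos[OF x] fin by (intro sum_pos2[OF fin]) (auto simp: less_imp_le)
    moreover have nn: "sum x (inner i) \<ge> 0" for i
      using eig_pos[OF x] by (intro sum_nonneg) (auto simp: V_def inner_def less_imp_le)
    ultimately have "rho f * (x (u (j - 1)) + x (u (Suc j)) - 2 * x (u j)) > 0"
      using eig_second_diff[OF f x s j] nn[of "j - 1"] nn[of j] by linarith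
    then show "2 * x (u j) < x (u (j - 1)) + x (u (Suc j))"
      using rho_ge1(2)[OF f x u01(1)] by (simp add: zero_less_mult_iff)
  qed (use pq in auto)
  moreover have "x (u (L - q)) \<le> x (u (L - (L - q)))"
    by (rule eig_reflect[OF f x s lh]) (use pq in auto)
  ultimately show ?thesis using pq by simp
qed

text \<open>Both hypertrees are left-heavy, so \<open>eig_skew\<close> orders the entries at
  \<open>u p\<close> and \<open>u q\<close> in the same way for both Perron vectors, as
  \<open>bilinear_move\<close> demands.\<close>

lemma balance_move:
  assumes f: "footed f" and S: "S \<subseteq> {g\<in>F. f ` g = {u p}}" "S \<noteq> {}"
    and s: "spiny f" and lh: "left_heavy f" "left_heavy (move f (\<Union>S) (u q))"
    and pq: "p < q" "q \<le> L" "p + q > L"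
  shows "rho f < rho (move f (\<Union>S) (u q))"
proof -
  have B: "u p \<in> B" "u q \<in> B" using uB pq by auto
  have SF: "S \<subseteq> F" using S by blast
  have f': "footed (move f (\<Union>S) (u q))" by (rule footed_move[OF f SF B(2)])
  have s': "spiny (move f (\<Union>S) (u q))"
    using s lou[OF pq(2)] hiu[OF pq(2)] by (auto simp: spiny_def move_def)
  obtain x y where x: "eig f x" and y: "eig (move f (\<Union>S) (u q)) y"
    using eig_ex[OF f] eig_ex[OF f'] by blast
  show ?thesis
    by (rule bilinear_move[OF f SF S(2) foot_at[OF S(1)] B x y
          eig_skew[OF f x s lh(1) pq] eig_skew[OF f' y s' lh(2) pq]])
qed

end

section \<open>Maximal caterpillars\<close>

context spine
begin

definition best where
  "best \<Delta> n f \<longleftrightarrow> footed f \<and> deg_ok \<Delta> n f \<and> (\<forall>f'. footed f' \<and> deg_ok \<Delta> n f' \<longrightarrow> rho f' \<le> rho f)"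

definition bare where "bare f b \<longleftrightarrow> (\<forall>z\<in>V. f z = b \<longrightarrow> z = b)"

lemma tcount_0_iff:
  assumes f: "footed f" and b: "b \<in> B" shows "tcount f b = 0 \<longleftrightarrow> bare f b"
proof -
  have "tcount f b = 0 \<longleftrightarrow> {g\<in>F. f ` g = {b}} = {}" using finF by (simp add: tcount_def)
  also have "\<dots> \<longleftrightarrow> bare f b"
  proof
    assume e: "{g\<in>F. f ` g = {b}} = {}"
    show "bare f b" unfolding bare_def
    proof (intro ballI impI)
      fix z assume z: "z \<in> V" "f z = b"
      show "z = b"
      proof (cases "z \<in> B")
        case False
        then obtain g where "g \<in> F" "z \<in> g" using z by (auto simp: V_def)
        with foot_image[OF f this] z e show ?thesis by blast
      qed (use z footB[OF f] in simp)
    qed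
  next
    assume b': "bare f b"
    show "{g\<in>F. f ` g = {b}} = {}"
    proof (rule ccontr)
      assume "{g\<in>F. f ` g = {b}} \<noteq> {}"
      then obtain g where g: "g \<in> F" "f ` g = {b}" by blast
      then obtain z where "z \<in> g" using g_ne by blast
      then have "z \<in> V" "f z = b" "z \<noteq> b" using g FB[OF g(1)] b by (auto simp: V_def)
      then show False using b' by (auto simp: bare_def)
    qed
  qed
  finally show ?thesis .
qed

lemma tcount_ne: "tcount f b \<noteq> 0 \<Longrightarrow> {g\<in>F. f ` g = {b}} \<noteq> {}"
  unfolding tcount_def by (metis card.empty)

lemma best_no_transfer:
  assumes bst: "best \<Delta> n f" and w: "w \<in> B" "w' \<in> B" "w \<noteq> w'" and p: "pdeg w = pdeg w'"
    and t: "tcount f w' = 0"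
  shows "rho (move f (\<Union>{g\<in>F. f ` g = {w}}) w') \<le> rho f"
proof -
  have f: "footed f" using bst by (simp add: best_def)
  have "footed (move f (\<Union>{g\<in>F. f ` g = {w}}) w')" using w by (intro footed_move f) auto
  moreover have "deg_ok \<Delta> n (move f (\<Union>{g\<in>F. f ` g = {w}}) w')"
    using bst by (intro deg_ok_transfer f w p t) (simp add: best_def)
  ultimately show ?thesis using bst by (simp add: best_def)
qed

lemma best_inner:
  assumes bst: "best \<Delta> n f" and L: "tcount f (u L) = 0" and v: "v \<in> B" "lo v = i" "hi v = Suc i"
    and i: "Suc i < L" and x: "eig f x"
    and heavy: "sum x {t\<in>V. lo (f t) \<ge> Suc i} \<le> sum x {t\<in>V. hi (f t) \<le> i}"
  shows "tcount f v = 0"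
proof (rule ccontr)
  assume t: "tcount f v \<noteq> 0"
  define S where "S = {g\<in>F. f ` g = {v}}"
  have f: "footed f" using bst by (simp add: best_def)
  have uL: "u L \<in> B" using uB by simp
  have S: "S \<noteq> {}" using tcount_ne[OF t] by (simp add: S_def)
  have ne: "v \<noteq> u L" using v lou[of L] hiu[of L] by auto
  have "rho f < rho (move f (\<Union>S) (u L))"
    by (rule inner_move[OF f v i S_def S _ x heavy])
      (use tcount_0_iff[OF f uL] L in \<open>auto simp: bare_def\<close>)
  moreover have "rho (move f (\<Union>S) (u L)) \<le> rho f"
    unfolding S_def using v pdeg_inner[OF v(1)] pdeg_u[of L]
    by (intro best_no_transfer[OF bst v(1) uL ne _ L]) simp
  ultimately show False by simp
qed

text \<open>Both vertices are below degree \<open>\<Delta>\<close> before and after the move, so the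
  set of vertices of degree \<open>\<Delta>\<close> is untouched.\<close>

lemma deg_ok_shift:
  assumes f: "footed f" and g: "g \<in> F" "f ` g = {w}" and w: "w \<in> B" "w' \<in> B" "w \<noteq> w'"
    and lt: "pdeg w + tcount f w < \<Delta>" "Suc (pdeg w' + tcount f w') < \<Delta>"
    and ok: "deg_ok \<Delta> n f"
  shows "deg_ok \<Delta> n (move f (\<Union>{g}) w')"
proof -
  let ?f = "move f (\<Union>{g}) w'"
  have f': "footed ?f" using w g by (intro footed_move f) auto
  have S: "{g} \<subseteq> {g\<in>F. f ` g = {w}}" using g by simp
  have "degree (edges ?f) v \<le> \<Delta> \<and> (degree (edges ?f) v = \<Delta> \<longleftrightarrow> degree (edges f) v = \<Delta>)" if v: "v \<in> V" for v
  proof (cases "v \<in> B")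
    case True
    have "degree (edges f) v \<le> \<Delta>" using ok v by (simp add: deg_ok_def)
    then show ?thesis
      unfolding degree_edges(1)[OF f' True] degree_edges(1)[OF f True] tcount_move[OF S w(3)]
      using lt by auto
  next
    case False
    then have d: "degree (edges ?f) v = 1" "degree (edges f) v = 1"
      using v degree_edges(2)[OF f', of v] degree_edges(2)[OF f, of v] by auto
    moreover have "degree (edges f) v \<le> \<Delta>" using ok v by (simp add: deg_ok_def)
    ultimately show ?thesis by simp
  qed
  then have "\<forall>v\<in>V. degree (edges ?f) v \<le> \<Delta>"
    and "{v\<in>V. degree (edges ?f) v = \<Delta>} = {v\<in>V. degree (edges f) v = \<Delta>}" by auto
  then show ?thesis using ok by (simp add: deg_ok_def)
qed

text \<open>At a vertex of degree strictly between 2 and \<open>\<Delta>\<close> a single pendant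
  edge is free to leave. It can go to either end of the path, whose degree then is 2, still below
  \<open>\<Delta>\<close> because \<open>\<Delta> \<ge> 3\<close>; by \<open>spine_move\<close> one
  of the two moves gains.\<close>

lemma best_counts:
  assumes bst: "best \<Delta> n f" and \<Delta>: "\<Delta> \<ge> 3" and ends: "tcount f (u 0) = 0" "tcount f (u L) = 0"
    and i: "0 < i" "i < L"
  shows "tcount f (u i) = 0 \<or> tcount f (u i) = \<Delta> - 2"
proof (rule ccontr)
  assume c: "\<not> ?thesis"
  have f: "footed f" and ok: "deg_ok \<Delta> n f" using bst by (auto simp: best_def)
  have ui: "u i \<in> B" "u 0 \<in> B" "u L \<in> B" using uB i by auto
  have ne: "u i \<noteq> u 0" "u i \<noteq> u L" using lou[of i] lou[of 0] lou[of L] i by auto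
  have "degree (edges f) (u i) \<le> \<Delta>" using ok ui by (auto simp: deg_ok_def V_def)
  then have lt: "pdeg (u i) + tcount f (u i) < \<Delta>"
    using c pdeg_u[of i] i degree_edges(1)[OF f ui(1)] by auto
  obtain g where g: "g \<in> F" "f ` g = {u i}"
    using c tcount_ne[of f "u i"] by auto
  have e0: "Suc (pdeg (u 0) + tcount f (u 0)) < \<Delta>" "Suc (pdeg (u L) + tcount f (u L)) < \<Delta>"
    using ends pdeg_u[of 0] pdeg_u[of L] \<Delta> by auto
  have "rho f < rho (move f (\<Union>{g}) (u 0)) \<or> rho f < rho (move f (\<Union>{g}) (u L))"
    by (rule spine_move[OF f, of "{g}" i]) (use g i in auto)
  moreover have "rho (move f (\<Union>{g}) (u 0)) \<le> rho f"
    using bst deg_ok_shift[OF f g ui(1,2) ne(1) lt e0(1) ok] footed_move[OF f, of "{g}" "u 0"] g ui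
    by (auto simp: best_def)
  moreover have "rho (move f (\<Union>{g}) (u L)) \<le> rho f"
    using bst deg_ok_shift[OF f g ui(1,3) ne(2) lt e0(2) ok] footed_move[OF f, of "{g}" "u L"] g ui
    by (auto simp: best_def)
  ultimately show False by linarith
qed

lemma best_no_gap:
  assumes bst: "best \<Delta> n f" and j: "0 < j1" "j1 < i" "i < j2" "j2 < L"
    and z: "tcount f (u j1) = 0" "tcount f (u j2) = 0"
  shows "tcount f (u i) = 0"
proof (rule ccontr)
  assume t: "tcount f (u i) \<noteq> 0"
  define S where "S = {g\<in>F. f ` g = {u i}}"
  have f: "footed f" using bst by (simp add: best_def)
  have S: "S \<noteq> {}" using tcount_ne[OF t] by (simp add: S_def)
  have uB': "u i \<in> B" "u j1 \<in> B" "u j2 \<in> B" using uB j by auto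
  have ne: "u i \<noteq> u j1" "u i \<noteq> u j2" using lou[of i] lou[of j1] lou[of j2] j by auto
  have p: "pdeg (u i) = pdeg (u j1)" "pdeg (u i) = pdeg (u j2)"
    using pdeg_u[of i] pdeg_u[of j1] pdeg_u[of j2] j by auto
  have "rho f < rho (move f (\<Union>S) (u j1)) \<or> rho f < rho (move f (\<Union>S) (u j2))"
    by (rule spine_move[OF f _ S j(2,3)]) (use j in \<open>auto simp: S_def\<close>)
  moreover have "rho (move f (\<Union>S) (u j1)) \<le> rho f" "rho (move f (\<Union>S) (u j2)) \<le> rho f"
    unfolding S_def using best_no_transfer[OF bst uB'(1,2) ne(1) p(1) z(1)]
      best_no_transfer[OF bst uB'(1,3) ne(2) p(2) z(2)] by auto
  ultimately show False by linarith
qed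

definition shape where
  "shape \<Delta> a b f \<longleftrightarrow> footed f \<and> spiny f \<and> a + b < L \<and>
    (\<forall>j\<le>L. tcount f (u j) = (if 1 \<le> j \<and> j \<le> a \<or> L - b \<le> j \<and> j \<le> L - 1 then \<Delta> - 2 else 0))"

lemma shape_left_heavy:
  assumes "shape \<Delta> a b f" "b \<le> a" shows "left_heavy f"
  unfolding left_heavy_def
proof (intro allI impI)
  fix i assume i: "2 * i \<le> L"
  have s: "tcount f (u j) = (if 1 \<le> j \<and> j \<le> a \<or> L - b \<le> j \<and> j \<le> L - 1 then \<Delta> - 2 else 0)"
    if "j \<le> L" for j using assms that by (simp add: shape_def)
  have ab: "a + b < L" using assms by (simp add: shape_def)
  have "1 \<le> i \<and> i \<le> a \<or> L - b \<le> i \<and> i \<le> L - 1"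
    if "1 \<le> L - i \<and> L - i \<le> a \<or> L - b \<le> L - i \<and> L - i \<le> L - 1"
    using that i ab assms(2) by linarith
  then show "tcount f (u (L - i)) \<le> tcount f (u i)" using s[of "L - i"] s[of i] i by auto
qed

text \<open>If \<open>a \<ge> b + 2\<close>, the bundle at the innermost vertex \<open>u a\<close>
  of the left segment goes to \<open>u q\<close> with \<open>q = L - b - 1\<close>, the bare
  position next to the right segment; \<open>a + b + 1 < L\<close> says that such a position exists.
  The new segments have sizes \<open>a - 1\<close> and \<open>b + 1\<close>, so both hypertrees are
  left-heavy, and \<open>a + q > L\<close>.\<close>

lemma best_balanced:
  assumes bst: "best \<Delta> n f" and sh: "shape \<Delta> a b f" and \<Delta>: "\<Delta> \<ge> 3" and ab: "a + b + 1 < L"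
  shows "a \<le> b + 1"
proof (rule ccontr)
  assume "\<not> a \<le> b + 1"
  then have big: "b + 2 \<le> a" by simp
  define q where "q = L - b - 1"
  define S where "S = {g\<in>F. f ` g = {u a}}"
  let ?f = "move f (\<Union>S) (u q)"
  have f: "footed f" and s: "spiny f" using sh by (auto simp: shape_def)
  have q: "a < q" "q \<le> L" "a + q > L" "q < L" "0 < a" using big ab by (auto simp: q_def)
  have tc: "tcount f (u j) = (if 1 \<le> j \<and> j \<le> a \<or> L - b \<le> j \<and> j \<le> L - 1 then \<Delta> - 2 else 0)"
    if "j \<le> L" for j using sh that by (simp add: shape_def)
  have ta: "tcount f (u a) = \<Delta> - 2" and tq: "tcount f (u q) = 0"
    using tc[of a] tc[of q] q by (auto simp: q_def)
  have uB': "u a \<in> B" "u q \<in> B" using uB q by auto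
  have ne: "u a \<noteq> u q" using lou[of a] lou[of q] q by auto
  have p: "pdeg (u a) = pdeg (u q)" using pdeg_u[of a] pdeg_u[of q] q by auto
  have cS: "card S = \<Delta> - 2" using ta by (simp add: tcount_def S_def)
  then have Sne: "S \<noteq> {}" using \<Delta> by auto
  have SF: "S \<subseteq> F" by (auto simp: S_def)
  have S': "S \<subseteq> {g\<in>F. f ` g = {u a}}" by (simp add: S_def)
  have aL: "a \<le> L" using ab by simp
  have inj: "u i = u j \<longleftrightarrow> i = j" if "i \<le> L" "j \<le> L" for i j using lou[OF that(1)] lou[OF that(2)] by metis
  have "shape \<Delta> (a - 1) (b + 1) ?f"
    unfolding shape_def
  proof (intro conjI allI impI)
    show "footed ?f" by (rule footed_move[OF f SF uB'(2)])
    show "spiny ?f" using s lou[OF q(2)] hiu[OF q(2)] by (auto simp: spiny_def move_def)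
    show "a - 1 + (b + 1) < L" using ab q by auto
    fix j assume j: "j \<le> L"
    have "tcount ?f (u j) = (if j = a then 0 else if j = q then \<Delta> - 2 else tcount f (u j))"
      unfolding tcount_move[OF S' ne] inj[OF j aL] inj[OF j q(2)] cS ta tq by simp
    with tc[OF j] show "tcount ?f (u j) = (if 1 \<le> j \<and> j \<le> a - 1 \<or> L - (b + 1) \<le> j \<and> j \<le> L - 1 then \<Delta> - 2 else 0)"
    proof -
      consider "j = a" | "j = q" "j \<noteq> a" | "j \<noteq> a" "j \<noteq> q" by blast
      then have "(1 \<le> j \<and> j \<le> a - 1 \<or> L - (b + 1) \<le> j \<and> j \<le> L - 1)
          \<longleftrightarrow> (j \<noteq> a \<and> (j = q \<or> 1 \<le> j \<and> j \<le> a \<or> L - b \<le> j \<and> j \<le> L - 1))"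
      proof cases
        case 1
        then show ?thesis using ab q unfolding q_def by linarith
      next
        case 2
        then show ?thesis using ab unfolding q_def by linarith
      next
        case 3
        then show ?thesis using ab unfolding q_def by linarith
      qed
      then show ?thesis using tc[OF j] \<open>tcount ?f (u j) = _\<close> by simp
    qed
  qed
  then have lh': "left_heavy ?f" by (rule shape_left_heavy) (use big in simp)
  have lh: "left_heavy f" using shape_left_heavy[OF sh] big by simp
  have "rho f < rho ?f" by (rule balance_move[OF f S' Sne s lh lh' q(1-3)])
  moreover have "rho ?f \<le> rho f" unfolding S_def by (rule best_no_transfer[OF bst uB' ne p tq])
  ultimately show False by simp
qed

lemma shape_count:
  assumes sh: "shape \<Delta> a b f" and \<Delta>: "\<Delta> \<ge> 3"
  shows "card F = (a + b) * (\<Delta> - 2)" and "card {v\<in>V. degree (edges f) v = \<Delta>} = a + b"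
proof -
  define J where "J = {1..a} \<union> {L - b..L - 1}"
  have f: "footed f" and s: "spiny f" and ab: "a + b < L" using sh by (auto simp: shape_def)
  have JL: "J \<subseteq> {0<..<L}" using ab L1 by (auto simp: J_def)
  have cJ: "card J = a + b"
  proof -
    have "card J = card {1..a} + card {L - b..L - 1}"
      unfolding J_def using ab by (intro card_Un_disjoint) auto
    then show ?thesis using ab by simp
  qed
  have tc: "tcount f (u j) = (if j \<in> J then \<Delta> - 2 else 0)" if "j \<le> L" for j
    using sh that by (simp add: shape_def J_def)
  have injJ: "inj_on u {..L}" by (rule inj_on_inverseI[where g = lo]) (simp add: lou)
  have onJ: "\<exists>j\<in>J. f ` g = {u j}" if g: "g \<in> F" for g
  proof -
    obtain z where z: "z \<in> g" using g_ne[OF g] by blast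
    have zV: "z \<in> V - B" using g z FB[OF g] by (auto simp: V_def)
    have "f z = u (lo (f z))" "lo (f z) \<le> L"
      using u_uniq[OF foot_in[OF f]] s zV hiL[OF foot_in[OF f]] by (force simp: spiny_def)+
    moreover have "f ` g = {f z}" by (rule foot_image[OF f g z])
    ultimately have j: "f ` g = {u (lo (f z))}" "lo (f z) \<le> L" by auto
    then have "g \<in> {g\<in>F. f ` g = {u (lo (f z))}}" using g by simp
    then have "tcount f (u (lo (f z))) \<noteq> 0" using finF by (auto simp: tcount_def)
    then show ?thesis using j tc by (auto split: if_splits)
  qed
  have "F = (\<Union>j\<in>J. {g\<in>F. f ` g = {u j}})" using onJ by auto
  moreover have "card (\<Union>j\<in>J. {g\<in>F. f ` g = {u j}}) = (\<Sum>j\<in>J. card {g\<in>F. f ` g = {u j}})"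
  proof (rule card_UN_disjoint)
    show "finite J" by (simp add: J_def)
    show "\<forall>i\<in>J. \<forall>j\<in>J. i \<noteq> j \<longrightarrow> {g \<in> F. f ` g = {u i}} \<inter> {g \<in> F. f ` g = {u j}} = {}"
      using inj_onD[OF injJ] JL by (fastforce simp: subset_iff)
  qed (use finF in auto)
  moreover have "(\<Sum>j\<in>J. card {g\<in>F. f ` g = {u j}}) = (\<Sum>j\<in>J. \<Delta> - 2)"
    using tc JL by (intro sum.cong refl) (auto simp: tcount_def subset_iff)
  ultimately show "card F = (a + b) * (\<Delta> - 2)" using cJ by simp
  have "{v\<in>V. degree (edges f) v = \<Delta>} = u ` J"
  proof (intro equalityI subsetI)
    fix v assume v: "v \<in> {v\<in>V. degree (edges f) v = \<Delta>}"
    then have vB: "v \<in> B" using degree_edges(2)[OF f, of v] \<Delta> by force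
    have d: "pdeg v + tcount f v = \<Delta>" using v degree_edges(1)[OF f vB] by simp
    show "v \<in> u ` J"
    proof (cases "hi v = lo v")
      case True
      then have j: "v = u (lo v)" "lo v \<le> L" using u_uniq[OF vB] hiL[OF vB] by auto
      then have "lo v \<in> J" using d tc[OF j(2)] pdeg_u[OF j(2)] \<Delta> by (auto split: if_splits)
      then show ?thesis using j by blast
    next
      case False
      have "{g\<in>F. f ` g = {v}} = {}"
      proof -
        have "v = u j \<Longrightarrow> j \<in> J \<Longrightarrow> False" for j using False lou[of j] hiu[of j] JL by (auto simp: subset_iff)
        then show ?thesis using onJ by fastforce
      qed
      then have "tcount f v = 0" unfolding tcount_def by (metis card.empty)
      then show ?thesis using d pdeg_inner[OF vB] lohi[OF vB] False \<Delta> by auto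
    qed
  next
    fix v assume "v \<in> u ` J"
    then obtain j where j: "j \<in> J" "v = u j" by blast
    then have "0 < j" "j < L" using JL by auto
    then show "v \<in> {v\<in>V. degree (edges f) v = \<Delta>}"
      using j uB[of j] degree_edges(1)[OF f, of v] tc[of j] pdeg_u[of j] \<Delta> by (auto simp: V_def)
  qed
  moreover have "card (u ` J) = card J"
    using JL by (intro card_image inj_on_subset[OF injJ]) auto
  ultimately show "card {v\<in>V. degree (edges f) v = \<Delta>} = a + b" using cJ by simp
qed

text \<open>The bare inner positions form an interval; what lies before and after it are the two
  segments. The disjunction separates the case without bare inner positions, where the split is a
  matter of choice and the balanced one is taken, from the case where room for a balancing move
  remains.\<close>

lemma best_shape:
  assumes bst: "best \<Delta> n f" and \<Delta>: "\<Delta> \<ge> 3" and s: "spiny f"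
    and ends: "tcount f (u 0) = 0" "tcount f (u L) = 0"
  shows "\<exists>a b. shape \<Delta> a b f \<and> (a = (a + b) div 2 \<or> a + b + 1 < L)"
proof -
  have f: "footed f" using bst by (simp add: best_def)
  note c = best_counts[OF bst \<Delta> ends]
  define N where "N = {j. 0 < j \<and> j < L \<and> tcount f (u j) = 0}"
  have finN: "finite N" by (simp add: N_def)
  show ?thesis
  proof (cases "N = {}")
    case True
    define a b where "a = (L - 1) div 2" and "b = L - 1 - a"
    have ab: "a + b = L - 1" "a \<le> L - 1" by (auto simp: a_def b_def)
    have "tcount f (u j) = (if 1 \<le> j \<and> j \<le> a \<or> L - b \<le> j \<and> j \<le> L - 1 then \<Delta> - 2 else 0)" if j: "j \<le> L" for j
    proof -
      consider "j = 0" | "j = L" | "0 < j" "j < L" using j by linarith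
      then show ?thesis
      proof cases
        case 3
        then have "tcount f (u j) = \<Delta> - 2" using c[OF 3] True by (auto simp: N_def)
        moreover have "1 \<le> j \<and> j \<le> a \<or> L - b \<le> j \<and> j \<le> L - 1" using 3 ab by linarith
        ultimately show ?thesis by simp
      qed (use ends ab L1 in auto)
    qed
    then have "shape \<Delta> a b f" using f s ab L1 by (auto simp: shape_def)
    moreover have "a = (a + b) div 2" using ab by (simp add: a_def)
    ultimately show ?thesis by blast
  next
    case False
    define j1 j2 where "j1 = Min N" and "j2 = Max N"
    have j12: "j1 \<in> N" "j2 \<in> N" "j1 \<le> j2" using finN False by (auto simp: j1_def j2_def)
    have out: "j \<notin> N" if "j < j1 \<or> j2 < j" for j
      using that Min_le[OF finN, of j] Max_ge[OF finN, of j] unfolding j1_def j2_def by linarith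
    define a b where "a = j1 - 1" and "b = L - 1 - j2"
    have "tcount f (u j) = (if 1 \<le> j \<and> j \<le> a \<or> L - b \<le> j \<and> j \<le> L - 1 then \<Delta> - 2 else 0)" if j: "j \<le> L" for j
    proof -
      have j1: "0 < j1" "j2 < L" using j12 by (auto simp: N_def)
      consider "j = 0" | "j = L" | "0 < j" "j < j1" | "j2 < j" "j < L" | "j = j1 \<or> j = j2" | "j1 < j" "j < j2"
        using j by linarith
      then show ?thesis
      proof cases
        case 3
        then have "tcount f (u j) = \<Delta> - 2" using c[of j] out[of j] j1 j12(3) by (auto simp: N_def)
        then show ?thesis using 3 by (auto simp: a_def)
      next
        case 4
        then have "tcount f (u j) = \<Delta> - 2" using c[of j] out[of j] j1 j12(3) by (auto simp: N_def)
        moreover have "L - b \<le> j \<and> j \<le> L - 1" using 4 by (auto simp: b_def)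
        ultimately show ?thesis by auto
      next
        case 5
        then have "tcount f (u j) = 0" using j12 by (auto simp: N_def)
        moreover have "\<not> (1 \<le> j \<and> j \<le> a \<or> L - b \<le> j \<and> j \<le> L - 1)"
          using 5 j1 j12(3) by (auto simp: a_def b_def)
        ultimately show ?thesis by auto
      next
        case 6
        then have "tcount f (u j) = 0"
          using best_no_gap[OF bst j1(1) 6 j1(2)] j12 by (auto simp: N_def)
        moreover have "\<not> (1 \<le> j \<and> j \<le> a \<or> L - b \<le> j \<and> j \<le> L - 1)"
          using 6 j1 j12(3) by (auto simp: a_def b_def)
        ultimately show ?thesis by auto
      qed (use ends j1 j12(3) in \<open>auto simp: a_def b_def\<close>)
    qed
    moreover have "a + b + 1 < L" using j12 by (auto simp: a_def b_def N_def)
    ultimately show ?thesis using f s by (intro exI[of _ a] exI[of _ b]) (auto simp: shape_def)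
  qed
qed

end

section \<open>Other coordinates for the same hypergraph\<close>

lemma card_exchange:
  assumes "v \<in> A" "w \<notin> A" "finite A" shows "card (insert w (A - {v})) = card A"
proof -
  have "card (insert w (A - {v})) = Suc (card (A - {v}))" using assms by (intro card_insert_disjoint) auto
  then show ?thesis using card_Suc_Diff1[OF assms(3,1)] by simp
qed

context spine
begin

lemma reverse_spine: "spine k L B (\<lambda>b. L - hi b) (\<lambda>b. L - lo b) (\<lambda>j. u (L - j)) F"
proof
  fix b assume b: "b \<in> B"
  show "L - lo b = L - hi b \<or> L - lo b = Suc (L - hi b)" using lohi[OF b] hiL[OF b] by auto
  show "L - lo b \<le> L" by simp
  assume "L - lo b = L - hi b"
  then have "hi b = lo b" using lohi[OF b] hiL[OF b] by auto
  then show "u (L - (L - hi b)) = b" using u_uniq[OF b] hiL[OF b] by simp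
next
  fix i assume i: "i < L"
  have "{b\<in>B. L - hi b = i \<and> L - lo b = Suc i} = {b\<in>B. lo b = L - Suc i \<and> hi b = Suc (L - Suc i)}"
  proof (rule Collect_cong, rule conj_cong[OF refl])
    fix b assume "b \<in> B"
    then show "(L - hi b = i \<and> L - lo b = Suc i) \<longleftrightarrow> (lo b = L - Suc i \<and> hi b = Suc (L - Suc i))"
      using i lohi[of b] hiL[of b] by linarith
  qed
  then show "card {b\<in>B. L - hi b = i \<and> L - lo b = Suc i} = k - 2"
    using card_inner[of "L - Suc i"] i by simp
next
  show "k \<ge> 2" by (rule k2)
  show "L \<ge> 1" by (rule L1)
  show "finite B" by (rule finB)
  show "finite F" by (rule finF)
  show "card g = k - 1" "g \<inter> B = {}" if "g \<in> F" for g using cardF FB that by auto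
  show "g = h" if "g \<in> F" "h \<in> F" "z \<in> g" "z \<in> h" for g h z using disjF that by blast
  show "u (L - j) \<in> B" if "j \<le> L" for j using uB by simp
  show "L - hi (u (L - j)) = j" "L - lo (u (L - j)) = j" if "j \<le> L" for j
    using lou[of "L - j"] hiu[of "L - j"] that by auto
qed

lemma reverse_edges: "spine.edges L B (\<lambda>b. L - hi b) (\<lambda>b. L - lo b) F f = edges f"
proof -
  interpret r: spine k L B "\<lambda>b. L - hi b" "\<lambda>b. L - lo b" "\<lambda>j. u (L - j)" F by (rule reverse_spine)
  have "r.pathE i = pathE (L - Suc i)" if i: "i < L" for i
    unfolding r.pathE_def pathE_def
  proof (rule Collect_cong, rule conj_cong[OF refl])
    fix b assume b: "b \<in> B"
    then show "(i \<le> L - hi b \<and> L - lo b \<le> Suc i) \<longleftrightarrow> (L - Suc i \<le> lo b \<and> hi b \<le> Suc (L - Suc i))"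
      using i lohi[OF b] hiL[OF b] by linarith
  qed
  then have "r.pathE ` {..<L} = pathE ` ((\<lambda>i. L - Suc i) ` {..<L})" by (force simp: image_image)
  also have "(\<lambda>i. L - Suc i) ` {..<L} = {..<L}"
  proof (intro equalityI subsetI)
    fix i assume "i \<in> {..<L}"
    then have "i = L - Suc (L - Suc i)" "L - Suc i \<in> {..<L}" by auto
    then show "i \<in> (\<lambda>i. L - Suc i) ` {..<L}" by blast
  qed auto
  finally show ?thesis unfolding r.edges_def edges_def by simp
qed

lemma swap_end_spine:
  assumes v: "v \<in> B" "lo v = L - 1" "hi v = L"
  shows "spine k L B (lo(u L := L - 1, v := L)) hi (u(L := v)) F"
proof -
  have uL: "u L \<in> B" "lo (u L) = L" "hi (u L) = L" using uB lou hiu by auto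
  have ne: "u L \<noteq> v" using uL v L1 by auto
  have nj: "u j \<noteq> u L" "u j \<noteq> v" if "j < L" for j
  proof -
    have e: "lo (u j) = j" "hi (u j) = j" using lou hiu that by auto
    show "u j \<noteq> u L"
    proof
      assume "u j = u L"
      then show False using e uL that by simp
    qed
    show "u j \<noteq> v"
    proof
      assume "u j = v"
      then show False using e v that by simp
    qed
  qed
  show ?thesis
  proof
    fix b assume b: "b \<in> B"
    show "hi b = (lo(u L := L - 1, v := L)) b \<or> hi b = Suc ((lo(u L := L - 1, v := L)) b)"
      using lohi[OF b] uL v L1 by auto
    show "hi b \<le> L" by (rule hiL[OF b])
    assume e: "hi b = (lo(u L := L - 1, v := L)) b"
    show "(u(L := v)) ((lo(u L := L - 1, v := L)) b) = b"
    proof (cases "b = v")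
      case False
      then have bL: "b \<noteq> u L" using e uL L1 by auto
      then have h: "hi b = lo b" using e False by simp
      then have "u (lo b) = b" by (rule u_uniq[OF b])
      moreover from this have "lo b \<noteq> L" using bL by auto
      ultimately show ?thesis using False bL by simp
    qed simp
  next
    fix i assume i: "i < L"
    let ?A = "{b\<in>B. lo b = i \<and> hi b = Suc i}"
    have "{b\<in>B. (lo(u L := L - 1, v := L)) b = i \<and> hi b = Suc i}
        = (if i = L - 1 then insert (u L) (?A - {v}) else ?A)"
    proof (rule set_eqI)
      fix b
      have Li: "Suc i = L \<longleftrightarrow> i = L - 1" using L1 by auto
      consider "b = u L" | "b = v" "b \<noteq> u L" | "b \<noteq> u L" "b \<noteq> v" by blast
      then show "b \<in> {b\<in>B. (lo(u L := L - 1, v := L)) b = i \<and> hi b = Suc i}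
          \<longleftrightarrow> b \<in> (if i = L - 1 then insert (u L) (?A - {v}) else ?A)"
      proof cases
        case 1
        then show ?thesis using uL ne i L1 by (simp add: Li)
      next
        case 2
        then show ?thesis using v i L1 by (simp add: Li)
      qed simp
    qed
    moreover have "card (insert (u L) (?A - {v})) = card ?A" if "i = L - 1"
    proof -
      have "v \<in> ?A" "u L \<notin> ?A" "finite ?A" using v uL that L1 finB by auto
      then show ?thesis by (rule card_exchange)
    qed
    ultimately show "card {b\<in>B. (lo(u L := L - 1, v := L)) b = i \<and> hi b = Suc i} = k - 2"
      using card_inner[OF i] by (cases "i = L - 1") simp_all
  next
    show "k \<ge> 2" by (rule k2)
    show "L \<ge> 1" by (rule L1)
    show "finite B" by (rule finB)
    show "finite F" by (rule finF)
    show "card g = k - 1" "g \<inter> B = {}" if "g \<in> F" for g using cardF FB that by auto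
    show "g = h" if "g \<in> F" "h \<in> F" "z \<in> g" "z \<in> h" for g h z using disjF that by blast
    fix j assume j: "j \<le> L"
    show "(u(L := v)) j \<in> B" using j uB v by simp
    show "(lo(u L := L - 1, v := L)) ((u(L := v)) j) = j"
      using j nj[of j] lou[OF j] ne by (cases "j = L") auto
    show "hi ((u(L := v)) j) = j" using j hiu[OF j] v by auto
  qed
qed

lemma swap_end_edges:
  assumes v: "v \<in> B" "lo v = L - 1" "hi v = L"
  shows "spine.edges L B (lo(u L := L - 1, v := L)) hi F f = edges f"
proof -
  interpret r: spine k L B "lo(u L := L - 1, v := L)" hi "u(L := v)" F by (rule swap_end_spine[OF v])
  have uL: "u L \<in> B" "lo (u L) = L" "hi (u L) = L" using uB lou hiu by auto
  have "r.pathE i = pathE i" if i: "i < L" for i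
    unfolding r.pathE_def pathE_def using i uL v L1 by auto
  then show ?thesis unfolding r.edges_def edges_def by simp
qed

text \<open>Lengthening the path: a pendant edge \<open>g\<close> rooted at \<open>u L\<close>
  becomes the new last path edge, \<open>z\<close> its end vertex and the rest of \<open>g\<close>
  its inner vertices. The vertices of \<open>g\<close> join the base, so \<open>extf\<close> makes
  them their own feet.\<close>

definition extB where "extB g = B \<union> g"
definition extlo where "extlo g z = (\<lambda>b. if b = z then Suc L else if b \<in> g then L else lo b)"
definition exthi where "exthi g = (\<lambda>b. if b \<in> g then Suc L else hi b)"
definition extf where "extf f g = (\<lambda>y. if y \<in> g then y else f y)"

lemma extend_spine:
  assumes g: "g \<in> F" and z: "z \<in> g"
  shows "spine k (Suc L) (extB g) (extlo g z) (exthi g) (u(Suc L := z)) (F - {g})"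
proof -
  have gB: "g \<inter> B = {}" by (rule FB[OF g])
  have zB: "z \<notin> B" using z gB by blast
  show ?thesis
  proof
    fix b assume b: "b \<in> extB g"
    show "exthi g b = extlo g z b \<or> exthi g b = Suc (extlo g z b)"
      using b lohi[of b] z by (auto simp: extB_def exthi_def extlo_def)
    show "exthi g b \<le> Suc L" using b hiL[of b] by (auto simp: extB_def exthi_def)
    assume "exthi g b = extlo g z b"
    then show "(u(Suc L := z)) (extlo g z b) = b"
      using b u_uniq[of b] hiL[of b] z by (auto simp: extB_def exthi_def extlo_def split: if_splits)
  next
    fix i assume i: "i < Suc L"
    show "card {b\<in>extB g. extlo g z b = i \<and> exthi g b = Suc i} = k - 2"
    proof (cases "i = L")
      case True
      have "{b\<in>extB g. extlo g z b = i \<and> exthi g b = Suc i} = g - {z}"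
      proof (intro equalityI subsetI)
        fix b assume "b \<in> {b\<in>extB g. extlo g z b = i \<and> exthi g b = Suc i}"
        then show "b \<in> g - {z}"
          using hiL[of b] True by (auto simp: extB_def exthi_def extlo_def split: if_splits)
      qed (use True in \<open>auto simp: extB_def exthi_def extlo_def\<close>)
      then show ?thesis using z cardF[OF g] by simp
    next
      case False
      have "{b\<in>extB g. extlo g z b = i \<and> exthi g b = Suc i} = {b\<in>B. lo b = i \<and> hi b = Suc i}"
        using False i gB z by (auto simp: extB_def exthi_def extlo_def split: if_splits)
      then show ?thesis using card_inner[of i] False i by simp
    qed
  next
    show "k \<ge> 2" by (rule k2)
    show "Suc L \<ge> 1" by simp
    show "finite (extB g)" using finB finite_g[OF g] by (simp add: extB_def)
    show "finite (F - {g})" using finF by simp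
    show "card h = k - 1" if "h \<in> F - {g}" for h using cardF that by auto
    show "h \<inter> extB g = {}" if "h \<in> F - {g}" for h
      using that FB[of h] disjF[of h g] g by (auto simp: extB_def)
    show "h = h'" if "h \<in> F - {g}" "h' \<in> F - {g}" "z \<in> h" "z \<in> h'" for h h' z
      using disjF that by blast
    fix j assume j: "j \<le> Suc L"
    show "(u(Suc L := z)) j \<in> extB g" using j uB[of j] z by (auto simp: extB_def le_Suc_eq)
    have "u j \<notin> g" "u j \<noteq> z" if "j \<le> L" using uB[OF that] gB z by auto
    then show "extlo g z ((u(Suc L := z)) j) = j" "exthi g ((u(Suc L := z)) j) = j"
      using j lou[of j] hiu[of j] z by (auto simp: extlo_def exthi_def le_Suc_eq)
  qed
qed

lemma extend_rest:
  assumes g: "g \<in> F" and z: "z \<in> g" and f: "footed f" and fg: "f ` g = {u L}"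
  shows "spine.V (extB g) (F - {g}) = V" and "spine.footed (extB g) (F - {g}) (extf f g)"
    and "spine.edges (Suc L) (extB g) (extlo g z) (exthi g) (F - {g}) (extf f g) = edges f"
proof -
  interpret r: spine k "Suc L" "extB g" "extlo g z" "exthi g" "u(Suc L := z)" "F - {g}"
    by (rule extend_spine[OF g z])
  have gB: "g \<inter> B = {}" by (rule FB[OF g])
  show "r.V = V" unfolding r.V_def unfolding V_def extB_def using g by auto
  have hg: "extf f g y = f y" if "h \<in> F - {g}" "y \<in> h" for h y
    using that disjF[of h g y] g by (auto simp: extf_def)
  show "r.footed (extf f g)"
    unfolding r.footed_def
  proof (intro conjI ballI)
    show "extf f g b = b" if "b \<in> extB g" for b using that footB[OF f] by (auto simp: extf_def extB_def)
    show "\<exists>w\<in>extB g. \<forall>y\<in>h. extf f g y = w" if h: "h \<in> F - {g}" for h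
    proof -
      have "h \<in> F" using h by simp
      then obtain w where "w \<in> B" "\<forall>y\<in>h. f y = w" using f unfolding footed_def by blast
      then show ?thesis using hg[OF h] by (intro bexI[of _ w]) (auto simp: extB_def)
    qed
  qed
  have p: "r.pathE i = pathE i" if i: "i < L" for i
    unfolding r.pathE_def pathE_def using i gB z
    by (auto simp: extB_def extlo_def exthi_def split: if_splits)
  have pL: "r.pathE L = g \<union> f ` g"
    unfolding r.pathE_def fg
  proof (intro equalityI subsetI)
    fix b assume b: "b \<in> {b \<in> extB g. L \<le> extlo g z b \<and> exthi g b \<le> Suc L}"
    show "b \<in> g \<union> {u L}"
    proof (cases "b \<in> g")
      case False
      then have bB: "b \<in> B" "L \<le> lo b" using b z by (auto simp: extB_def extlo_def split: if_splits)
      then have "lo b = L" "hi b = L" using hiL[OF bB(1)] lohi[OF bB(1)] by auto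
      then show ?thesis using u_uniq[OF bB(1)] by simp
    qed simp
  next
    fix b assume "b \<in> g \<union> {u L}"
    then show "b \<in> {b \<in> extB g. L \<le> extlo g z b \<and> exthi g b \<le> Suc L}"
      using uB[of L] lou[of L] hiu[of L] by (auto simp: extB_def extlo_def exthi_def)
  qed
  have "r.edges (extf f g) = r.pathE ` {..<Suc L} \<union> (\<lambda>h. h \<union> f ` h) ` (F - {g})"
    unfolding r.edges_def by (intro arg_cong2[where f = "(\<union>)"] refl image_cong) (rule hg)
  also have "r.pathE ` {..<Suc L} = insert (g \<union> f ` g) (pathE ` {..<L})"
    using p by (auto simp: lessThan_Suc pL)
  finally show "r.edges (extf f g) = edges f"
    using g by (auto simp: edges_def)
qed

end

text \<open>One hypergraph has many coordinate systems, since the path of a caterpillar is not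
  unique. \<open>V\<close> and \<open>E\<close> are parameters so that they stay fixed while the
  coordinates change.\<close>

definition rep where
  "rep k L V E B lo hi u F f \<longleftrightarrow> spine k L B lo hi u F \<and> spine.footed B F f
     \<and> spine.V B F = V \<and> spine.edges L B lo hi F f = E"

lemma rep_reverse:
  assumes "rep k L V E B lo hi u F f"
  shows "rep k L V E B (\<lambda>b. L - hi b) (\<lambda>b. L - lo b) (\<lambda>j. u (L - j)) F f"
proof -
  interpret spine k L B lo hi u F using assms by (simp add: rep_def)
  show ?thesis using assms reverse_spine reverse_edges[of f] by (simp add: rep_def)
qed

lemma rep_swap_end:
  assumes "rep k L V E B lo hi u F f" "v \<in> B" "lo v = L - 1" "hi v = L"
  shows "rep k L V E B (lo(u L := L - 1, v := L)) hi (u(L := v)) F f"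
proof -
  interpret spine k L B lo hi u F using assms by (simp add: rep_def)
  show ?thesis
    using assms swap_end_spine[OF assms(2-4)] swap_end_edges[OF assms(2-4), of f]
    by (simp add: rep_def)
qed

lemma rep_extend:
  assumes r: "rep k L V E B lo hi u F f" and t: "spine.tcount F f (u L) \<noteq> 0"
  shows "\<exists>B lo hi u F f. rep k (Suc L) V E B lo hi u F f"
proof -
  interpret spine k L B lo hi u F using r by (simp add: rep_def)
  have f: "footed f" using r by (simp add: rep_def)
  obtain g where g: "g \<in> F" "f ` g = {u L}" using tcount_ne[OF t] by blast
  obtain z where z: "z \<in> g" using g_ne[OF g(1)] by blast
  have "rep k (Suc L) V E (extB g) (extlo g z) (exthi g) (u(Suc L := z)) (F - {g}) (extf f g)"
    using r extend_spine[OF g(1) z] extend_rest[OF g(1) z f g(2)] by (simp add: rep_def)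
  then show ?thesis by blast
qed

section \<open>A maximizer described along a longest path\<close>

context spine
begin

text \<open>Coordinate-free form of \<open>eig\<close>: the right-hand side mentions only the
  hypergraph, so a Perron vector can be carried over to reversed coordinates.\<close>

lemma eig_alt:
  assumes f: "footed f"
  shows "eig f x \<longleftrightarrow> (\<forall>v\<in>V. x v > 0) \<and> (\<forall>v\<in>V. (\<Sum>w\<in>V. real (hdist (edges f) v w) * x w)
    = dist_spectral_radius V (edges f) * x v)"
  unfolding eig_def rho_def by (simp add: hdist_edges[OF f] cong: sum.cong)

end

text \<open>\<open>no_longer\<close> makes both ends bare in every coordinate system of length
  \<open>L\<close>, as a pendant edge there would extend the path. \<open>max\<close> compares
  \<open>E\<close> with all hypergraphs in the same class on \<open>V\<close>, so it does not depend
  on the coordinates chosen for \<open>E\<close>.\<close>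

locale extremal =
  fixes k m \<Delta> n L :: nat and V :: "'a set" and E :: "'a set set"
  assumes \<Delta>3: "\<Delta> \<ge> 3" and cardE: "card E = m"
    and deg: "\<And>v. v \<in> V \<Longrightarrow> degree E v \<le> \<Delta>" "card {v\<in>V. degree E v = \<Delta>} = n"
    and no_longer: "\<not> (\<exists>B lo hi u F f. rep k (Suc L) V E B lo hi u F f)"
    and max: "\<And>L B lo hi u F f E'. rep k L V E' B lo hi u F f \<Longrightarrow> card E' = m
      \<Longrightarrow> \<forall>v\<in>V. degree E' v \<le> \<Delta> \<Longrightarrow> card {v\<in>V. degree E' v = \<Delta>} = n
      \<Longrightarrow> dist_spectral_radius V E' \<le> dist_spectral_radius V E"
begin

lemma end_bare:
  assumes "rep k L V E B lo hi u F f" shows "spine.tcount F f (u L) = 0" "spine.tcount F f (u 0) = 0"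
proof -
  show "spine.tcount F f (u L) = 0" using rep_extend[OF assms] no_longer by blast
  show "spine.tcount F f (u 0) = 0" using rep_extend[OF rep_reverse[OF assms]] no_longer by auto
qed

lemma rep_best:
  assumes r: "rep k L V E B lo hi u F f" shows "spine.best L B lo hi F \<Delta> n f"
proof -
  interpret s: spine k L B lo hi u F using r by (simp add: rep_def)
  have f: "s.footed f" and V: "s.V = V" and E: "s.edges f = E" using r by (auto simp: rep_def)
  show ?thesis
    unfolding s.best_def
  proof (intro conjI allI impI f)
    show "s.deg_ok \<Delta> n f" unfolding s.deg_ok_def V E using deg by blast
    fix f' assume f': "s.footed f' \<and> s.deg_ok \<Delta> n f'"
    have "rep k L V (s.edges f') B lo hi u F f'"
      using f' V s.spine_axioms by (simp add: rep_def)
    moreover have "card (s.edges f') = m"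
      using s.card_edges[of f'] s.card_edges[OF f] f' cardE E by simp
    ultimately show "s.rho f' \<le> s.rho f"
      unfolding s.rho_def E V using f' max[of L "s.edges f'"] unfolding s.deg_ok_def V by blast
  qed
qed

lemma rep_inner_one_side:
  assumes r: "rep k L V E B lo hi u F f" and v: "v \<in> B" "lo v = i" "hi v = Suc i" and i: "Suc i < L"
    and x: "spine.eig L B lo hi F f x"
    and heavy: "sum x {t\<in>V. Suc i \<le> lo (f t)} \<le> sum x {t\<in>V. hi (f t) \<le> i}"
  shows "spine.tcount F f v = 0"
proof -
  interpret s: spine k L B lo hi u F using r by (simp add: rep_def)
  have V: "s.V = V" using r by (simp add: rep_def)
  show ?thesis
    by (rule s.best_inner[OF rep_best[OF r] end_bare(1)[OF r] v i x])
      (use heavy V in simp)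
qed

text \<open>If \<open>v\<close> lies in the last or the first path edge, it can be renamed to be an
  end of the path, and ends are bare. For the other edges one of the two sides weighs at most as
  much as the other, and reversal makes it the right one, as \<open>inner_move\<close>
  requires.\<close>

lemma rep_inner:
  assumes r: "rep k L V E B lo hi u F f" and v: "v \<in> B" "hi v = Suc (lo v)"
  shows "spine.tcount F f v = 0"
proof -
  interpret s: spine k L B lo hi u F using r by (simp add: rep_def)
  have f: "s.footed f" and V: "s.V = V" and E: "s.edges f = E" using r by (auto simp: rep_def)
  let ?i = "lo v"
  have r': "rep k L V E B (\<lambda>b. L - hi b) (\<lambda>b. L - lo b) (\<lambda>j. u (L - j)) F f"
    by (rule rep_reverse[OF r])
  interpret r: spine k L B "\<lambda>b. L - hi b" "\<lambda>b. L - lo b" "\<lambda>j. u (L - j)" F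
    by (rule s.reverse_spine)
  have iL: "Suc ?i \<le> L" using s.hiL[OF v(1)] v(2) by simp
  consider "Suc ?i = L" | "?i = 0" | "Suc ?i < L" "0 < ?i" using iL by linarith
  then show ?thesis
  proof cases
    case 1
    have "rep k L V E B (lo(u L := L - 1, v := L)) hi (u(L := v)) F f"
      by (rule rep_swap_end[OF r v(1)]) (use 1 v in auto)
    from end_bare(1)[OF this] show ?thesis by simp
  next
    case 2
    have "rep k L V E B ((\<lambda>b. L - hi b)(u (L - L) := L - 1, v := L)) (\<lambda>b. L - lo b)
        ((\<lambda>j. u (L - j))(L := v)) F f"
      by (rule rep_swap_end[OF r' v(1)]) (use 2 v in auto)
    from end_bare(1)[OF this] show ?thesis by simp
  next
    case 3
    obtain x where x: "s.eig f x" using s.eig_ex[OF f] by blast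
    show ?thesis
    proof (cases "sum x {t\<in>V. Suc ?i \<le> lo (f t)} \<le> sum x {t\<in>V. hi (f t) \<le> ?i}")
      case True
      then show ?thesis by (rule rep_inner_one_side[OF r v(1) refl v(2) 3(1) x])
    next
      case False
      have E': "r.edges f = E" and f': "r.footed f" using r' by (auto simp: rep_def)
      have x': "r.eig f x" using x unfolding s.eig_alt[OF f] r.eig_alt[OF f'] E E' .
      have b: "lo (f t) \<le> hi (f t)" "hi (f t) \<le> L" if "t \<in> V" for t
        using s.lohi_foot[OF f] s.hiL[OF s.foot_in[OF f]] that V by force+
      have i': "Suc (L - Suc ?i) = L - ?i" using iL by simp
      \<comment> \<open>Reversal takes edge \<open>?i\<close> to edge \<open>L - Suc ?i\<close> and
        exchanges the two weight classes, so the failed inequality becomes the required one.\<close>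
      have "sum x {t\<in>V. Suc (L - Suc ?i) \<le> L - hi (f t)} \<le> sum x {t\<in>V. L - lo (f t) \<le> L - Suc ?i}"
      proof -
        have "{t\<in>V. Suc (L - Suc ?i) \<le> L - hi (f t)} = {t\<in>V. hi (f t) \<le> ?i}"
          using b iL unfolding i' by (intro Collect_cong conj_cong refl) (use b iL in fastforce)
        moreover have "{t\<in>V. L - lo (f t) \<le> L - Suc ?i} = {t\<in>V. Suc ?i \<le> lo (f t)}"
          by (intro Collect_cong conj_cong refl) (use b iL in fastforce)
        ultimately show ?thesis using False by simp
      qed
      then show ?thesis
        by (intro rep_inner_one_side[where i = "L - Suc ?i", OF r' v(1) _ _ _ x']) (use v 3 i' in auto)
    qed
  qed
qed

lemma rep_spiny:
  assumes r: "rep k L V E B lo hi u F f" shows "spine.spiny B lo hi F f"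
proof -
  interpret s: spine k L B lo hi u F using r by (simp add: rep_def)
  have f: "s.footed f" using r by (simp add: rep_def)
  have "hi (f t) = lo (f t)" if t: "t \<in> s.V - B" for t
  proof (rule ccontr)
    have B: "f t \<in> B" using s.foot_in[OF f] t by simp
    assume "hi (f t) \<noteq> lo (f t)"
    then have "hi (f t) = Suc (lo (f t))" using s.lohi[OF B] by simp
    then have "s.bare f (f t)" using rep_inner[OF r B] s.tcount_0_iff[OF f B] by simp
    then show False using t B by (auto simp: s.bare_def)
  qed
  then show ?thesis by (simp add: s.spiny_def)
qed

lemma shape_reverse:
  assumes r: "rep k L V E B lo hi u F f" and sh: "spine.shape L B lo hi u F \<Delta> a b f"
  shows "spine.shape L B (\<lambda>b. L - hi b) (\<lambda>b. L - lo b) (\<lambda>j. u (L - j)) F \<Delta> b a f"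
proof -
  interpret s: spine k L B lo hi u F using r by (simp add: rep_def)
  interpret r: spine k L B "\<lambda>b. L - hi b" "\<lambda>b. L - lo b" "\<lambda>j. u (L - j)" F
    by (rule s.reverse_spine)
  have f: "s.footed f" and ab: "a + b < L" using sh by (auto simp: s.shape_def)
  have tc: "s.tcount f (u j) = (if 1 \<le> j \<and> j \<le> a \<or> L - b \<le> j \<and> j \<le> L - 1 then \<Delta> - 2 else 0)"
    if "j \<le> L" for j using sh that by (simp add: s.shape_def)
  show ?thesis
    unfolding r.shape_def
  proof (intro conjI allI impI)
    show "r.footed f" by (rule f)
    show "r.spiny f" using rep_spiny[OF rep_reverse[OF r]] .
    show "b + a < L" using ab by simp
    fix j assume j: "j \<le> L"
    have "(1 \<le> L - j \<and> L - j \<le> a \<or> L - b \<le> L - j \<and> L - j \<le> L - 1)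
        \<longleftrightarrow> (1 \<le> j \<and> j \<le> b \<or> L - a \<le> j \<and> j \<le> L - 1)"
      using j ab by linarith
    then show "r.tcount f (u (L - j)) = (if 1 \<le> j \<and> j \<le> b \<or> L - a \<le> j \<and> j \<le> L - 1 then \<Delta> - 2 else 0)"
      using tc[of "L - j"] by simp
  qed
qed

text \<open>Balancing is used in both directions, so the segment sizes differ by at most 1; without
  a bare inner position \<open>best_shape\<close> already chose a balanced split. For odd
  \<open>n\<close> reversal puts the larger segment on the right, as in \<open>C\<close>. The length
  comes from counting edges: \<open>m = L + n * (\<Delta> - 2)\<close>.\<close>

lemma extremal_shape:
  assumes r: "rep k L V E B lo hi u F f"
  shows "\<exists>lo hi u. rep k L V E B lo hi u F f
      \<and> spine.shape L B lo hi u F \<Delta> (n div 2) ((n + 1) div 2) f \<and> L = m - n * (\<Delta> - 2)"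
proof -
  interpret s: spine k L B lo hi u F using r by (simp add: rep_def)
  have f: "s.footed f" and V: "s.V = V" and E: "s.edges f = E" using r by (auto simp: rep_def)
  have r': "rep k L V E B (\<lambda>b. L - hi b) (\<lambda>b. L - lo b) (\<lambda>j. u (L - j)) F f"
    by (rule rep_reverse[OF r])
  interpret r: spine k L B "\<lambda>b. L - hi b" "\<lambda>b. L - lo b" "\<lambda>j. u (L - j)" F
    by (rule s.reverse_spine)
  obtain a b where sh: "s.shape \<Delta> a b f" and ab: "a = (a + b) div 2 \<or> a + b + 1 < L"
    using s.best_shape[OF rep_best[OF r] \<Delta>3 rep_spiny[OF r]] end_bare[OF r] by blast
  have n: "n = a + b" using s.shape_count(2)[OF sh \<Delta>3] deg(2) E V by simp
  have "L = m - n * (\<Delta> - 2)"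
    using s.card_edges[OF f] s.shape_count(1)[OF sh \<Delta>3] cardE E n by simp
  moreover consider "a = n div 2" "b = (n + 1) div 2" | "a = (n + 1) div 2" "b = n div 2"
  proof (cases "a = (a + b) div 2")
    case True
    then show ?thesis using n that(1) by linarith
  next
    case False
    then have L: "a + b + 1 < L" using ab by simp
    have "a \<le> b + 1" by (rule s.best_balanced[OF rep_best[OF r] sh \<Delta>3 L])
    moreover have "b \<le> a + 1"
      by (rule r.best_balanced[OF rep_best[OF r'] shape_reverse[OF r sh] \<Delta>3]) (use L in simp)
    ultimately show ?thesis using n that by linarith
  qed
  then have "\<exists>lo hi u. rep k L V E B lo hi u F f
      \<and> spine.shape L B lo hi u F \<Delta> (n div 2) ((n + 1) div 2) f"
  proof cases
    case 1
    then show ?thesis using r sh by blast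
  next
    case 2
    then show ?thesis using r' shape_reverse[OF r sh] by blast
  qed
  ultimately show ?thesis by blast
qed

end

section \<open>Comparison with the hypergraph \<open>C\<close>\<close>

text \<open>Bijections between the fibres over equal keys are glued together. The isomorphism with
  \<open>C\<close> is assembled from such matchings.\<close>

lemma key_bij:
  assumes fin: "finite A" "finite A'"
    and card: "\<And>c. card {a\<in>A. \<kappa> a = c} = card {b\<in>A'. \<kappa>' b = c}"
  shows "\<exists>h. bij_betw h A A' \<and> (\<forall>a\<in>A. \<kappa>' (h a) = \<kappa> a)"
proof -
  have "\<exists>h. bij_betw h {a\<in>A. \<kappa> a = c} {b\<in>A'. \<kappa>' b = c}" for c
    using card fin by (intro finite_same_card_bij) auto
  then obtain H where H: "\<And>c. bij_betw (H c) {a\<in>A. \<kappa> a = c} {b\<in>A'. \<kappa>' b = c}" by metis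
  define h where "h a = H (\<kappa> a) a" for a
  have h: "h a \<in> A'" "\<kappa>' (h a) = \<kappa> a" if "a \<in> A" for a
    using bij_betwE[OF H[of "\<kappa> a"]] that by (auto simp: h_def)
  have "inj_on h A"
  proof (rule inj_onI)
    fix a b assume ab: "a \<in> A" "b \<in> A" "h a = h b"
    then have "\<kappa> a = \<kappa> b" using h by metis
    then show "a = b"
      using ab bij_betw_imp_inj_on[OF H[of "\<kappa> a"]] by (auto simp: h_def inj_on_def)
  qed
  moreover have "A' \<subseteq> h ` A"
  proof
    fix b assume b: "b \<in> A'"
    then obtain a where "a \<in> A" "\<kappa> a = \<kappa>' b" "H (\<kappa>' b) a = b"
      using bij_betw_imp_surj_on[OF H[of "\<kappa>' b"]] by (force simp: image_iff set_eq_iff)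
    then have "h a = b" by (simp add: h_def)
    then show "b \<in> h ` A" using \<open>a \<in> A\<close> by blast
  qed
  ultimately show ?thesis using h by (intro exI[of _ h]) (auto simp: bij_betw_def)
qed

context spine
begin

lemma card_key:
  "card {b\<in>B. (lo b, hi b) = c} = (if fst c = snd c \<and> fst c \<le> L then 1
     else if snd c = Suc (fst c) \<and> fst c < L then k - 2 else 0)"
proof -
  obtain p q where c: "c = (p, q)" by fastforce
  consider "p = q" "p \<le> L" | "q = Suc p" "p < L" | "\<not> (p = q \<and> p \<le> L)" "\<not> (q = Suc p \<and> p < L)"
    by blast
  then show ?thesis
  proof cases
    case 1
    then have "{b\<in>B. (lo b, hi b) = c} = {u p}"
      using c uB lou hiu u_uniq by fastforce
    then show ?thesis using 1 c by simp
  next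
    case 2
    then show ?thesis using card_inner[of p] c by simp
  next
    case 3
    have e: "{b\<in>B. (lo b, hi b) = c} = {}"
      using 3 c lohi hiL by fastforce
    show ?thesis unfolding e using 3 c by auto
  qed
qed

definition pos where "pos f g = lo (f (SOME z. z \<in> g))"

lemma pos_foot: "footed f \<Longrightarrow> g \<in> F \<Longrightarrow> z \<in> g \<Longrightarrow> lo (f z) = pos f g"
  unfolding pos_def by (metis same_foot same_def someI)

lemma shape_foot:
  assumes sh: "shape \<Delta> a b f" and g: "g \<in> F"
  shows "f ` g = {u (pos f g)}" "pos f g \<le> L"
proof -
  have f: "footed f" and s: "spiny f" using sh by (auto simp: shape_def)
  obtain z where z: "z \<in> g" using g_ne[OF g] by blast
  have zV: "z \<in> V" "z \<notin> B" using z g FB by (auto simp: V_def)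
  have fz: "f z \<in> B" "hi (f z) = lo (f z)" using foot_in[OF f zV(1)] s zV by (auto simp: spiny_def)
  show "f ` g = {u (pos f g)}" "pos f g \<le> L"
    using foot_image[OF f g z] u_uniq[OF fz] pos_foot[OF f g z] hiL[OF fz(1)] fz(2) by auto
qed

lemma shape_pos_card:
  assumes sh: "shape \<Delta> a b f"
  shows "card {g\<in>F. pos f g = j}
    = (if 1 \<le> j \<and> j \<le> a \<or> L - b \<le> j \<and> j \<le> L - 1 then \<Delta> - 2 else 0)"
proof (cases "j \<le> L")
  case True
  have "{g\<in>F. pos f g = j} = {g\<in>F. f ` g = {u j}}"
    using shape_foot[OF sh] lou True by (metis (no_types, lifting) singleton_inject)
  then show ?thesis using sh True by (simp add: shape_def tcount_def)
next
  case False
  then have e: "{g\<in>F. pos f g = j} = {}" using shape_foot(2)[OF sh] by auto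
  have "a + b < L" using sh by (simp add: shape_def)
  then show ?thesis unfolding e using False by auto
qed

end

text \<open>Three matchings by \<open>key_bij\<close>: base vertices by their coordinates, pendant
  edges by the position of their roots, and the remaining vertices by the pendant edge that contains
  them. The first count depends on \<open>k\<close> and \<open>L\<close> only, the second on the
  shape, and each pendant edge has \<open>k - 1\<close> vertices off its root.\<close>

lemma shape_iso:
  assumes r1: "rep k L V1 E1 B1 lo1 hi1 u1 F1 f1" and sh1: "spine.shape L B1 lo1 hi1 u1 F1 \<Delta> a b f1"
    and r2: "rep k L V2 E2 B2 lo2 hi2 u2 F2 f2" and sh2: "spine.shape L B2 lo2 hi2 u2 F2 \<Delta> a b f2"
  shows "hg_iso V1 E1 V2 E2"
proof -
  interpret s: spine k L B1 lo1 hi1 u1 F1 using r1 by (simp add: rep_def)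
  interpret t: spine k L B2 lo2 hi2 u2 F2 using r2 by (simp add: rep_def)
  have f1: "s.footed f1" and f2: "t.footed f2" using r1 r2 by (auto simp: rep_def)
  have "card {b\<in>B1. (lo1 b, hi1 b) = c} = card {b\<in>B2. (lo2 b, hi2 b) = c}" for c
    by (simp only: s.card_key t.card_key)
  from key_bij[OF s.finB t.finB this]
  obtain hB where hB: "bij_betw hB B1 B2" "\<forall>b\<in>B1. (lo2 (hB b), hi2 (hB b)) = (lo1 b, hi1 b)" by blast
  have "card {g\<in>F1. s.pos f1 g = c} = card {g\<in>F2. t.pos f2 g = c}" for c
    by (simp only: s.shape_pos_card[OF sh1] t.shape_pos_card[OF sh2])
  from key_bij[OF s.finF t.finF this]
  obtain hF where hF: "bij_betw hF F1 F2" "\<forall>g\<in>F1. t.pos f2 (hF g) = s.pos f1 g" by blast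
  have hF2: "hF g \<in> F2" if "g \<in> F1" for g using hF(1) that by (auto dest: bij_betwE)
  define grp1 where "grp1 y = (THE g. g \<in> F1 \<and> y \<in> g)" for y
  define grp2 where "grp2 y = (THE g. g \<in> F2 \<and> y \<in> g)" for y
  have grp1: "grp1 y = g" if "g \<in> F1" "y \<in> g" for g y
    unfolding grp1_def using that s.disjF by (intro the_equality) blast+
  have grp2: "grp2 y = g" if "g \<in> F2" "y \<in> g" for g y
    unfolding grp2_def using that t.disjF by (intro the_equality) blast+
  have "card {y\<in>\<Union>F1. hF (grp1 y) = c} = card {y\<in>\<Union>F2. grp2 y = c}" for c
  proof (cases "c \<in> F2")
    case True
    then obtain g where g: "g \<in> F1" "hF g = c" using bij_betw_imp_surj_on[OF hF(1)] by blast
    have "{y\<in>\<Union>F1. hF (grp1 y) = c} = g"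
    proof (intro equalityI subsetI)
      fix y assume y: "y \<in> {y\<in>\<Union>F1. hF (grp1 y) = c}"
      then obtain h where h: "h \<in> F1" "y \<in> h" by blast
      then have "hF h = hF g" using y grp1 g by simp
      then have "h = g" using bij_betw_imp_inj_on[OF hF(1)] h g by (auto dest: inj_onD)
      then show "y \<in> g" using h by simp
    qed (use g grp1 in auto)
    moreover have "{y\<in>\<Union>F2. grp2 y = c} = c" using grp2 True by auto
    ultimately show ?thesis using s.cardF[OF g(1)] t.cardF[OF True] by simp
  next
    case False
    then have e: "{y\<in>\<Union>F1. hF (grp1 y) = c} = {}" "{y\<in>\<Union>F2. grp2 y = c} = {}"
      using grp1 grp2 hF2 by auto
    show ?thesis unfolding e by simp
  qed
  moreover have "finite (\<Union>F1)" "finite (\<Union>F2)"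
    using s.finF s.finite_g t.finF t.finite_g by auto
  ultimately obtain hP where hP: "bij_betw hP (\<Union>F1) (\<Union>F2)" "\<forall>y\<in>\<Union>F1. grp2 (hP y) = hF (grp1 y)"
    using key_bij[of "\<Union>F1" "\<Union>F2" "\<lambda>y. hF (grp1 y)" grp2] by blast
  define h where "h y = (if y \<in> B1 then hB y else hP y)" for y
  have notB: "y \<notin> B1" if "y \<in> \<Union>F1" for y using that s.FB by blast
  have bij: "bij_betw h V1 V2"
  proof -
    have "bij_betw h B1 B2" using hB(1) by (rule bij_betw_cong[THEN iffD1, rotated]) (simp add: h_def)
    moreover have "bij_betw h (\<Union>F1) (\<Union>F2)"
      using hP(1) by (rule bij_betw_cong[THEN iffD1, rotated]) (use notB in \<open>simp add: h_def\<close>)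
    moreover have "B2 \<inter> \<Union>F2 = {}" using t.FB by blast
    ultimately have "bij_betw h (B1 \<union> \<Union>F1) (B2 \<union> \<Union>F2)" by (rule bij_betw_combine)
    then show ?thesis using r1 r2 by (simp add: rep_def s.V_def t.V_def)
  qed
  have hpath: "h ` s.pathE i = t.pathE i" for i
  proof -
    have "h ` s.pathE i = hB ` s.pathE i" using s.pathE_B[of i] by (intro image_cong) (auto simp: h_def)
    also have "\<dots> = t.pathE i"
      using hB bij_betw_imp_surj_on[OF hB(1)] unfolding s.pathE_def t.pathE_def by force
    finally show ?thesis .
  qed
  have hg: "h ` g = hF g" if g: "g \<in> F1" for g
  proof (rule card_subset_eq)
    show "finite (hF g)" by (rule t.finite_g[OF hF2[OF g]])
    show "h ` g \<subseteq> hF g"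
    proof
      fix z assume "z \<in> h ` g"
      then obtain y where y: "y \<in> g" "z = h y" by blast
      have "z = hP y" using y notB[of y] g by (auto simp: h_def)
      then have "z \<in> \<Union>F2" "grp2 z = hF g" using hP y g grp1 by (auto dest: bij_betwE)
      then show "z \<in> hF g" using grp2 by auto
    qed
    have "g \<subseteq> V1" using g r1 by (auto simp: rep_def s.V_def)
    then have "inj_on h g" using bij by (auto simp: bij_betw_def intro: inj_on_subset)
    then show "card (h ` g) = card (hF g)"
      using s.cardF[OF g] t.cardF[OF hF2[OF g]] by (simp add: card_image)
  qed
  have hu: "h (u1 j) = u2 j" if "j \<le> L" for j
  proof -
    have B: "u1 j \<in> B1" using s.uB that by simp
    then have "hB (u1 j) \<in> B2" using hB(1) by (auto dest: bij_betwE)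
    moreover have "lo2 (hB (u1 j)) = j" "hi2 (hB (u1 j)) = j"
      using hB(2) B s.lou[OF that] s.hiu[OF that] by auto
    ultimately show ?thesis using t.u_uniq[of "hB (u1 j)"] B by (simp add: h_def)
  qed
  have hgf: "h ` (g \<union> f1 ` g) = hF g \<union> f2 ` hF g" if g: "g \<in> F1" for g
    using s.shape_foot[OF sh1 g] t.shape_foot[OF sh2 hF2[OF g]] hF(2) g hg[OF g] hu
    by (simp add: image_Un)
  have "(`) h ` E1 = (`) h ` (s.pathE ` {..<L}) \<union> (`) h ` ((\<lambda>g. g \<union> f1 ` g) ` F1)"
    using r1 by (auto simp: rep_def s.edges_def)
  also have "(`) h ` (s.pathE ` {..<L}) = t.pathE ` {..<L}"
    by (simp add: image_image hpath)
  also have "(`) h ` ((\<lambda>g. g \<union> f1 ` g) ` F1) = (\<lambda>g. g \<union> f2 ` g) ` (hF ` F1)"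
    unfolding image_image by (intro image_cong refl hgf)
  also have "hF ` F1 = F2" by (rule bij_betw_imp_surj_on[OF hF(1)])
  finally have "(`) h ` E1 = E2" using r2 by (simp add: rep_def t.edges_def)
  then show ?thesis using bij by (auto simp: hg_iso_def)
qed

section \<open>Coordinates for the hypergraph \<open>C\<close>\<close>

definition C_base :: "nat \<Rightarrow> nat \<Rightarrow> (nat \<times> nat \<times> nat) set" where
  "C_base k L = (\<lambda>i. (0, i, 0)) ` {..L} \<union> (\<lambda>(i, j). (1, i, j)) ` ({1..L} \<times> {1..k - 2})"
text \<open>\<open>C\<close> numbers its path edges from 1, a spine numbers them from 0: an inner
  vertex \<open>(1, i, j)\<close> lies on spine edge \<open>i - 1\<close>. The first component
  separates base vertices, with 0 or 1, from star vertices, where it is at least 2 because stars are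
  counted from 1.\<close>

definition C_lo :: "nat \<times> nat \<times> nat \<Rightarrow> nat" where
  "C_lo = (\<lambda>(t, i, j). if t = 0 then i else i - 1)"
definition C_hi :: "nat \<times> nat \<times> nat \<Rightarrow> nat" where "C_hi = (\<lambda>(t, i, j). i)"
definition C_u :: "nat \<Rightarrow> nat \<times> nat \<times> nat" where "C_u j = (0, j, 0)"
definition C_leaves :: "nat \<Rightarrow> nat \<Rightarrow> nat \<Rightarrow> (nat \<times> nat \<times> nat) set" where
  "C_leaves k i t = (\<lambda>j. (t + 1, i, j)) ` {1..k - 1}"
definition C_stars :: "nat \<Rightarrow> nat \<Rightarrow> nat \<Rightarrow> nat set" where
  "C_stars L a b = {i. 1 \<le> i \<and> i \<le> a \<or> L - b \<le> i \<and> i \<le> L - 1}"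
definition C_pend :: "nat \<Rightarrow> nat \<Rightarrow> nat \<Rightarrow> nat \<Rightarrow> nat \<Rightarrow> (nat \<times> nat \<times> nat) set set" where
  "C_pend k L \<Delta> a b = (\<lambda>(i, t). C_leaves k i t) ` (C_stars L a b \<times> {1..\<Delta> - 2})"
definition C_foot :: "nat \<times> nat \<times> nat \<Rightarrow> nat \<times> nat \<times> nat" where
  "C_foot = (\<lambda>(t, i, j). if t \<le> 1 then (t, i, j) else (0, i, 0))"

lemma C_spine:
  assumes k: "k \<ge> 2" and L: "L \<ge> 1"
  shows "spine k L (C_base k L) C_lo C_hi C_u (C_pend k L \<Delta> a b)"
proof
  show "k \<ge> 2" "L \<ge> 1" by (rule k, rule L)
  show "finite (C_base k L)" by (simp add: C_base_def)
  have "C_stars L a b \<subseteq> {..a + L}" by (auto simp: C_stars_def)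
  then have "finite (C_stars L a b)" by (rule finite_subset) simp
  then show "finite (C_pend k L \<Delta> a b)" by (simp add: C_pend_def)
  show "C_hi b = C_lo b \<or> C_hi b = Suc (C_lo b)" if "b \<in> C_base k L" for b
    using that by (auto simp: C_base_def C_hi_def C_lo_def)
  show "C_hi b \<le> L" if "b \<in> C_base k L" for b using that by (auto simp: C_base_def C_hi_def)
  show "C_u j \<in> C_base k L" if "j \<le> L" for j using that by (auto simp: C_base_def C_u_def)
  show "C_lo (C_u j) = j" "C_hi (C_u j) = j" for j by (auto simp: C_lo_def C_hi_def C_u_def)
  show "C_u (C_lo b) = b" if "b \<in> C_base k L" "C_hi b = C_lo b" for b
    using that by (auto simp: C_base_def C_hi_def C_lo_def C_u_def)
  show "card {b\<in>C_base k L. C_lo b = i \<and> C_hi b = Suc i} = k - 2" if i: "i < L" for i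
  proof -
    have "{b\<in>C_base k L. C_lo b = i \<and> C_hi b = Suc i} = (\<lambda>j. (1, Suc i, j)) ` {1..k - 2}"
      using i by (auto simp: C_base_def C_hi_def C_lo_def image_iff)
    then show ?thesis by (simp add: card_image inj_on_def)
  qed
  show "card g = k - 1" if "g \<in> C_pend k L \<Delta> a b" for g
    using that by (auto simp: C_pend_def C_leaves_def card_image inj_on_def)
  show "g \<inter> C_base k L = {}" if "g \<in> C_pend k L \<Delta> a b" for g
    using that by (auto simp: C_pend_def C_leaves_def C_base_def)
  show "g = h" if "g \<in> C_pend k L \<Delta> a b" "h \<in> C_pend k L \<Delta> a b" "z \<in> g" "z \<in> h" for g h z
    using that by (auto simp: C_pend_def C_leaves_def)
qed

lemma C_foot_leaves: "k \<ge> 2 \<Longrightarrow> t \<ge> 1 \<Longrightarrow> C_foot ` C_leaves k i t = {C_u i}"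
  by (force simp: C_foot_def C_leaves_def C_u_def image_iff)

lemma C_rep:
  assumes k: "k \<ge> 2" and ab: "a + b < L"
  shows "rep k L (C_verts k L \<Delta> a b) (C_edges k L \<Delta> a b) (C_base k L) C_lo C_hi C_u (C_pend k L \<Delta> a b) C_foot"
    and "spine.shape L (C_base k L) C_lo C_hi C_u (C_pend k L \<Delta> a b) \<Delta> a b C_foot"
proof -
  have L: "L \<ge> 1" using ab by simp
  interpret s: spine k L "C_base k L" C_lo C_hi C_u "C_pend k L \<Delta> a b" by (rule C_spine[OF k L])
  have stars: "i \<le> L" if "i \<in> C_stars L a b" for i using that ab by (auto simp: C_stars_def)
  have uB: "C_u i \<in> C_base k L" if "i \<le> L" for i by (rule s.uB[OF that])
  have f: "s.footed C_foot"
    unfolding s.footed_def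
  proof (intro conjI ballI)
    show "C_foot b = b" if "b \<in> C_base k L" for b using that by (auto simp: C_base_def C_foot_def)
    show "\<exists>w\<in>C_base k L. \<forall>z\<in>g. C_foot z = w" if g: "g \<in> C_pend k L \<Delta> a b" for g
    proof -
      obtain i t where it: "g = C_leaves k i t" "i \<in> C_stars L a b" "t \<ge> 1"
        using g by (auto simp: C_pend_def)
      then have "C_foot ` g = {C_u i}" using C_foot_leaves k by simp
      then show ?thesis using uB[OF stars[OF it(2)]] by blast
    qed
  qed
  have path: "s.pathE i = C_path_edge k (Suc i)" if i: "i < L" for i
  proof (intro equalityI subsetI)
    fix b assume "b \<in> s.pathE i"
    then have "b \<in> C_base k L" "i \<le> C_lo b" "C_hi b \<le> Suc i" by (auto simp: s.pathE_def)
    then show "b \<in> C_path_edge k (Suc i)"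
      by (auto simp: C_base_def C_path_edge_def C_lo_def C_hi_def le_Suc_eq)
  next
    fix b assume "b \<in> C_path_edge k (Suc i)"
    then show "b \<in> s.pathE i"
      unfolding s.pathE_def
      using i by (auto simp: C_base_def C_path_edge_def C_lo_def C_hi_def image_iff)
  qed
  have star: "C_leaves k i t \<union> C_foot ` C_leaves k i t = C_star_edge k i t" if "t \<ge> 1" for i t
    unfolding C_foot_leaves[OF k that] by (auto simp: C_star_edge_def C_leaves_def C_u_def)
  have "s.edges C_foot = C_edges k L \<Delta> a b"
  proof -
    have "{C_path_edge k i | i. 1 \<le> i \<and> i \<le> L} = (\<lambda>i. C_path_edge k (Suc i)) ` {..<L}"
    proof (intro equalityI subsetI)
      fix e assume "e \<in> {C_path_edge k i | i. 1 \<le> i \<and> i \<le> L}"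
      then obtain i where "e = C_path_edge k i" "1 \<le> i" "i \<le> L" by blast
      then show "e \<in> (\<lambda>i. C_path_edge k (Suc i)) ` {..<L}" by (intro image_eqI[of _ _ "i - 1"]) auto
    qed (auto intro: Suc_leI)
    also have "\<dots> = s.pathE ` {..<L}" by (intro image_cong) (auto simp: path)
    finally have 1: "{C_path_edge k i | i. 1 \<le> i \<and> i \<le> L} = s.pathE ` {..<L}" .
    have "(\<lambda>g. g \<union> C_foot ` g) ` C_pend k L \<Delta> a b
        = (\<lambda>(i, t). C_star_edge k i t) ` (C_stars L a b \<times> {1..\<Delta> - 2})"
      unfolding C_pend_def image_image
    proof (rule image_cong[OF refl])
      fix p assume "p \<in> C_stars L a b \<times> {1..\<Delta> - 2}"
      then obtain i t where "p = (i, t)" "t \<ge> 1" by auto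
      then show "(case p of (i, t) \<Rightarrow> C_leaves k i t) \<union> C_foot ` (case p of (i, t) \<Rightarrow> C_leaves k i t)
          = (case p of (i, t) \<Rightarrow> C_star_edge k i t)"
        using star by simp
    qed
    also have "\<dots> = {C_star_edge k i t | i t. i \<in> C_stars L a b \<and> 1 \<le> t \<and> t \<le> \<Delta> - 2}"
      by fastforce
    also have "\<dots> = {C_star_edge k i t | i t. ((1 \<le> i \<and> i \<le> a) \<or> (L - b \<le> i \<and> i \<le> L - 1))
        \<and> 1 \<le> t \<and> t \<le> \<Delta> - 2}" unfolding C_stars_def mem_Collect_eq by (rule refl)
    finally show ?thesis unfolding s.edges_def C_edges_def 1 by simp
  qed
  then show "rep k L (C_verts k L \<Delta> a b) (C_edges k L \<Delta> a b) (C_base k L) C_lo C_hi C_u (C_pend k L \<Delta> a b) C_foot"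
    using f s.edges_V[OF f] s.spine_axioms by (simp add: rep_def C_verts_def)
  have "s.tcount C_foot (C_u j) = (if j \<in> C_stars L a b then \<Delta> - 2 else 0)" for j
  proof -
    have "{g\<in>C_pend k L \<Delta> a b. C_foot ` g = {C_u j}}
        = (if j \<in> C_stars L a b then C_leaves k j ` {1..\<Delta> - 2} else {})"
    proof -
      have "C_foot ` C_leaves k i t = {C_u j} \<longleftrightarrow> i = j" if "t \<ge> 1" for i t
        unfolding C_foot_leaves[OF k that] by (simp add: C_u_def)
      then have "{g\<in>C_pend k L \<Delta> a b. C_foot ` g = {C_u j}}
          = (\<lambda>(i, t). C_leaves k i t) ` {(i, t) \<in> C_stars L a b \<times> {1..\<Delta> - 2}. i = j}"
        unfolding C_pend_def by auto
      also have "{(i, t) \<in> C_stars L a b \<times> {1..\<Delta> - 2}. i = j}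
          = (if j \<in> C_stars L a b then (\<lambda>t. (j, t)) ` {1..\<Delta> - 2} else {})" by auto
      finally show ?thesis by (simp add: image_image)
    qed
    moreover have "inj_on (C_leaves k j) {1..\<Delta> - 2}"
    proof (rule inj_onI)
      fix t t' assume "C_leaves k j t = C_leaves k j t'"
      moreover have "(t + 1, j, 1) \<in> C_leaves k j t" using k by (auto simp: C_leaves_def)
      ultimately show "t = t'" by (auto simp: C_leaves_def)
    qed
    ultimately show ?thesis by (simp add: s.tcount_def card_image)
  qed
  moreover have "s.spiny C_foot"
    unfolding s.spiny_def s.V_def by (auto simp: C_pend_def C_leaves_def C_foot_def C_lo_def C_hi_def)
  ultimately show "s.shape \<Delta> a b C_foot" using f ab by (simp add: s.shape_def C_stars_def)
qed

text \<open>The degree conditions of \<open>loose_path\<close> determine the path edges of a vertex: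
  an interior \<open>us ! j\<close> lies in exactly the two edges around it, any other vertex in
  exactly one. This yields \<open>lo\<close> and \<open>hi\<close>; pendant edges enter without
  their roots, and their disjointness off the path makes the foot well defined.\<close>

lemma caterpillar_rep:
  assumes k: "k \<ge> 2" and fin: "finite V" and unif: "uniform k V E" and cat: "caterpillar V E"
  shows "\<exists>L B lo hi u F f. rep k L V E B lo hi u F f"
proof -
  from cat obtain us es where c: "loose_path us es \<and> set es \<subseteq> E \<and>
      V = \<Union>(set es) \<union> \<Union>(E - set es) \<and>
      (\<forall>e\<in>E - set es. \<exists>r. e \<inter> \<Union>(set es) = {r}) \<and>
      (\<forall>e\<in>E - set es. \<forall>e'\<in>E - set es. e \<noteq> e' \<longrightarrow> e \<inter> e' \<subseteq> \<Union>(set es))"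
    unfolding caterpillar_def by (elim exE)
  have lp: "loose_path us es" and esE: "set es \<subseteq> E" and VE: "V = \<Union>(set es) \<union> \<Union>(E - set es)"
    using c by simp_all
  note root = c[THEN conjunct2, THEN conjunct2, THEN conjunct2, THEN conjunct1, rule_format]
  note sep = c[THEN conjunct2, THEN conjunct2, THEN conjunct2, THEN conjunct2, rule_format]
  define L B where "L = length es" and "B = \<Union>(set es)"
  note lp' = lp[unfolded loose_path_def, folded L_def B_def]
  have L: "L \<ge> 1" and len: "length us = Suc L" and dist: "distinct es" using lp' by simp_all
  have mem: "us ! i \<in> es ! i" "us ! Suc i \<in> es ! i" and ne: "us ! i \<noteq> us ! Suc i" if "i < L" for i
    using lp' that by simp_all
  have deg2: "degree (set es) (us ! i) = 2" if "1 \<le> i" "i < L" for i using lp' that by blast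
  note deg1 = lp'[THEN conjunct2, THEN conjunct2, THEN conjunct2, THEN conjunct2, THEN conjunct2,
      THEN conjunct2, rule_format]
  have edge: "finite e" "card e = k" "e \<subseteq> V" if "e \<in> E" for e
    using unif that fin by (auto simp: uniform_def intro: finite_subset)
  have finE: "finite E" using edge(3) fin by (intro finite_subset[of E "Pow V"]) auto
  have esi: "es ! i \<in> E" "es ! i \<subseteq> B" if "i < L" for i
  proof -
    have "es ! i \<in> set es" using that by (simp add: L_def)
    then show "es ! i \<in> E" "es ! i \<subseteq> B" using esE by (auto simp: B_def)
  qed
  have finB: "finite B" using esE edge by (auto simp: B_def)
  define D where "D v = {i. i < L \<and> v \<in> es ! i}" for v
  have cardD: "card (D v) = degree (set es) v" for v
  proof -
    have "{e \<in> set es. v \<in> e} = (!) es ` D v" by (auto simp: D_def L_def in_set_conv_nth)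
    moreover have "inj_on ((!) es) (D v)"
      using dist by (auto simp: D_def L_def inj_on_def nth_eq_iff_index_eq)
    ultimately show ?thesis by (simp add: degree_def card_image)
  qed
  have finD: "finite (D v)" for v by (simp add: D_def)
  have uB: "us ! j \<in> B" if "j \<le> L" for j
  proof (cases "j < L")
    case True
    then show ?thesis using mem(1) esi(2) by blast
  next
    case False
    then have "j = Suc (L - 1)" "L - 1 < L" using that L by auto
    then show ?thesis using mem(2)[of "L - 1"] esi(2)[of "L - 1"] by auto
  qed
  have sub: "{i. i < L \<and> (i = j \<or> Suc i = j)} \<subseteq> D (us ! j)" for j
    using mem by (auto simp: D_def)
  \<comment> \<open>Both edges contain the vertex by \<open>mem\<close>, and degree 2 leaves room
    for no others.\<close>
  have Dint: "D (us ! j) = {j - 1, j}" if j: "1 \<le> j" "j < L" for j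
  proof -
    have "{j - 1, j} \<subseteq> D (us ! j)" using sub[of j] j by auto
    moreover have "card {j - 1, j} = card (D (us ! j))" using deg2[OF j] j by (simp add: cardD)
    ultimately show ?thesis using card_subset_eq[OF finD] by metis
  qed
  have Dus: "D (us ! j) = {i. i < L \<and> (i = j \<or> Suc i = j)}" if j: "j \<le> L" for j
  proof (cases "1 \<le> j \<and> j < L")
    case True
    then have "{i. i < L \<and> (i = j \<or> Suc i = j)} = {j - 1, j}" by auto
    then show ?thesis using Dint True by simp
  next
    case False
    \<comment> \<open>\<open>loose_path\<close> says outright only that consecutive vertices differ.
      If an end coincided with a joint, its edge would be one of the two edges of the joint; the
      joint would then be the neighbour of the end, which \<open>ne\<close> excludes.\<close>
    have "us ! j \<noteq> us ! i" if i: "1 \<le> i" "i < L" for i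
    proof
      assume eq: "us ! j = us ! i"
      consider "j = 0" | "j = L" "j \<noteq> 0" using False j by linarith
      then show False
      proof cases
        case 1
        then have "0 \<in> D (us ! i)" using sub[of 0] L eq by auto
        then have "i = 1" using Dint[OF i] i by auto
        then show False using ne[of 0] eq 1 L by simp
      next
        case 2
        then have "L - 1 \<in> D (us ! i)" using sub[of L] L eq by auto
        then have "Suc i = L" using Dint[OF i] i by auto
        then show False using ne[of i] eq 2 i by simp
      qed
    qed
    then have "card (D (us ! j)) = 1" using deg1[OF uB[OF j]] by (auto simp: cardD)
    then obtain c where c: "D (us ! j) = {c}" by (auto simp: card_1_singleton_iff)
    have "{i. i < L \<and> (i = j \<or> Suc i = j)} \<noteq> {}"
    proof (cases "j = 0")
      case True
      then show ?thesis using L by auto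
    next
      case False
      then have "j - 1 \<in> {i. i < L \<and> (i = j \<or> Suc i = j)}" using j by auto
      then show ?thesis by blast
    qed
    then show ?thesis using c sub[of j] by (metis subset_singleton_iff)
  qed
  have injus: "j = j'" if jj: "j \<le> L" "j' \<le> L" "us ! j = us ! j'" for j j'
  proof -
    have *: False if "j < j'" "j' \<le> L" "us ! j = us ! j'" for j j'
    proof -
      have "j \<in> D (us ! j)" using Dus[of j] that by auto
      then have "j' = Suc j" using Dus[of j'] that by auto
      then show False using ne[of j] that by simp
    qed
    show ?thesis using *[of j j'] *[of j' j] jj by (metis linorder_neqE_nat)
  qed
  define S where "S = (!) us ` {..L}"
  define lo where "lo v = (if v \<in> S then the_inv_into {..L} ((!) us) v else (THE i. D v = {i}))" for v
  define hi where "hi v = (if v \<in> S then lo v else Suc (lo v))" for v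
  have injon: "inj_on ((!) us) {..L}" using injus by (auto simp: inj_on_def)
  have lou: "lo (us ! j) = j" "hi (us ! j) = j" if "j \<le> L" for j
    using that the_inv_into_f_f[OF injon] by (auto simp: lo_def hi_def S_def)
  have DnS: "D v = {lo v}" if v: "v \<in> B" "v \<notin> S" for v
  proof -
    have "v \<notin> {us ! i | i. 1 \<le> i \<and> i < L}" using v(2) by (auto simp: S_def)
    then have "card (D v) = 1" using deg1[OF v(1)] by (simp add: cardD)
    then obtain c where "D v = {c}" by (auto simp: card_1_singleton_iff)
    then show ?thesis using v(2) by (simp add: lo_def)
  qed
  have pathE: "{b\<in>B. i \<le> lo b \<and> hi b \<le> Suc i} = es ! i" if i: "i < L" for i
  proof -
    have "i \<le> lo b \<and> hi b \<le> Suc i \<longleftrightarrow> b \<in> es ! i" if b: "b \<in> B" for b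
    proof (cases "b \<in> S")
      case True
      then obtain j where j: "j \<le> L" "b = us ! j" by (auto simp: S_def)
      have "b \<in> es ! i \<longleftrightarrow> i \<in> D (us ! j)" using i j by (simp add: D_def)
      also have "\<dots> \<longleftrightarrow> i = j \<or> Suc i = j" unfolding Dus[OF j(1)] using i by simp
      finally show ?thesis using lou[OF j(1)] unfolding j(2) by auto
    next
      case False
      have "b \<in> es ! i \<longleftrightarrow> i \<in> D b" using i by (simp add: D_def)
      also have "\<dots> \<longleftrightarrow> i = lo b" unfolding DnS[OF b False] by simp
      finally show ?thesis using False by (auto simp: hi_def)
    qed
    then show ?thesis using esi(2)[OF i] by blast
  qed
  define F where "F = (\<lambda>e. e - B) ` (E - set es)"
  define f where "f y = (if y \<in> B then y else (THE r. \<exists>e\<in>E - set es. y \<in> e \<and> e \<inter> B = {r}))" for y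
  have uniq: "e = e'" if "e \<in> E - set es" "e' \<in> E - set es" "y \<in> e" "y \<in> e'" "y \<notin> B" for e e' y
    using sep[OF that(1,2)] that by (auto simp: B_def)
  have fr: "f y = r" if "e \<in> E - set es" "e \<inter> B = {r}" "y \<in> e" "y \<notin> B" for e r y
  proof -
    have "(THE r. \<exists>e\<in>E - set es. y \<in> e \<and> e \<inter> B = {r}) = r"
    proof (rule the_equality)
      show "\<exists>e\<in>E - set es. y \<in> e \<and> e \<inter> B = {r}" using that by blast
      fix r' assume "\<exists>e\<in>E - set es. y \<in> e \<and> e \<inter> B = {r'}"
      then obtain e' where e': "e' \<in> E - set es" "y \<in> e'" "e' \<inter> B = {r'}" by blast
      then have "e = e'" using uniq[OF that(1) e'(1) that(3) e'(2) that(4)] by simp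
      then show "r' = r" using e'(3) that(2) by auto
    qed
    then show ?thesis using that(4) by (simp add: f_def)
  qed
  have root': "\<exists>r. e \<inter> B = {r}" if "e \<in> E - set es" for e using root[OF that] by (simp add: B_def)
  interpret s: spine k L B lo hi "(!) us" F
  proof
    show "k \<ge> 2" "L \<ge> 1" "finite B" by fact+
    show "finite F" using finE by (simp add: F_def)
    fix b assume b: "b \<in> B"
    show "hi b = lo b \<or> hi b = Suc (lo b)" by (auto simp: hi_def)
    show "hi b \<le> L"
    proof (cases "b \<in> S")
      case True
      then show ?thesis using lou(2) by (auto simp: S_def)
    next
      case False
      have "lo b \<in> D b" using DnS[OF b False] by simp
      then show ?thesis using False by (auto simp: D_def hi_def)
    qed
    show "us ! lo b = b" if "hi b = lo b"
    proof -
      have "b \<in> S" using that by (auto simp: hi_def split: if_splits)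
      then show ?thesis using lou(1) by (auto simp: S_def)
    qed
  next
    show "us ! j \<in> B" "lo (us ! j) = j" "hi (us ! j) = j" if "j \<le> L" for j
      using uB lou that by auto
    show "card {b\<in>B. lo b = i \<and> hi b = Suc i} = k - 2" if i: "i < L" for i
    proof -
      have "{b\<in>B. lo b = i \<and> hi b = Suc i} = es ! i - {us ! i, us ! Suc i}"
      proof (intro equalityI subsetI)
        fix b assume b: "b \<in> {b\<in>B. lo b = i \<and> hi b = Suc i}"
        then show "b \<in> es ! i - {us ! i, us ! Suc i}"
          using lou(2)[of i] lou(1)[of "Suc i"] i unfolding pathE[OF i, symmetric] by auto
      next
        fix b assume b: "b \<in> es ! i - {us ! i, us ! Suc i}"
        have bB: "b \<in> B" using b esi(2)[OF i] by blast
        have le: "i \<le> lo b" "hi b \<le> Suc i" using b unfolding pathE[OF i, symmetric] by auto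
        have "b \<notin> S"
        proof
          assume "b \<in> S"
          then obtain j where j: "j \<le> L" "b = us ! j" by (auto simp: S_def)
          then have "j = i \<or> j = Suc i" using le lou[OF j(1)] by auto
          then show False using b j by auto
        qed
        then show "b \<in> {b\<in>B. lo b = i \<and> hi b = Suc i}" using bB le by (auto simp: hi_def)
      qed
      moreover have "card (es ! i - {us ! i, us ! Suc i}) = card (es ! i) - card {us ! i, us ! Suc i}"
        using mem[OF i] by (intro card_Diff_subset) auto
      ultimately show ?thesis using ne[OF i] edge(2)[OF esi(1)[OF i]] by simp
    qed
    fix g assume "g \<in> F"
    then obtain e where e: "e \<in> E - set es" "g = e - B" by (auto simp: F_def)
    obtain r where r: "e \<inter> B = {r}" using root'[OF e(1)] by blast
    have "g = e - {r}" "r \<in> e" using e(2) r by auto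
    then show "card g = k - 1" using edge(1,2)[of e] e(1) by simp
    show "g \<inter> B = {}" using e by blast
    fix h z assume h: "h \<in> F" "z \<in> g" "z \<in> h"
    then obtain e' where e': "e' \<in> E - set es" "h = e' - B" by (auto simp: F_def)
    have "e = e'" using uniq[OF e(1) e'(1), of z] h e e' by blast
    then show "g = h" using e e' by simp
  qed
  have foot: "s.footed f"
    unfolding s.footed_def
  proof (intro conjI ballI)
    show "f b = b" if "b \<in> B" for b using that by (simp add: f_def)
    fix g assume "g \<in> F"
    then obtain e where e: "e \<in> E - set es" "g = e - B" by (auto simp: F_def)
    obtain r where r: "e \<inter> B = {r}" using root'[OF e(1)] by blast
    then have "\<forall>z\<in>g. f z = r" using fr[OF e(1) r] e(2) by blast
    then show "\<exists>w\<in>B. \<forall>z\<in>g. f z = w" using r by blast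
  qed
  have "s.V = V" unfolding s.V_def unfolding F_def VE B_def by blast
  moreover have "s.edges f = E"
  proof -
    have "s.pathE ` {..<L} = (!) es ` {..<L}"
      unfolding s.pathE_def by (intro image_cong refl) (simp add: pathE)
    also have "\<dots> = set es" by (auto simp: L_def in_set_conv_nth)
    finally have 1: "s.pathE ` {..<L} = set es" .
    have "(\<lambda>g. g \<union> f ` g) ` F = (\<lambda>e. e) ` (E - set es)"
      unfolding F_def image_image
    proof (rule image_cong[OF refl])
      fix e assume e: "e \<in> E - set es"
      obtain r where r: "e \<inter> B = {r}" using root'[OF e] by blast
      have "e - B \<in> F" using e by (auto simp: F_def)
      then obtain y where y: "y \<in> e - B" using s.g_ne by blast
      have "f ` (e - B) = {f y}" by (rule s.foot_image[OF foot \<open>e - B \<in> F\<close> y])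
      moreover have "f y = r" using fr[OF e r] y by blast
      ultimately show "e - B \<union> f ` (e - B) = e" using r by auto
    qed
    then show ?thesis using 1 esE by (auto simp: s.edges_def)
  qed
  ultimately have "rep k L V E B lo hi ((!) us) F f"
    using s.spine_axioms foot by (simp add: rep_def)
  then show ?thesis by blast
qed

section \<open>Maximizers on a fixed vertex set\<close>

definition cat_class :: "nat \<Rightarrow> nat \<Rightarrow> nat \<Rightarrow> nat \<Rightarrow> 'a set \<Rightarrow> 'a set set set" where
  "cat_class k m \<Delta> n V = {E. (\<exists>L B lo hi u F f. rep k L V E B lo hi u F f) \<and> card E = m
     \<and> (\<forall>v\<in>V. degree E v \<le> \<Delta>) \<and> card {v\<in>V. degree E v = \<Delta>} = n}"

lemma rep_V: "rep k L V E B lo hi u F f \<Longrightarrow> \<Union>E = V"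
  unfolding rep_def by (metis spine.edges_V)

lemma rep_length:
  assumes "rep k L V E B lo hi u F f" shows "L \<le> card E"
proof -
  interpret spine k L B lo hi u F using assms by (simp add: rep_def)
  show ?thesis using card_edges[of f] assms by (simp add: rep_def)
qed

text \<open>A path of \<open>E\<close> has at most \<open>m\<close> edges, so a longest one exists
  and supplies \<open>no_longer\<close>. The coordinates found for \<open>E\<close> and those of
  \<open>C\<close> then have the same shape, which determines the hypergraph up to
  isomorphism.\<close>

lemma maximal_iso:
  assumes k: "k \<ge> 2" and \<Delta>: "\<Delta> \<ge> 3" and E: "E \<in> cat_class k m \<Delta> n V"
    and max: "\<And>E'. E' \<in> cat_class k m \<Delta> n V \<Longrightarrow> dist_spectral_radius V E' \<le> dist_spectral_radius V E"
  shows "hg_iso V E (C_verts k (m - n * (\<Delta> - 2)) \<Delta> (n div 2) ((n + 1) div 2))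
    (C_edges k (m - n * (\<Delta> - 2)) \<Delta> (n div 2) ((n + 1) div 2))"
proof -
  let ?P = "\<lambda>L. \<exists>B lo hi u F f. rep k L V E B lo hi u F f"
  have "\<exists>L. ?P L" using E by (simp add: cat_class_def)
  moreover have "\<forall>L. ?P L \<longrightarrow> L \<le> m" using rep_length E by (fastforce simp: cat_class_def)
  ultimately have "?P (Greatest ?P)" and "\<And>L'. ?P L' \<Longrightarrow> L' \<le> Greatest ?P"
    by (blast intro: GreatestI_ex_nat[of ?P m] Greatest_le_nat[of ?P _ m])+
  then obtain L where L: "?P L" and Lmax: "\<And>L'. ?P L' \<Longrightarrow> L' \<le> L" by blast
  interpret extremal k m \<Delta> n L V E
  proof
    show "\<Delta> \<ge> 3" by (rule \<Delta>)
    show "card E = m" "card {v\<in>V. degree E v = \<Delta>} = n" using E by (simp_all add: cat_class_def)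
    show "degree E v \<le> \<Delta>" if "v \<in> V" for v using E that by (simp add: cat_class_def)
    show "\<not> ?P (Suc L)" using Lmax[of "Suc L"] Suc_n_not_le_n by blast
    show "dist_spectral_radius V E' \<le> dist_spectral_radius V E"
      if "rep k L V E' B lo hi u F f" "card E' = m" "\<forall>v\<in>V. degree E' v \<le> \<Delta>"
        "card {v\<in>V. degree E' v = \<Delta>} = n" for L B lo hi u F f E'
      using that by (intro max) (unfold cat_class_def, blast)
  qed
  obtain B lo hi u F f where "rep k L V E B lo hi u F f" using L by blast
  then obtain lo hi u where r: "rep k L V E B lo hi u F f"
    and sh: "spine.shape L B lo hi u F \<Delta> (n div 2) ((n + 1) div 2) f" and Lm: "L = m - n * (\<Delta> - 2)"
    using extremal_shape by blast
  interpret s: spine k L B lo hi u F using r by (simp add: rep_def)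
  have ab: "n div 2 + (n + 1) div 2 < L" using sh by (simp add: s.shape_def)
  from shape_iso[OF r sh C_rep(1)[OF k ab] C_rep(2)[OF k ab]] show ?thesis unfolding Lm .
qed

theorem theorem1:
  fixes k m \<Delta> n :: nat and V :: "'a set" and E :: "'a set set"
  assumes "k \<ge> 2" and "m \<ge> 1" and "\<Delta> \<ge> 3" and "n \<ge> 2"
    and "finite V" and "uniform k V E" and "hypertree V E" and "card E = m"
    and "max_degree V E = \<Delta>" and "card {v\<in>V. degree E v = \<Delta>} = n"
    and "caterpillar V E"
  shows "dist_spectral_radius V E
           \<le> dist_spectral_radius (C_verts k (m - n * (\<Delta> - 2)) \<Delta> (n div 2) ((n + 1) div 2))
                                  (C_edges k (m - n * (\<Delta> - 2)) \<Delta> (n div 2) ((n + 1) div 2))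
      \<and> (dist_spectral_radius V E
           = dist_spectral_radius (C_verts k (m - n * (\<Delta> - 2)) \<Delta> (n div 2) ((n + 1) div 2))
                                  (C_edges k (m - n * (\<Delta> - 2)) \<Delta> (n div 2) ((n + 1) div 2))
         \<longleftrightarrow> hg_iso V E (C_verts k (m - n * (\<Delta> - 2)) \<Delta> (n div 2) ((n + 1) div 2))
                          (C_edges k (m - n * (\<Delta> - 2)) \<Delta> (n div 2) ((n + 1) div 2)))"
proof -
  let ?CV = "C_verts k (m - n * (\<Delta> - 2)) \<Delta> (n div 2) ((n + 1) div 2)"
  let ?CE = "C_edges k (m - n * (\<Delta> - 2)) \<Delta> (n div 2) ((n + 1) div 2)"
  let ?K = "cat_class k m \<Delta> n V"
  have "degree E v \<le> \<Delta>" if "v \<in> V" for v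
    using assms(5,9) that by (auto simp: max_degree_def)
  then have EK: "E \<in> ?K"
    using caterpillar_rep[OF assms(1,5,6,11)] assms(8,10) by (simp add: cat_class_def)
  have KV: "\<Union>E' = V" if "E' \<in> ?K" for E'
  proof -
    obtain L B lo hi u F f where "rep k L V E' B lo hi u F f"
      using \<open>E' \<in> ?K\<close> unfolding cat_class_def by blast
    then show ?thesis by (rule rep_V)
  qed
  have "?K \<subseteq> Pow (Pow V)" using KV by blast
  then have "finite ?K" using assms(5) by (meson finite_Pow_iff finite_subset)
  then have fin: "finite (dist_spectral_radius V ` ?K)" by simp
  have "Max (dist_spectral_radius V ` ?K) \<in> dist_spectral_radius V ` ?K"
    using fin EK by (intro Max_in) auto
  then obtain E0 where E0: "E0 \<in> ?K" "dist_spectral_radius V E0 = Max (dist_spectral_radius V ` ?K)"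
    by auto
  have max: "dist_spectral_radius V E' \<le> dist_spectral_radius V E0" if "E' \<in> ?K" for E'
    using Max_ge[OF fin] that E0(2) by simp
  have "hg_iso V E0 ?CV ?CE" by (rule maximal_iso[OF assms(1,3) E0(1) max])
  then have C: "dist_spectral_radius V E0 = dist_spectral_radius ?CV ?CE"
    using KV[OF E0(1)] by (intro dist_spectral_radius_iso) auto
  have "dist_spectral_radius V E \<le> dist_spectral_radius ?CV ?CE" using max[OF EK] C by simp
  \<comment> \<open>Equality of the radii makes \<open>E\<close> itself a maximizer of the
    class.\<close>
  moreover have "hg_iso V E ?CV ?CE" if eq: "dist_spectral_radius V E = dist_spectral_radius ?CV ?CE"
    by (rule maximal_iso[OF assms(1,3) EK]) (use max C eq in simp)
  moreover have "dist_spectral_radius V E = dist_spectral_radius ?CV ?CE" if "hg_iso V E ?CV ?CE"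
    using that KV[OF EK] by (intro dist_spectral_radius_iso) auto
  ultimately show ?thesis by blast
qed

end
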